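(* Let $n\geq 2$, $1\leq k<n$, and let $\Omega\subset\mathbb{R}^n$ be a smooth bounded convex domain. Let $f\in C^{1,1}(\overline{\Omega}\times\mathbb{R}\times\mathbb{R}^n)$ be a positive function and let $u\in C^4(\overline{\Omega})$ be a convex solution of the Dirichlet problem $$\begin{cases}F(D^2u)=f(x,u,Du) & \text{in }\Omega,\\ u=0 & \text{on }\partial\Omega,\end{cases}$$ where $F=\frac{\sigma_n}{\sigma_{n-k}}$. Let $\lambda_{\min}$ be the smallest eigenvalue of $D^2u$. Then, in $\Omega$, $$\frac{(-u)^\beta}{\lambda_{\min}}\leq C,$$ where $\beta$ and $C$ are positive constants depending only on $n$, $k$, the diameter of $\Omega$, $\|u\|_{C^{0,1}(\overline{\Omega})}$, $\min_{\overline{\Omega}\times[-M,M]\times\overline{B}_M}f$ and $\|f\|_{C^{1,1}(\overline{\Omega}\times[-M,M]\times\overline{B}_M)}$. Here $M$ is a constant satisfying $\|u\|_{C^{0,1}(\overline{\Omega})}\leq M$.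
   Context: For a symmetric $n\times n$ matrix $A$, $\sigma_j(A)$ denotes the $j$-th elementary symmetric function of the eigenvalues of $A$, and $\frac{\sigma_n}{\sigma_{n-k}}(A)=\sigma_n(A)/\sigma_{n-k}(A)$. $B_M\subset\mathbb{R}^n$ is the ball of radius $M$ centered at the origin. *)

theory Defs
  imports "HOL-Analysis.Analysis" "HOL-Computational_Algebra.Polynomial"
begin

section \<open>Elementary symmetric functions of the eigenvalues\<close>

definition char_polynomial :: "real^'n^'n \<Rightarrow> real poly" where
  "char_polynomial A = det (\<chi> i j. (if i = j then [:0, 1:] else 0) - [:A $ i $ j:])"

text \<open>The real eigenvalues, each repeated according to its algebraic multiplicity. For a
  symmetric matrix these are all the eigenvalues, so there are \<open>CARD('n)\<close> of them.\<close>

definition eigvals :: "real^'n^'n \<Rightarrow> real multiset" where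
  "eigvals A = proots (char_polynomial A)"

definition lambda_min :: "real^'n^'n \<Rightarrow> real" where
  "lambda_min A = Min (set_mset (eigvals A))"

definition elem_sym :: "nat \<Rightarrow> real list \<Rightarrow> real" where
  "elem_sym j xs = (\<Sum>I | I \<subseteq> {..<length xs} \<and> card I = j. \<Prod>i\<in>I. xs ! i)"

text \<open>Sorting only serves to enumerate the multiset; \<^const>\<open>elem_sym\<close> does not depend on
  the order.\<close>

definition sigma :: "nat \<Rightarrow> real^'n^'n \<Rightarrow> real" where
  "sigma j A = elem_sym j (sorted_list_of_multiset (eigvals A))"

definition hess_quot :: "nat \<Rightarrow> real^'n^'n \<Rightarrow> real" where
  "hess_quot k A = sigma CARD('n) A / sigma (CARD('n) - k) A"


section \<open>Partial derivatives and function spaces\<close>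

primrec partials :: "'a list \<Rightarrow> ('a::euclidean_space \<Rightarrow> real) \<Rightarrow> 'a \<Rightarrow> real" where
  "partials [] f = f"
| "partials (b # bs) f = (\<lambda>x. frechet_derivative (partials bs f) (at x) b)"

definition grad :: "('a::euclidean_space \<Rightarrow> real) \<Rightarrow> 'a \<Rightarrow> 'a" where
  "grad f x = (\<Sum>b\<in>Basis. partials [b] f x *\<^sub>R b)"

definition hessian :: "(real^'n \<Rightarrow> real) \<Rightarrow> real^'n \<Rightarrow> real^'n^'n" where
  "hessian u x = (\<chi> i j. partials [axis i 1, axis j 1] u x)"

text \<open>In the following two definitions \<open>S\<close> is meant to be open.\<close>

definition Ck_on :: "nat \<Rightarrow> 'a::euclidean_space set \<Rightarrow> ('a \<Rightarrow> real) \<Rightarrow> bool" where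
  "Ck_on k S f \<longleftrightarrow>
     (\<forall>bs. set bs \<subseteq> Basis \<and> length bs \<le> k \<longrightarrow>
        continuous_on S (partials bs f) \<and>
        (length bs < k \<longrightarrow> partials bs f differentiable_on S))"

text \<open>The space of \<open>C\<^sup>k\<close> functions on the closure of \<open>S\<close>: all derivatives of order at most \<open>k\<close>
  in \<open>S\<close> extend continuously to the closure; for order \<open>0\<close> the extension is \<open>f\<close> itself.\<close>

definition Ck_closure :: "nat \<Rightarrow> 'a::euclidean_space set \<Rightarrow> ('a \<Rightarrow> real) \<Rightarrow> bool" where
  "Ck_closure k S f \<longleftrightarrow>
     Ck_on k S f \<and> continuous_on (closure S) f \<and>
     (\<forall>bs. set bs \<subseteq> Basis \<and> length bs \<le> k \<longrightarrow>
        (\<exists>g. continuous_on (closure S) g \<and> (\<forall>x\<in>S. g x = partials bs f x)))"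

definition lip_seminorm :: "'a::metric_space set \<Rightarrow> ('a \<Rightarrow> 'b::metric_space) \<Rightarrow> real" where
  "lip_seminorm S f = Sup {dist (f x) (f y) / dist x y | x y. x \<in> S \<and> y \<in> S \<and> x \<noteq> y}"

definition C01_norm :: "'a::metric_space set \<Rightarrow> ('a \<Rightarrow> real) \<Rightarrow> real" where
  "C01_norm S f = (SUP x\<in>S. \<bar>f x\<bar>) + lip_seminorm S f"

definition C11_norm :: "'a::euclidean_space set \<Rightarrow> ('a \<Rightarrow> real) \<Rightarrow> real" where
  "C11_norm S f = (SUP x\<in>S. \<bar>f x\<bar>) + (SUP x\<in>S. norm (grad f x)) + lip_seminorm S (grad f)"

text \<open>The arguments of \<open>f\<close> are \<open>(x, z, p)\<close>, standing for \<open>(x, u(x), Du(x))\<close>. As the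
  \<open>(z, p)\<close>-space is not compact, the Lipschitz condition on the first derivatives is required
  only for bounded \<open>(z, p)\<close>; it also makes them extend continuously up to \<open>x \<in> \<partial>\<Omega>\<close>.\<close>

definition C11_rhs :: "(real^'n) set \<Rightarrow> ((real^'n) \<times> real \<times> (real^'n) \<Rightarrow> real) \<Rightarrow> bool" where
  "C11_rhs \<Omega> f \<longleftrightarrow>
     Ck_closure 1 (\<Omega> \<times> UNIV \<times> UNIV) f \<and>
     (\<forall>R. \<exists>L. L-lipschitz_on (\<Omega> \<times> {-R..R} \<times> cball 0 R) (grad f))"

text \<open>The minimum is attained, the set being compact and \<open>f\<close> continuous.\<close>

definition rhs_min :: "(real^'n) set \<Rightarrow> real \<Rightarrow> ((real^'n) \<times> real \<times> (real^'n) \<Rightarrow> real) \<Rightarrow> real" where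
  "rhs_min \<Omega> M f = (INF w \<in> closure \<Omega> \<times> {-M..M} \<times> cball 0 M. f w)"

text \<open>The derivatives of \<open>f\<close> are evaluated at \<open>x \<in> \<Omega>\<close> only; by continuity this gives the same
  suprema as their extensions to \<open>closure \<Omega>\<close>.\<close>

definition rhs_norm :: "(real^'n) set \<Rightarrow> real \<Rightarrow> ((real^'n) \<times> real \<times> (real^'n) \<Rightarrow> real) \<Rightarrow> real" where
  "rhs_norm \<Omega> M f = C11_norm (\<Omega> \<times> {-M..M} \<times> cball 0 M) f"


section \<open>Smooth domains\<close>

text \<open>Near each boundary point, \<open>\<Omega>\<close> is the sublevel set of a smooth function without
  critical points.\<close>

definition smooth_boundary :: "'a::euclidean_space set \<Rightarrow> bool" where
  "smooth_boundary \<Omega> \<longleftrightarrow>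
     (\<forall>p\<in>frontier \<Omega>. \<exists>U \<rho>. open U \<and> p \<in> U \<and> (\<forall>k. Ck_on k U \<rho>) \<and>
        (\<forall>x\<in>U. grad \<rho> x \<noteq> 0) \<and> \<Omega> \<inter> U = {x \<in> U. \<rho> x < 0})"

definition smooth_bounded_convex_domain :: "'a::euclidean_space set \<Rightarrow> bool" where
  "smooth_bounded_convex_domain \<Omega> \<longleftrightarrow>
     open \<Omega> \<and> \<Omega> \<noteq> {} \<and> bounded \<Omega> \<and> convex \<Omega> \<and> smooth_boundary \<Omega>"

end

theory Submission
  imports Defs
begin

text \<open>Maximise \<open>(- u)\<^sup>\<beta> exp (A |x - p|\<^sup>2 / 2) / \<lambda>\<^sub>m\<^sub>i\<^sub>n (D\<^sup>2u)\<close> and let \<open>b\<close> be the reciprocals of the eigenvalues of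
  \<open>D\<^sup>2u\<close> at the maximum, so that the equation reads \<open>\<sigma>\<^sub>k(b) = 1 / f\<close>. The second-derivative test,
  weighted by the linearised operator, leaves a quadratic form in the third derivatives of \<open>u\<close>. Its
  off-diagonal part has a sign. On the diagonal, write \<open>\<sigma>\<^sub>k\<close> as \<open>\<sigma>\<^sub>k\<^sub>-\<^sub>1\<close> times \<open>b r + \<sigma>\<^sub>k / \<sigma>\<^sub>k\<^sub>-\<^sub>1\<close>, where \<open>b r\<close> is the
  largest of the \<open>b i\<close> and the symmetric functions are those of the others: the quotient is concave
  and bounded, so \<open>log \<sigma>\<^sub>k\<close> is concave enough to control \<open>u\<^sub>r\<^sub>r\<^sub>r\<close> with a margin depending only on the
  dimension, as soon as \<open>b r\<close> is large. The margin absorbs the gradient of the cut-off for large \<open>\<beta>\<close>,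
  and the term \<open>A |x - p|\<^sup>2 / 2\<close> absorbs the derivatives of \<open>f\<close>, which leaves \<open>- u \<cdot> b r \<le> C\<close>.\<close>

section \<open>Second-order jets of real functions\<close>

text \<open>Two objects resist differentiation. Eigenvalues need not be smooth where they cross, so
  along a line sigma_n and sigma_(n-k) of D^2u are treated as a determinant and as a fixed linear
  combination of determinants det (m I + D^2u), and the smallest eigenvalue as a quadratic form on
  moving test vectors. Second derivatives of f need not exist, so only one-sided comparisons at a
  point of contact are made; \<open>jet2\<close> records just what these need. The constant A comes
  first. The trace of the linearised operator is at least b r / 2, the same growth in b r as the
  terms from the Lipschitz bound on the gradient of f, so A / 2 times the trace beats those terms
  with one b r to spare. Then \<beta> >= 32 n is twice the reciprocal of the margin 1 / (16 n), and
  \<beta> >= 4 A d^2 makes the gradient of the quadratic weight harmless. The squared first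
  derivative of f along the solution, which hides third derivatives of u, needs no bound: it cancels
  between the twice differentiated equation and the third-order estimate. For k = 1 the bound is
  immediate, since b r <= sigma_1(b) = 1 / f.\<close>

definition jet2 :: "(real \<Rightarrow> real) \<Rightarrow> real \<Rightarrow> real \<Rightarrow> real \<Rightarrow> bool" where
  "jet2 g a b c \<longleftrightarrow> (\<exists>g'. (\<forall>\<^sub>F t in nhds 0. (g has_real_derivative g' t) (at t)) \<and>
     g 0 = a \<and> g' 0 = b \<and> (g' has_real_derivative c) (at 0))"

lemma jet2I:
  assumes "\<forall>\<^sub>F t in nhds 0. (g has_real_derivative g' t) (at t)"
    and "g 0 = a" "g' 0 = b" "(g' has_real_derivative c) (at 0)"
  shows "jet2 g a b c"
  using assms unfolding jet2_def by blast

lemma jet2_const: "jet2 (\<lambda>t. a) a 0 0"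
  by (rule jet2I[where g' = "\<lambda>t. 0"]) auto

lemma jet2_linear: "jet2 (\<lambda>t. a + t * b) a b 0"
  by (rule jet2I[where g' = "\<lambda>t. b"]) (auto intro!: derivative_eq_intros always_eventually)

lemma jet2_value: "jet2 g a b c \<Longrightarrow> g 0 = a"
  unfolding jet2_def by blast

lemma jet2_tendsto:
  assumes "jet2 g a b c" shows "(g \<longlongrightarrow> a) (nhds 0)"
proof -
  from assms obtain g1 where
    g: "\<forall>\<^sub>F t in nhds 0. (g has_real_derivative g1 t) (at t)" "g 0 = a"
    unfolding jet2_def by blast
  have "isCont g 0" using g(1) DERIV_isCont eventually_nhds_x_imp_x by blast
  hence "(g \<longlongrightarrow> g 0) (nhds 0)"
    unfolding isCont_def tendsto_at_iff_tendsto_nhds .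
  thus ?thesis using g(2) by simp
qed

lemma jet2_add:
  assumes "jet2 f a b c" "jet2 g a' b' c'"
  shows "jet2 (\<lambda>t. f t + g t) (a + a') (b + b') (c + c')"
proof -
  from assms obtain f1 g1 where
    f: "\<forall>\<^sub>F t in nhds 0. (f has_real_derivative f1 t) (at t)" "f 0 = a" "f1 0 = b"
      "(f1 has_real_derivative c) (at 0)" and
    g: "\<forall>\<^sub>F t in nhds 0. (g has_real_derivative g1 t) (at t)" "g 0 = a'" "g1 0 = b'"
      "(g1 has_real_derivative c') (at 0)"
    unfolding jet2_def by blast
  show ?thesis
  proof (rule jet2I[where g' = "\<lambda>t. f1 t + g1 t"])
    show "\<forall>\<^sub>F t in nhds 0. ((\<lambda>t. f t + g t) has_real_derivative f1 t + g1 t) (at t)"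
      using f(1) g(1) by eventually_elim (rule DERIV_add)
    show "((\<lambda>t. f1 t + g1 t) has_real_derivative c + c') (at 0)"
      using f(4) g(4) by (rule DERIV_add)
  qed (simp_all add: f g)
qed

lemma jet2_mult:
  assumes "jet2 f a b c" "jet2 g a' b' c'"
  shows "jet2 (\<lambda>t. f t * g t) (a * a') (b * a' + a * b') (c * a' + 2 * b * b' + a * c')"
proof -
  from assms obtain f1 g1 where
    f: "\<forall>\<^sub>F t in nhds 0. (f has_real_derivative f1 t) (at t)" "f 0 = a" "f1 0 = b"
      "(f1 has_real_derivative c) (at 0)" and
    g: "\<forall>\<^sub>F t in nhds 0. (g has_real_derivative g1 t) (at t)" "g 0 = a'" "g1 0 = b'"
      "(g1 has_real_derivative c') (at 0)"
    unfolding jet2_def by blast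
  have f0: "(f has_real_derivative b) (at 0)" and g0: "(g has_real_derivative b') (at 0)"
    using f(1,3) g(1,3) eventually_nhds_x_imp_x by blast+
  show ?thesis
  proof (rule jet2I[where g' = "\<lambda>t. f1 t * g t + f t * g1 t"])
    show "\<forall>\<^sub>F t in nhds 0. ((\<lambda>t. f t * g t) has_real_derivative f1 t * g t + f t * g1 t) (at t)"
      using f(1) g(1) by eventually_elim (auto intro!: derivative_eq_intros)
    show "((\<lambda>t. f1 t * g t + f t * g1 t) has_real_derivative c * a' + 2 * b * b' + a * c') (at 0)"
      by (rule derivative_eq_intros f(4) g(4) f0 g0 refl)+ (simp add: f g)
  qed (simp_all add: f g)
qed

lemma jet2_cmult: "jet2 f a b c \<Longrightarrow> jet2 (\<lambda>t. k * f t) (k * a) (k * b) (k * c)"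
  using jet2_mult[OF jet2_const[of k]] by simp

lemma jet2_cong:
  assumes "jet2 f a b c" "\<forall>\<^sub>F t in nhds 0. f t = g t"
  shows "jet2 g a b c"
proof -
  from assms(1) obtain f1 where
    f: "\<forall>\<^sub>F t in nhds 0. (f has_real_derivative f1 t) (at t)" "f 0 = a" "f1 0 = b"
      "(f1 has_real_derivative c) (at 0)"
    unfolding jet2_def by blast
  have "\<forall>\<^sub>F t in nhds 0. \<forall>\<^sub>F s in nhds t. f s = g s"
    using assms(2) by (simp add: eventually_eventually)
  hence "\<forall>\<^sub>F t in nhds 0. (g has_real_derivative f1 t) (at t)"
    using f(1) by eventually_elim (metis DERIV_cong_ev)
  moreover have "g 0 = a" using f(2) eventually_nhds_x_imp_x[OF assms(2)] by simp
  ultimately show ?thesis using f by (intro jet2I)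
qed

text \<open>The second-derivative test at a minimum with value 0. Were c < 0, the derivative would
  be negative just to the right of 0 and the mean value theorem would push g below 0.\<close>

lemma jet2_nonneg:
  assumes "jet2 g 0 b c" "\<forall>\<^sub>F t in nhds 0. g t \<ge> 0"
  shows "b = 0" "c \<ge> 0"
proof -
  from assms(1) obtain g1 where
    g: "\<forall>\<^sub>F t in nhds 0. (g has_real_derivative g1 t) (at t)" "g 0 = 0" "g1 0 = b"
      "(g1 has_real_derivative c) (at 0)"
    unfolding jet2_def by blast
  have g0: "(g has_real_derivative b) (at 0)"
    using g(1,3) eventually_nhds_x_imp_x by blast
  from eventually_conj[OF g(1) assms(2)] obtain d where d: "d > 0"
    "\<And>t. \<bar>t\<bar> < d \<Longrightarrow> (g has_real_derivative g1 t) (at t) \<and> g t \<ge> 0"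
    unfolding eventually_nhds_metric by (auto simp: dist_real_def)
  show b: "b = 0"
    using DERIV_local_min[OF g0 d(1)] d(2) g(2) by simp
  show "c \<ge> 0"
  proof (rule ccontr)
    assume "\<not> c \<ge> 0"
    hence "c < 0" by simp
    from DERIV_neg_dec_right[OF g(4) this] obtain e where e: "e > 0"
      "\<And>h. 0 < h \<Longrightarrow> h < e \<Longrightarrow> g1 h < 0" using g(3) b by auto
    define h where "h = min d e / 2"
    have h: "0 < h" "h < d" "h < e" using d(1) e(1) by (auto simp: h_def min_def)
    have "\<exists>z. 0 < z \<and> z < h \<and> g h - g 0 = (h - 0) * g1 z"
      by (rule MVT2) (use h d(2) in auto)
    then obtain z where z: "0 < z" "z < h" "g h = h * g1 z" using g(2) by auto
    have "g1 z < 0" using e(2) z h by auto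
    hence "g h < 0" using z h by (simp add: mult_pos_neg)
    thus False using d(2)[of h] h by auto
  qed
qed

text \<open>The function g - g is identically 0, hence nonnegative; the second-derivative test
  applied to the difference of the two jets, in both orders, forces equality.\<close>

lemma jet2_unique:
  assumes "jet2 g a b c" "jet2 g a' b' c'"
  shows "a = a'" "b = b'" "c = c'"
proof -
  have e: "a = a'" using assms jet2_value by blast
  have 1: "jet2 (\<lambda>t. g t + (-1) * g t) (a + (-1) * a') (b + (-1) * b') (c + (-1) * c')"
    by (intro jet2_add jet2_cmult assms)
  have 2: "jet2 (\<lambda>t. g t + (-1) * g t) (a' + (-1) * a) (b' + (-1) * b) (c' + (-1) * c)"
    by (intro jet2_add jet2_cmult assms)
  show "a = a'" by fact
  show "b = b'" using jet2_nonneg[of "\<lambda>t. g t + (-1) * g t" "b + (-1) * b'"] 1 e by simp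
  show "c = c'" using jet2_nonneg(2)[of "\<lambda>t. g t + (-1) * g t" "b + (-1) * b'" "c + (-1) * c'"]
    jet2_nonneg(2)[of "\<lambda>t. g t + (-1) * g t" "b' + (-1) * b" "c' + (-1) * c"] 1 2 e by simp
qed

lemma jet2_reflect:
  assumes "jet2 g a b c" shows "jet2 (\<lambda>t. g (- t)) a (- b) c"
proof -
  from assms obtain g1 where
    g: "\<forall>\<^sub>F t in nhds 0. (g has_real_derivative g1 t) (at t)" "g 0 = a" "g1 0 = b"
      "(g1 has_real_derivative c) (at 0)"
    unfolding jet2_def by blast
  have m: "((\<lambda>t. f (- t)) has_real_derivative - D) (at t)"
    if "(f has_real_derivative D) (at (- t))" for f :: "real \<Rightarrow> real" and D t
    using DERIV_chain'[OF DERIV_minus[OF DERIV_ident] that] by simp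
  have "filterlim (\<lambda>t::real. - t) (nhds 0) (nhds 0)"
    using tendsto_minus[OF filterlim_ident[of "nhds (0::real)"]] by simp
  from eventually_compose_filterlim[OF g(1) this]
  have "\<forall>\<^sub>F t in nhds 0. ((\<lambda>t. g (- t)) has_real_derivative - g1 (- t)) (at t)"
    by eventually_elim (rule m)
  moreover have "((\<lambda>t. - g1 (- t)) has_real_derivative c) (at 0)"
    using DERIV_minus[OF m[of g1 c 0]] g(4) by simp
  ultimately show ?thesis using g by (intro jet2I) auto
qed

lemma jet2_inverse:
  assumes "jet2 g a b c" "a \<noteq> 0"
  shows "jet2 (\<lambda>t. inverse (g t)) (inverse a)
    (- b * (inverse a)\<^sup>2) (2 * b\<^sup>2 * inverse a ^ 3 - c * (inverse a)\<^sup>2)"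
proof -
  from assms obtain g1 where
    g: "\<forall>\<^sub>F t in nhds 0. (g has_real_derivative g1 t) (at t)" "g 0 = a" "g1 0 = b"
      "(g1 has_real_derivative c) (at 0)"
    unfolding jet2_def by blast
  have g0: "(g has_real_derivative b) (at 0)"
    using g(1,3) eventually_nhds_x_imp_x by blast
  have "(g \<longlongrightarrow> a) (nhds 0)" using assms(1) by (rule jet2_tendsto)
  hence "\<forall>\<^sub>F t in nhds 0. g t \<noteq> 0" using assms(2) by (rule tendsto_imp_eventually_ne)
  with g(1) have "\<forall>\<^sub>F t in nhds 0. ((\<lambda>t. inverse (g t)) has_real_derivative - g1 t * (inverse (g t))\<^sup>2) (at t)"
    by eventually_elim (auto intro!: derivative_eq_intros simp: power2_eq_square)
  moreover have "((\<lambda>t. - g1 t * (inverse (g t))\<^sup>2) has_real_derivative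
      2 * b\<^sup>2 * inverse a ^ 3 - c * (inverse a)\<^sup>2) (at 0)"
    using DERIV_mult[OF DERIV_minus[OF g(4)] DERIV_power[OF DERIV_inverse'[OF g0], of 2]] assms(2)
    by (simp add: g(2,3) power2_eq_square power3_eq_cube algebra_simps)
  ultimately show ?thesis using g by (intro jet2I) auto
qed

text \<open>The derivatives q and r of the quotient are given implicitly, by the Leibniz rule for
  quotient times g = f. Later computations cancel products in this form and never meet an explicit
  quotient rule.\<close>

lemma jet2_divide:
  assumes "jet2 f a b c" "jet2 g a' b' c'" "a' \<noteq> 0"
  obtains q r where "jet2 (\<lambda>t. f t / g t) (a / a') q r"
    "b = q * a' + (a / a') * b'" "c = r * a' + 2 * q * b' + (a / a') * c'"
proof -
  obtain q r where j: "jet2 (\<lambda>t. f t * inverse (g t)) (a * inverse a') q r"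
    using jet2_mult[OF assms(1) jet2_inverse[OF assms(2,3)]] by blast
  have m: "jet2 (\<lambda>t. f t * inverse (g t) * g t) (a * inverse a' * a') (q * a' + a * inverse a' * b')
     (r * a' + 2 * q * b' + a * inverse a' * c')"
    by (rule jet2_mult[OF j assms(2)])
  have "(g \<longlongrightarrow> a') (nhds 0)" using assms(2) by (rule jet2_tendsto)
  hence "\<forall>\<^sub>F t in nhds 0. g t \<noteq> 0" using assms(3) by (rule tendsto_imp_eventually_ne)
  hence "\<forall>\<^sub>F t in nhds 0. f t * inverse (g t) * g t = f t" by eventually_elim simp
  from jet2_unique[OF jet2_cong[OF m this] assms(1)] j show ?thesis
    by (intro that[of q r]) (simp_all add: field_simps)
qed

lemma jet2_ln:
  assumes "jet2 g a b c" "a > 0"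
  shows "jet2 (\<lambda>t. ln (g t)) (ln a) (b / a) (c / a - (b / a)^2)"
proof -
  from assms obtain g1 where
    g: "\<forall>\<^sub>F t in nhds 0. (g has_real_derivative g1 t) (at t)" "g 0 = a" "g1 0 = b"
      "(g1 has_real_derivative c) (at 0)"
    unfolding jet2_def by blast
  have g0: "(g has_real_derivative b) (at 0)"
    using g(1,3) eventually_nhds_x_imp_x by blast
  have "(g \<longlongrightarrow> a) (nhds 0)" using assms(1) by (rule jet2_tendsto)
  hence "\<forall>\<^sub>F t in nhds 0. g t > 0" using assms(2) by (rule order_tendstoD)
  with g(1) have "\<forall>\<^sub>F t in nhds 0. ((\<lambda>t. ln (g t)) has_real_derivative g1 t / g t) (at t)"
    by eventually_elim (auto intro!: derivative_eq_intros simp: field_simps)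
  moreover have "((\<lambda>t. g1 t / g t) has_real_derivative c / a - (b / a)^2) (at 0)"
    by (rule derivative_eq_intros g(4) g0 refl | simp add: g(2))+
      (use assms in \<open>simp_all add: g field_simps power2_eq_square\<close>)
  ultimately show ?thesis using g by (intro jet2I) auto
qed

lemma jet2_exp:
  assumes "jet2 g a b c"
  shows "jet2 (\<lambda>t. exp (g t)) (exp a) (exp a * b) (exp a * (c + b^2))"
proof -
  from assms obtain g1 where
    g: "\<forall>\<^sub>F t in nhds 0. (g has_real_derivative g1 t) (at t)" "g 0 = a" "g1 0 = b"
      "(g1 has_real_derivative c) (at 0)"
    unfolding jet2_def by blast
  have g0: "(g has_real_derivative b) (at 0)"
    using g(1,3) eventually_nhds_x_imp_x by blast
  have "\<forall>\<^sub>F t in nhds 0. ((\<lambda>t. exp (g t)) has_real_derivative exp (g t) * g1 t) (at t)"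
    using g(1) by eventually_elim (auto intro!: derivative_eq_intros)
  moreover have "((\<lambda>t. exp (g t) * g1 t) has_real_derivative exp a * (c + b^2)) (at 0)"
    by (rule derivative_eq_intros g(4) g0 refl)+ (simp add: g algebra_simps power2_eq_square)
  ultimately show ?thesis using g by (intro jet2I) auto
qed

lemma jet2_sum:
  assumes "finite I" "\<And>i. i \<in> I \<Longrightarrow> jet2 (f i) (a i) (b i) (c i)"
  shows "jet2 (\<lambda>t. \<Sum>i\<in>I. f i t) (\<Sum>i\<in>I. a i) (\<Sum>i\<in>I. b i) (\<Sum>i\<in>I. c i)"
  using assms
proof (induction I rule: finite_induct)
  case empty
  show ?case using jet2_const[of 0] by simp
next
  case (insert i I)
  then show ?case by (simp add: jet2_add)
qed

lemma jet2_prod: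
  assumes "finite I" "\<And>i. i \<in> I \<Longrightarrow> jet2 (f i) (a i) (b i) (c i)"
  shows "jet2 (\<lambda>t. \<Prod>i\<in>I. f i t) (\<Prod>i\<in>I. a i) (\<Sum>i\<in>I. b i * (\<Prod>l\<in>I-{i}. a l))
    ((\<Sum>i\<in>I. c i * (\<Prod>l\<in>I-{i}. a l)) +
     (\<Sum>i\<in>I. \<Sum>j\<in>I-{i}. b i * b j * (\<Prod>l\<in>I-{i}-{j}. a l)))"
  using assms
proof (induction I rule: finite_induct)
  case empty
  show ?case using jet2_const[of 1] by simp
next
  case (insert x I)
  let ?P = "\<lambda>J. \<Prod>l\<in>J. a l"
  have A: "?P (insert x I - {i}) = a x * ?P (I - {i})" if "i \<in> I" for i
  proof -
    have "insert x I - {i} = insert x (I - {i})" using that insert.hyps by auto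
    thus ?thesis using insert.hyps by simp
  qed
  have B: "?P (insert x I - {i} - {j}) = a x * ?P (I - {i} - {j})" if "i \<in> I" "j \<in> I" for i j
  proof -
    have "insert x I - {i} - {j} = insert x (I - {i} - {j})" using that insert.hyps by auto
    thus ?thesis using insert.hyps by simp
  qed
  have C: "insert x I - {x} = I" using insert.hyps by auto
  have D: "(\<Sum>j\<in>insert x I - {i}. b i * b j * ?P (insert x I - {i} - {j}))
      = b i * b x * ?P (I - {i}) + a x * (\<Sum>j\<in>I - {i}. b i * b j * ?P (I - {i} - {j}))"
    if i: "i \<in> I" for i
  proof -
    have e: "insert x I - {i} = insert x (I - {i})" using i insert.hyps by auto
    have "(\<Sum>j\<in>insert x I - {i}. b i * b j * ?P (insert x I - {i} - {j}))
      = b i * b x * ?P (insert x I - {i} - {x}) + (\<Sum>j\<in>I - {i}. b i * b j * ?P (insert x I - {i} - {j}))"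
      unfolding e using insert.hyps by (subst sum.insert) auto
    also have "insert x I - {i} - {x} = I - {i}" using i insert.hyps by auto
    also have "(\<Sum>j\<in>I - {i}. b i * b j * ?P (insert x I - {i} - {j}))
      = (\<Sum>j\<in>I - {i}. b i * b j * (a x * ?P (I - {i} - {j})))"
      using B i by (intro sum.cong refl) auto
    finally show ?thesis by (simp add: sum_distrib_left mult_ac)
  qed
  have 1: "jet2 (\<lambda>t. f x t * (\<Prod>i\<in>I. f i t)) (a x * ?P I)
     (b x * ?P I + a x * (\<Sum>i\<in>I. b i * ?P (I - {i})))
     (c x * ?P I + 2 * b x * (\<Sum>i\<in>I. b i * ?P (I - {i})) + a x * ((\<Sum>i\<in>I. c i * ?P (I-{i})) +
       (\<Sum>i\<in>I. \<Sum>j\<in>I-{i}. b i * b j * ?P (I-{i}-{j}))))"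
    using insert by (intro jet2_mult) auto
  have 2: "(\<Sum>i\<in>insert x I. b i * ?P (insert x I - {i})) = b x * ?P I + a x * (\<Sum>i\<in>I. b i * ?P (I - {i}))" for b
    using insert.hyps A by (simp add: C sum_distrib_left mult_ac cong: sum.cong)
  have 3: "(\<Sum>i\<in>insert x I. \<Sum>j\<in>insert x I-{i}. b i * b j * ?P (insert x I-{i}-{j})) =
     2 * b x * (\<Sum>i\<in>I. b i * ?P (I - {i})) + a x * (\<Sum>i\<in>I. \<Sum>j\<in>I-{i}. b i * b j * ?P (I-{i}-{j}))"
    using insert.hyps D by (simp add: C sum_distrib_left sum.distrib mult_ac cong: sum.cong)
  show ?case
    unfolding 2 3 using 1 insert.hyps by (simp add: algebra_simps)
qed

section \<open>Elementary symmetric functions and their quotients\<close>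

text \<open>The index is an integer so that the recursion \<open>esym_insert\<close> also holds at the bottom, where
  \<open>esym m\<close> vanishes for negative \<open>m\<close>.\<close>

definition esym :: "int \<Rightarrow> 'a set \<Rightarrow> ('a \<Rightarrow> real) \<Rightarrow> real" where
  "esym m I b = (\<Sum>J | J \<subseteq> I \<and> int (card J) = m. \<Prod>i\<in>J. b i)"

lemma esym_neg: "m < 0 \<Longrightarrow> esym m I b = 0"
  unfolding esym_def by (rule sum.neutral) auto

lemma esym_0: "finite I \<Longrightarrow> esym 0 I b = 1"
proof -
  assume "finite I"
  hence "{J. J \<subseteq> I \<and> int (card J) = 0} = {{}}" by (auto dest: finite_subset)
  thus ?thesis by (simp add: esym_def)
qed

lemma esym_empty: "esym m {} b = (if m = 0 then 1 else 0)"
proof -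
  have "{J. J \<subseteq> ({} :: 'a set) \<and> int (card J) = m} = (if m = 0 then {{}} else {})" by auto
  thus ?thesis by (simp add: esym_def)
qed

lemma esym_insert:
  assumes "finite I" "x \<notin> I"
  shows "esym m (insert x I) b = esym m I b + b x * esym (m - 1) I b"
proof -
  let ?S = "\<lambda>m. {J. J \<subseteq> I \<and> int (card J) = m}"
  have S: "{J. J \<subseteq> insert x I \<and> int (card J) = m} = ?S m \<union> insert x ` ?S (m - 1)"
  proof (intro set_eqI iffI)
    fix J assume J: "J \<in> {J. J \<subseteq> insert x I \<and> int (card J) = m}"
    hence f: "finite J" using assms(1) finite_subset by auto
    show "J \<in> ?S m \<union> insert x ` ?S (m - 1)"
    proof (cases "x \<in> J")
      case True
      have "int (card (J - {x})) = m - 1" using True J f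
        using card_Suc_Diff1[OF f True] by simp
      hence "J - {x} \<in> ?S (m - 1)" using J by blast
      moreover have "J = insert x (J - {x})" using True by auto
      ultimately show ?thesis by blast
    qed (use J in auto)
  next
    fix J assume "J \<in> ?S m \<union> insert x ` ?S (m - 1)"
    thus "J \<in> {J. J \<subseteq> insert x I \<and> int (card J) = m}"
    proof
      assume "J \<in> insert x ` ?S (m - 1)"
      then obtain J' where J': "J' \<subseteq> I" "int (card J') = m - 1" "J = insert x J'" by auto
      have "finite J'" "x \<notin> J'" using J' assms finite_subset by auto
      thus ?thesis using J' by auto
    qed auto
  qed
  have fin: "finite (?S m)" for m by (rule finite_subset[of _ "Pow I"]) (use assms in auto)
  have inj: "inj_on (insert x) (?S (m - 1))" using assms(2) by (auto simp: inj_on_def)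
  have "esym m (insert x I) b = (\<Sum>J\<in>?S m. prod b J) + (\<Sum>J\<in>insert x ` ?S (m - 1). prod b J)"
    unfolding esym_def S using fin assms(2) by (intro sum.union_disjoint) auto
  also have "(\<Sum>J\<in>insert x ` ?S (m - 1). prod b J) = (\<Sum>J\<in>?S (m - 1). prod b (insert x J))"
    using sum.reindex[OF inj, of "prod b"] by simp
  also have "\<dots> = (\<Sum>J\<in>?S (m - 1). b x * prod b J)"
  proof (rule sum.cong[OF refl])
    fix J assume J: "J \<in> ?S (m - 1)"
    hence "finite J" "x \<notin> J" using assms finite_subset by auto
    thus "prod b (insert x J) = b x * prod b J" by simp
  qed
  finally show ?thesis by (simp add: esym_def sum_distrib_left)
qed

lemma esym_remove:
  assumes "finite I" "x \<in> I"
  shows "esym m I b = esym m (I - {x}) b + b x * esym (m - 1) (I - {x}) b"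
  using esym_insert[of "I - {x}" x m b] assms by (simp add: insert_absorb)

lemma esym_nonneg: "(\<And>i. i \<in> I \<Longrightarrow> b i \<ge> 0) \<Longrightarrow> esym m I b \<ge> 0"
  unfolding esym_def by (intro sum_nonneg prod_nonneg) auto

lemma esym_pos:
  assumes "finite I" "\<And>i. i \<in> I \<Longrightarrow> b i > 0" "0 \<le> m" "m \<le> int (card I)"
  shows "esym m I b > 0"
proof -
  obtain J where J: "J \<subseteq> I" "card J = nat m"
    using obtain_subset_with_card_n[of "nat m" I] assms(4) by (metis nat_le_iff)
  show ?thesis unfolding esym_def
  proof (rule sum_pos2[of _ J])
    show "finite {J. J \<subseteq> I \<and> int (card J) = m}"
      by (rule finite_subset[of _ "Pow I"]) (use assms in auto)
  qed (use J assms in \<open>auto intro!: prod_pos prod_nonneg less_imp_le\<close>)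
qed

lemma esym_gt_card:
  assumes "finite I" "m > int (card I)"
  shows "esym m I b = 0"
  unfolding esym_def
proof (rule sum.neutral, safe)
  fix J assume "J \<subseteq> I" "m = int (card J)"
  thus "prod b J = 0" using card_mono[OF assms(1), of J] assms(2) by simp
qed

lemma esym_card: 
  assumes "finite I" shows "esym (int (card I)) I b = prod b I"
proof -
  have "{J. J \<subseteq> I \<and> card J = card I} = {I}" using assms card_subset_eq by auto
  thus ?thesis by (simp add: esym_def)
qed

lemma esym_scale: "esym m I (\<lambda>i. c * b i) = c ^ nat m * esym m I b"
  unfolding esym_def sum_distrib_left
  by (rule sum.cong) (auto simp: prod.distrib)

text \<open>\<open>esym (m - 1) (I - {i}) b\<close> is the partial derivative of sigma_m in
  \<open>b i\<close>, so this is Euler's identity for a form of degree m.\<close>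

lemma esym_euler:
  assumes "finite I"
  shows "(\<Sum>i\<in>I. b i * esym (m - 1) (I - {i}) b) = of_int m * esym m I b"
  using assms
proof (induction I arbitrary: m rule: finite_induct)
  case empty
  show ?case by (simp add: esym_empty)
next
  case (insert x I)
  have e: "insert x I - {i} = insert x (I - {i})" if "i \<in> I" for i using that insert by auto
  have "(\<Sum>i\<in>I. b i * esym (m - 1) (insert x I - {i}) b)
      = (\<Sum>i\<in>I. b i * esym (m - 1) (I - {i}) b + b x * (b i * esym (m - 1 - 1) (I - {i}) b))"
    using insert.hyps by (intro sum.cong refl) (simp add: e esym_insert algebra_simps)
  also have "\<dots> = of_int m * esym m I b + b x * (of_int (m - 1) * esym (m - 1) I b)"
    by (simp only: sum.distrib sum_distrib_left[symmetric] insert.IH)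
  finally show ?case using insert.hyps by (simp add: esym_insert algebra_simps)
qed

text \<open>sigma_m is affine in each variable separately; this is why the second derivative has
  only pairs i \<noteq> j.\<close>

lemma jet2_esym:
  assumes "finite I"
  shows "jet2 (\<lambda>t. esym m I (\<lambda>i. b i + t * Y i)) (esym m I b)
    (\<Sum>i\<in>I. Y i * esym (m - 1) (I - {i}) b)
    (\<Sum>i\<in>I. \<Sum>j\<in>I-{i}. Y i * Y j * esym (m - 2) (I - {i} - {j}) b)"
  using assms
proof (induction I arbitrary: m rule: finite_induct)
  case empty
  show ?case by (simp add: esym_empty jet2_const)
next
  case (insert x I)
  let ?E = "\<lambda>m J. esym m J b"
  have e: "insert x I - {i} = insert x (I - {i})" if "i \<in> I" for i using that insert by auto
  have A: "?E m (insert x I - {i}) = ?E m (I - {i}) + b x * ?E (m - 1) (I - {i})" if "i \<in> I" for i m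
    using that insert.hyps by (simp add: e esym_insert)
  have B: "?E m (insert x I - {i} - {j}) = ?E m (I - {i} - {j}) + b x * ?E (m - 1) (I - {i} - {j})"
    if "i \<in> I" "j \<in> I" for i j m
  proof -
    have "insert x I - {i} - {j} = insert x (I - {i} - {j})" using that insert.hyps by auto
    thus ?thesis using insert.hyps by (simp add: esym_insert)
  qed
  have C: "insert x I - {x} = I" using insert.hyps by auto
  let ?D = "\<lambda>m. \<Sum>i\<in>I. Y i * ?E (m - 1) (I - {i})"
  let ?DD = "\<lambda>m. \<Sum>i\<in>I. \<Sum>j\<in>I-{i}. Y i * Y j * ?E (m - 2) (I - {i} - {j})"
  have D: "(\<Sum>j\<in>insert x I - {i}. Y i * Y j * ?E (m - 2) (insert x I - {i} - {j}))
      = Y x * (Y i * ?E (m - 1 - 1) (I - {i})) + ((\<Sum>j\<in>I - {i}. Y i * Y j * ?E (m - 2) (I - {i} - {j}))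
        + b x * (\<Sum>j\<in>I - {i}. Y i * Y j * ?E (m - 1 - 2) (I - {i} - {j})))"
    if i: "i \<in> I" for i
  proof -
    have "(\<Sum>j\<in>insert x I - {i}. Y i * Y j * ?E (m - 2) (insert x I - {i} - {j}))
      = Y i * Y x * ?E (m - 2) (insert x I - {i} - {x}) + (\<Sum>j\<in>I - {i}. Y i * Y j * ?E (m - 2) (insert x I - {i} - {j}))"
      unfolding e[OF i] using insert.hyps by (subst sum.insert) auto
    also have "insert x I - {i} - {x} = I - {i}" using i insert.hyps by auto
    also have "(\<Sum>j\<in>I - {i}. Y i * Y j * ?E (m - 2) (insert x I - {i} - {j}))
      = (\<Sum>j\<in>I - {i}. Y i * Y j * ?E (m - 2) (I - {i} - {j}) + b x * (Y i * Y j * ?E (m - 1 - 2) (I - {i} - {j})))"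
      using B i by (intro sum.cong refl) (auto simp: algebra_simps)
    finally show ?thesis by (simp add: sum_distrib_left sum.distrib mult_ac)
  qed
  have 1: "jet2 (\<lambda>t. esym m I (\<lambda>i. b i + t * Y i) + (b x + t * Y x) * esym (m - 1) I (\<lambda>i. b i + t * Y i))
     (?E m I + b x * ?E (m - 1) I)
     (?D m + (Y x * ?E (m - 1) I + b x * ?D (m - 1)))
     (?DD m + (0 * ?E (m - 1) I + 2 * Y x * ?D (m - 1) + b x * ?DD (m - 1)))"
    by (intro jet2_add jet2_mult jet2_linear insert.IH)
  have 2: "(\<Sum>i\<in>insert x I. Y i * ?E (m - 1) (insert x I - {i})) = ?D m + (Y x * ?E (m - 1) I + b x * ?D (m - 1))"
    using insert.hyps A by (simp add: C sum_distrib_left sum.distrib algebra_simps cong: sum.cong)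
  have 3: "(\<Sum>i\<in>insert x I. \<Sum>j\<in>insert x I-{i}. Y i * Y j * ?E (m - 2) (insert x I-{i}-{j})) =
     ?DD m + (0 * ?E (m - 1) I + 2 * Y x * ?D (m - 1) + b x * ?DD (m - 1))"
  proof -
    have "(\<Sum>i\<in>insert x I. \<Sum>j\<in>insert x I-{i}. Y i * Y j * ?E (m - 2) (insert x I-{i}-{j})) =
      (\<Sum>j\<in>I. Y x * Y j * ?E (m - 1 - 1) (I - {j})) + 
      (\<Sum>i\<in>I. \<Sum>j\<in>insert x I-{i}. Y i * Y j * ?E (m - 2) (insert x I-{i}-{j}))"
      using insert.hyps by (simp add: C)
    also have "(\<Sum>i\<in>I. \<Sum>j\<in>insert x I-{i}. Y i * Y j * ?E (m - 2) (insert x I-{i}-{j}))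
      = (\<Sum>i\<in>I. Y x * (Y i * ?E (m - 1 - 1) (I - {i})) + ((\<Sum>j\<in>I - {i}. Y i * Y j * ?E (m - 2) (I - {i} - {j}))
        + b x * (\<Sum>j\<in>I - {i}. Y i * Y j * ?E (m - 1 - 2) (I - {i} - {j}))))"
      by (intro sum.cong refl D)
    also have "\<dots> = Y x * ?D (m - 1) + (?DD m + b x * ?DD (m - 1))"
      by (simp only: sum.distrib sum_distrib_left[symmetric])
    also have "(\<Sum>j\<in>I. Y x * Y j * ?E (m - 1 - 1) (I - {j})) = Y x * ?D (m - 1)"
      by (simp add: sum_distrib_left mult.assoc)
    finally show ?thesis by simp
  qed
  have 4: "esym m (insert x I) (\<lambda>i. b i + t * Y i) = esym m I (\<lambda>i. b i + t * Y i) 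
     + (b x + t * Y x) * esym (m - 1) I (\<lambda>i. b i + t * Y i)" for t
    using insert.hyps by (simp add: esym_insert)
  show ?case unfolding 4 2 3 esym_insert[OF insert.hyps] by (rule 1)
qed

text \<open>The step of the induction of Marcus and Lopes for the concavity of quotients of consecutive
  elementary symmetric functions.\<close>

lemma parallel_superadditive:
  fixes x y x' y' :: real
  assumes "x > 0" "y > 0" "x' > 0" "y' > 0"
  shows "x * y / (x + y) + x' * y' / (x' + y') \<le> (x + x') * (y + y') / ((x + x') + (y + y'))"
proof -
  define u v where "u = x + y" and "v = x' + y'"
  have uv: "u > 0" "v > 0" using assms by (auto simp: u_def v_def)
  \<comment> \<open>In this form the claim becomes subadditivity of x^2 / u, which is
    Cauchy-Schwarz.\<close>
  have e: "a * b / (a + b) = a - a\<^sup>2 / (a + b)" if "a + b > 0" for a b :: real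
  proof -
    have "a * b / (a + b) = (a * (a + b) - a\<^sup>2) / (a + b)" by (simp add: algebra_simps power2_eq_square)
    thus ?thesis using that by (simp add: diff_divide_distrib)
  qed
  define p q where "p = x / u" and "q = x' / v"
  have pq: "x = p * u" "x' = q * v" using uv by (auto simp: p_def q_def)
  have "(p\<^sup>2 * u + q\<^sup>2 * v) * (u + v) - (p * u + q * v)\<^sup>2 = u * v * (p - q)\<^sup>2"
    by (simp add: algebra_simps power2_eq_square)
  also have "\<dots> \<ge> 0" using uv by simp
  finally have "(p * u + q * v)\<^sup>2 / (u + v) \<le> p\<^sup>2 * u + q\<^sup>2 * v"
    using uv by (simp add: pos_divide_le_eq)
  moreover have "(p * u)\<^sup>2 / u = p\<^sup>2 * u" "(q * v)\<^sup>2 / v = q\<^sup>2 * v"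
    using uv by (simp_all add: power2_eq_square)
  ultimately have "(x + x')\<^sup>2 / (u + v) \<le> x\<^sup>2 / u + x'\<^sup>2 / v" unfolding pq by simp
  moreover have "x * y / (x + y) = x - x\<^sup>2 / u" "x' * y' / (x' + y') = x' - x'\<^sup>2 / v"
    "(x + x') * (y + y') / ((x + x') + (y + y')) = (x + x') - (x + x')\<^sup>2 / (u + v)"
    using e[of x y] e[of x' y'] e[of "x + x'" "y + y'"] uv by (simp_all add: u_def v_def add_ac)
  ultimately show ?thesis by linarith
qed

lemma parallel_mono:
  fixes x y y' :: real
  assumes "x > 0" "y > 0" "y \<le> y'"
  shows "x * y / (x + y) \<le> x * y' / (x + y')"
  using assms by (simp add: field_simps)

text \<open>Homogeneous of degree 1 in \<open>b\<close>, so superadditivity on positive arguments is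
  the same as concavity there.\<close>

definition qsym :: "int \<Rightarrow> 'a set \<Rightarrow> ('a \<Rightarrow> real) \<Rightarrow> real" where
  "qsym m I b = esym m I b / esym (m - 1) I b"

lemma qsym_pos:
  assumes "finite I" "\<And>i. i \<in> I \<Longrightarrow> b i > 0" "1 \<le> m" "m \<le> int (card I)"
  shows "qsym m I b > 0"
  unfolding qsym_def using assms by (intro divide_pos_pos esym_pos) auto

text \<open>Euler's identity divided by sigma_(m-1), with \<open>b i\<close> split off in the
  denominator: the ratio q_m becomes a sum of parallel sums x y / (x + y) of \<open>b i\<close> with
  the ratio q_(m-1) of the other variables. Superadditivity and monotonicity are both proved by
  induction along this identity.\<close>

lemma qsym_rec:
  assumes "finite I" "\<And>i. i \<in> I \<Longrightarrow> b i > 0" "2 \<le> m" "m \<le> int (card I)"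
  shows "of_int m * qsym m I b
    = (\<Sum>i\<in>I. b i * qsym (m - 1) (I - {i}) b / (b i + qsym (m - 1) (I - {i}) b))"
proof -
  have "of_int m * qsym m I b = (\<Sum>i\<in>I. b i * esym (m - 1) (I - {i}) b / esym (m - 1) I b)"
    using esym_euler[OF assms(1), of b m] by (simp add: qsym_def sum_divide_distrib[symmetric])
  also have "\<dots> = (\<Sum>i\<in>I. b i * qsym (m - 1) (I - {i}) b / (b i + qsym (m - 1) (I - {i}) b))"
  proof (intro sum.cong refl)
    fix i assume i: "i \<in> I"
    have 1: "esym (m - 1) (I - {i}) b > 0" "esym (m - 2) (I - {i}) b > 0"
      using assms i by (intro esym_pos; force)+
    have 2: "esym (m - 1) I b = esym (m - 1) (I - {i}) b + b i * esym (m - 2) (I - {i}) b"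
      using esym_remove[OF assms(1) i, of "m - 1" b] by simp
    have "b i > 0" using assms i by auto
    thus "b i * esym (m - 1) (I - {i}) b / esym (m - 1) I b =
       b i * qsym (m - 1) (I - {i}) b / (b i + qsym (m - 1) (I - {i}) b)"
      using 1 unfolding 2 by (simp add: qsym_def field_simps add_pos_pos)
  qed
  finally show ?thesis .
qed

lemma esym_1: assumes "finite I" shows "esym 1 I b = sum b I"
  using esym_euler[OF assms, of b 1] assms by (simp add: esym_0)

text \<open>For m = 1 the ratio is the linear function \<open>sum b I\<close>. The step feeds
  superadditivity and monotonicity of the parallel sum into \<open>qsym_rec\<close>.\<close>

lemma qsym_superadditive:
  assumes "finite I" "\<And>i. i \<in> I \<Longrightarrow> x i > 0" "\<And>i. i \<in> I \<Longrightarrow> y i > 0" "1 \<le> m" "m \<le> int (card I)"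
  shows "qsym m I x + qsym m I y \<le> qsym m I (\<lambda>i. x i + y i)"
  using assms(4,1-3,5)
proof (induction m arbitrary: I rule: int_ge_induct)
  case base
  show ?case using base by (simp add: qsym_def esym_0 esym_1 sum.distrib)
next
  case (step m)
  have q: "0 < qsym m (I - {i}) x" "0 < qsym m (I - {i}) y" if "i \<in> I" for i
    using that step.prems step.hyps by (auto intro!: qsym_pos)
  have "of_int (m + 1) * (qsym (m + 1) I x + qsym (m + 1) I y)
    = (\<Sum>i\<in>I. x i * qsym m (I - {i}) x / (x i + qsym m (I - {i}) x)
        + y i * qsym m (I - {i}) y / (y i + qsym m (I - {i}) y))"
    using qsym_rec[of I x "m + 1"] qsym_rec[of I y "m + 1"] step.prems step.hyps
    by (simp add: distrib_left sum.distrib)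
  also have "\<dots> \<le> (\<Sum>i\<in>I. (x i + y i) * qsym m (I - {i}) (\<lambda>i. x i + y i) / ((x i + y i) + qsym m (I - {i}) (\<lambda>i. x i + y i)))"
  proof (rule sum_mono)
    fix i assume i: "i \<in> I"
    have "qsym m (I - {i}) x + qsym m (I - {i}) y \<le> qsym m (I - {i}) (\<lambda>i. x i + y i)"
      by (rule step.IH) (use step.prems i in auto)
    moreover have "0 < x i" "0 < y i" using step.prems i by auto
    ultimately show "x i * qsym m (I - {i}) x / (x i + qsym m (I - {i}) x)
        + y i * qsym m (I - {i}) y / (y i + qsym m (I - {i}) y)
      \<le> (x i + y i) * qsym m (I - {i}) (\<lambda>i. x i + y i) / ((x i + y i) + qsym m (I - {i}) (\<lambda>i. x i + y i))"
      using q[OF i] by (intro order_trans[OF parallel_superadditive parallel_mono]) auto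
  qed
  also have "\<dots> = of_int (m + 1) * qsym (m + 1) I (\<lambda>i. x i + y i)"
    using qsym_rec[of I "\<lambda>i. x i + y i" "m + 1"] step.prems step.hyps by (simp add: add_pos_pos)
  finally show ?case using step.hyps by (simp add: mult_le_cancel_left)
qed

text \<open>A weak Newton inequality, sigma_(m+1) sigma_(m-1) <= sigma_m^2. In
  \<open>qsym_rec\<close> the ratios of the remaining variables compare by induction, and the
  integer factors m + 2 and m + 1 in front differ in the favourable direction.\<close>

lemma qsym_antimono:
  assumes "finite I" "\<And>i. i \<in> I \<Longrightarrow> b i > 0" "1 \<le> m" "m + 1 \<le> int (card I)"
  shows "qsym (m + 1) I b \<le> qsym m I b"
  using assms(3,1,2,4)
proof (induction m arbitrary: I rule: int_ge_induct)
  case base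
  have p: "0 < b i + sum b (I - {i})" if "i \<in> I" for i
    using base that by (intro add_pos_nonneg sum_nonneg) (auto intro: less_imp_le)
  have "2 * qsym 2 I b = (\<Sum>i\<in>I. b i * sum b (I - {i}) / (b i + sum b (I - {i})))"
    using qsym_rec[of I b 2] base by (simp add: qsym_def esym_1 esym_0)
  also have "\<dots> \<le> (\<Sum>i\<in>I. b i)"
  proof (rule sum_mono)
    fix i assume i: "i \<in> I"
    show "b i * sum b (I - {i}) / (b i + sum b (I - {i})) \<le> b i"
      using p[OF i] less_imp_le[OF base(2)[OF i]] by (simp add: divide_le_eq mult_left_mono)
  qed
  finally have "2 * qsym 2 I b \<le> qsym 1 I b" using base by (simp add: qsym_def esym_1 esym_0)
  thus ?case using qsym_pos[of I b 1] qsym_pos[of I b 2] base by simp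
next
  case (step m)
  have q: "0 < qsym m (I - {i}) b" "0 < qsym (m + 1) (I - {i}) b" if "i \<in> I" for i
    using that step.prems step.hyps by (auto intro!: qsym_pos)
  have "of_int (m + 2) * qsym (m + 2) I b = (\<Sum>i\<in>I. b i * qsym (m + 1) (I - {i}) b / (b i + qsym (m + 1) (I - {i}) b))"
    using qsym_rec[of I b "m + 2"] step.prems step.hyps by (simp add: add.commute add_diff_eq)
  also have "\<dots> \<le> (\<Sum>i\<in>I. b i * qsym m (I - {i}) b / (b i + qsym m (I - {i}) b))"
  proof (rule sum_mono)
    fix i assume i: "i \<in> I"
    have "qsym (m + 1) (I - {i}) b \<le> qsym m (I - {i}) b"
      by (rule step.IH) (use step.prems i in auto)
    moreover have "0 < b i" using step.prems i by auto
    ultimately show "b i * qsym (m + 1) (I - {i}) b / (b i + qsym (m + 1) (I - {i}) b)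
       \<le> b i * qsym m (I - {i}) b / (b i + qsym m (I - {i}) b)"
      using q[OF i] by (intro parallel_mono) auto
  qed
  also have "\<dots> = of_int (m + 1) * qsym (m + 1) I b"
    using qsym_rec[of I b "m + 1"] step.prems step.hyps by simp
  also have "\<dots> \<le> of_int (m + 2) * qsym (m + 1) I b"
    using qsym_pos[of I b "m + 1"] step.prems step.hyps by (intro mult_right_mono) auto
  finally have "qsym (m + 2) I b \<le> qsym (m + 1) I b" using step.hyps by (simp add: mult_le_cancel_left)
  thus ?case by (simp add: add.assoc)
qed

text \<open>sigma_m is the product of the ratios q_1, ..., q_m, and these decrease.\<close>

lemma qsym_power_le:
  assumes "finite I" "\<And>i. i \<in> I \<Longrightarrow> b i > 0" "1 \<le> m" "m \<le> int (card I)"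
  shows "qsym m I b ^ nat m \<le> esym m I b"
  using assms(3,1,2,4)
proof (induction m rule: int_ge_induct)
  case base
  show ?case using base by (simp add: qsym_def esym_0)
next
  case (step m)
  have p: "0 < qsym (m + 1) I b" "0 < qsym m I b" "0 < esym m I b" 
    using step.prems step.hyps by (auto intro!: qsym_pos esym_pos)
  have "qsym (m + 1) I b ^ nat (m + 1) = qsym (m + 1) I b * qsym (m + 1) I b ^ nat m"
    using step by (simp add: nat_add_distrib)
  also have "\<dots> \<le> qsym (m + 1) I b * qsym m I b ^ nat m"
    using p step by (intro mult_left_mono power_mono qsym_antimono) auto
  also have "\<dots> \<le> qsym (m + 1) I b * esym m I b"
    using p step by (intro mult_left_mono step.IH) auto
  also have "\<dots> = esym (m + 1) I b" using p by (simp add: qsym_def)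
  finally show ?case .
qed

text \<open>Bounding by \<open>max 1 N\<close> avoids the m-th root of N: a ratio above 1 is at most
  its own m-th power.\<close>

lemma qsym_le_max:
  assumes "finite I" "\<And>i. i \<in> I \<Longrightarrow> b i > 0" "1 \<le> m" "m \<le> int (card I)" "esym m I b \<le> N"
  shows "qsym m I b \<le> max 1 N"
proof (rule ccontr)
  assume "\<not> qsym m I b \<le> max 1 N"
  hence q: "qsym m I b > 1" "qsym m I b > N" by auto
  have "qsym m I b ^ 1 \<le> qsym m I b ^ nat m"
    using q assms by (intro power_increasing) auto
  also have "\<dots> \<le> esym m I b" by (rule qsym_power_le) fact+
  finally show False using q assms(5) by simp
qed

section \<open>The third-order terms\<close>

text \<open>Superadditivity at b + t Y and b - t Y together with homogeneity gives q(b + t Y) + q(b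
  - t Y) <= 2 q(b) for small t; the second-derivative test does the rest.\<close>

lemma qsym_line_concave:
  assumes "finite I" "\<And>i. i \<in> I \<Longrightarrow> b i > 0" "1 \<le> m" "m \<le> int (card I)"
    and j: "jet2 (\<lambda>t. qsym m I (\<lambda>i. b i + t * Y i)) q0 q1 q2"
  shows "q2 \<le> 0"
proof -
  let ?q = "\<lambda>t. qsym m I (\<lambda>i. b i + t * Y i)"
  have q0: "q0 = ?q 0" using jet2_value[OF j] by simp
  have "jet2 (\<lambda>t. 2 * q0 + (-1) * (?q t + ?q (- t))) (2 * q0 + (-1) * (q0 + q0)) (0 + (-1) * (q1 + - q1))
     (0 + (-1) * (q2 + q2))"
    by (intro jet2_add jet2_const jet2_cmult j jet2_reflect)
  hence J: "jet2 (\<lambda>t. 2 * q0 + (-1) * (?q t + ?q (- t))) 0 0 (- 2 * q2)" by simp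
  have "\<forall>\<^sub>F t in nhds 0. \<forall>i\<in>I. b i + t * Y i > 0 \<and> b i + (- t) * Y i > 0"
  proof (rule eventually_ball_finite[OF assms(1)], safe)
    fix i assume i: "i \<in> I"
    have 1: "((\<lambda>t. b i + t * Y i) \<longlongrightarrow> b i + 0 * Y i) (nhds 0)"
      and 2: "((\<lambda>t. b i + (- t) * Y i) \<longlongrightarrow> b i + (- 0) * Y i) (nhds 0)"
      by (intro tendsto_intros filterlim_ident)+
    from order_tendstoD(1)[OF 1, of 0] order_tendstoD(1)[OF 2, of 0] assms(2)[OF i]
    show "\<forall>\<^sub>F t in nhds 0. b i + t * Y i > 0 \<and> b i + (- t) * Y i > 0"
      by (simp add: eventually_conj_iff)
  qed
  hence "\<forall>\<^sub>F t in nhds 0. 2 * q0 + (-1) * (?q t + ?q (- t)) \<ge> 0"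
  proof eventually_elim
    case (elim t)
    have "?q t + ?q (- t) \<le> qsym m I (\<lambda>i. (b i + t * Y i) + (b i + (- t) * Y i))"
      using elim assms by (intro qsym_superadditive) auto
    also have "\<dots> = qsym m I (\<lambda>i. 2 * b i)" by (simp add: algebra_simps)
    also have "\<dots> = 2 * qsym m I b"
    proof -
      have "nat m = Suc (nat (m - 1))" using assms(3) by simp
      thus ?thesis by (simp add: qsym_def esym_scale)
    qed
    finally show ?case using q0 by simp
  qed
  from jet2_nonneg(2)[OF J this] show ?thesis by simp
qed

text \<open>The difference of the two sides times M (M + 1) is the square (M \<alpha> - \<gamma>)^2.
  In the induction from m to m + 1 that follows, \<alpha> and \<gamma> stand for the contributions
  of the ratio q_(m+1) and of sigma_m to the first derivative of sigma_(m+1).\<close>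

lemma log_concave_step:
  fixes M \<alpha> \<gamma> :: real
  assumes "M \<ge> 1"
  shows "2 * \<alpha> * \<gamma> + (1 - 1 / M) * \<gamma>\<^sup>2 \<le> (1 - 1 / (M + 1)) * (\<alpha> + \<gamma>)\<^sup>2"
proof -
  let ?d = "(1 - 1 / (M + 1)) * (\<alpha> + \<gamma>)\<^sup>2 - (2 * \<alpha> * \<gamma> + (1 - 1 / M) * \<gamma>\<^sup>2)"
  have M: "M * (M + 1) > 0" using assms by simp
  have 1: "(1 - 1 / (M + 1)) * (M * (M + 1)) = M * M" "(1 - 1 / M) * (M * (M + 1)) = (M - 1) * (M + 1)"
    using assms by (simp_all add: field_simps)
  have "?d * (M * (M + 1)) = (1 - 1 / (M + 1)) * (M * (M + 1)) * (\<alpha> + \<gamma>)\<^sup>2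
    - (2 * \<alpha> * \<gamma> * (M * (M + 1)) + (1 - 1 / M) * (M * (M + 1)) * \<gamma>\<^sup>2)"
  proof -
    have "(u * S - (w + v * g)) * m = u * m * S - (w * m + v * m * g)" for u S w v g m :: real
      by (simp add: algebra_simps)
    thus ?thesis .
  qed
  also have "\<dots> = (M * \<alpha> - \<gamma>)\<^sup>2" unfolding 1 by (simp add: algebra_simps power2_eq_square)
  finally have "?d * (M * (M + 1)) \<ge> 0" by simp
  hence "?d \<ge> 0" using M by (simp add: zero_le_mult_iff)
  thus ?thesis by simp
qed

text \<open>The infinitesimal form of the concavity of sigma_m^(1/m), that is, (log sigma_m)'' <= -
  (1/m) ((log sigma_m)')^2. The induction uses sigma_(m+1) = sigma_m q_(m+1) with q_(m+1)
  concave.\<close>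

lemma esym_log_concave:
  assumes "finite I" "\<And>i. i \<in> I \<Longrightarrow> b i > 0" "1 \<le> m" "m \<le> int (card I)"
    and "jet2 (\<lambda>t. esym m I (\<lambda>i. b i + t * Y i)) e0 e1 e2"
  shows "e2 * e0 \<le> (1 - 1 / of_int m) * e1\<^sup>2"
  using assms(3,4,5)
proof (induction m arbitrary: e0 e1 e2 rule: int_ge_induct)
  case base
  have "jet2 (\<lambda>t. esym 1 I (\<lambda>i. b i + t * Y i)) (esym 1 I b) (\<Sum>i\<in>I. Y i * esym (1 - 1) (I - {i}) b) 0"
    using jet2_esym[OF assms(1), of 1 b Y] by (simp add: esym_neg)
  from jet2_unique(3)[OF this base(2)] show ?case by simp
next
  case (step m)
  obtain p0 p1 p2 where P: "jet2 (\<lambda>t. esym m I (\<lambda>i. b i + t * Y i)) p0 p1 p2"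
    using jet2_esym[OF assms(1)] by blast
  have p0: "p0 = esym m I b" "e0 = esym (m + 1) I b"
    using jet2_value[OF P] jet2_value[OF step.prems(2)] by auto
  have pos: "p0 > 0" "e0 > 0" unfolding p0 using assms step.prems step.hyps by (auto intro!: esym_pos)
  obtain q r where qr: "jet2 (\<lambda>t. esym (m + 1) I (\<lambda>i. b i + t * Y i) / esym m I (\<lambda>i. b i + t * Y i)) (e0 / p0) q r"
    "e1 = q * p0 + (e0 / p0) * p1" "e2 = r * p0 + 2 * q * p1 + (e0 / p0) * p2"
    using jet2_divide[OF step.prems(2) P] pos by auto
  have "jet2 (\<lambda>t. qsym (m + 1) I (\<lambda>i. b i + t * Y i)) (e0 / p0) q r"
    using qr(1) by (simp add: qsym_def)
  hence r: "r \<le> 0" by (rule qsym_line_concave[rotated 4]) (use assms step.prems step.hyps in auto)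
  have IH: "p2 * p0 \<le> (1 - 1 / of_int m) * p1\<^sup>2"
    by (rule step.IH[OF _ P]) (use step.prems in auto)
  define x where "x = e0 / p0"
  have x: "x > 0" "e0 = x * p0" using pos by (auto simp: x_def)
  have "e2 * e0 = r * x * p0\<^sup>2 + 2 * (q * p0) * (x * p1) + x\<^sup>2 * (p2 * p0)"
    unfolding qr(3) x_def[symmetric] x(2) by (simp add: power2_eq_square algebra_simps)
  also have "\<dots> \<le> 0 + 2 * (q * p0) * (x * p1) + x\<^sup>2 * ((1 - 1 / of_int m) * p1\<^sup>2)"
  proof -
    have "r * x * p0\<^sup>2 \<le> 0" using r x by (intro mult_nonpos_nonneg) auto
    moreover have "x\<^sup>2 * (p2 * p0) \<le> x\<^sup>2 * ((1 - 1 / of_int m) * p1\<^sup>2)"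
      using IH by (intro mult_left_mono) auto
    ultimately show ?thesis by linarith
  qed
  also have "\<dots> = 2 * (q * p0) * (x * p1) + (1 - 1 / of_int m) * (x * p1)\<^sup>2"
    by (simp add: power_mult_distrib)
  also have "\<dots> \<le> (1 - 1 / (of_int m + 1)) * (q * p0 + x * p1)\<^sup>2"
    using step.hyps by (intro log_concave_step) auto
  finally show ?case unfolding qr(2) x_def by simp
qed

section \<open>Concavity of log sigma_k in the presence of one dominant variable\<close>

lemma sum_mult_square_le:
  fixes Y R :: "'a \<Rightarrow> real"
  assumes "finite J" "real (card J) \<le> n"
  shows "(\<Sum>j\<in>J. Y j * R j)\<^sup>2 \<le> n * (\<Sum>j\<in>J. R j ^ 2 * Y j ^ 2)"
proof -
  have "(\<Sum>j\<in>J. 1 * (Y j * R j))\<^sup>2 \<le> (\<Sum>j\<in>J. 1\<^sup>2) * (\<Sum>j\<in>J. (Y j * R j)\<^sup>2)"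
    by (rule Cauchy_Schwarz_ineq_sum)
  also have "\<dots> \<le> n * (\<Sum>j\<in>J. (Y j * R j)\<^sup>2)"
    using assms by (intro mult_right_mono sum_nonneg) auto
  finally show ?thesis by (simp add: power_mult_distrib mult.commute)
qed

text \<open>The threshold in \<open>large\<close> collects its factors from
  \<open>diagonal_estimate\<close>: 1 + 16 n is 1 + 1 / \<epsilon> from Young's inequality with
  \<epsilon> = 1 / (16 n), the factor n comes from Cauchy-Schwarz over the other indices, and
  \<open>max 1 N\<close> bounds ratios of symmetric functions of the remaining variables.\<close>

context
  fixes I :: "'a set" and r :: 'a and b :: "'a \<Rightarrow> real" and k :: int and N n :: real
  assumes I: "finite I" "r \<in> I" and bpos: "\<And>i. i \<in> I \<Longrightarrow> b i > 0"
    and k: "2 \<le> k" "k < int (card I)" and n: "n = real (card I)"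
    and N: "esym k I b \<le> N" and large: "(1 + 16 * n) * n * max 1 N \<le> b r"
begin

lemma card_ge_one: "n \<ge> 1" using k n by linarith

lemma large_bounds: "16 * n * max 1 N \<le> b r" "n * max 1 N \<le> b r" "b r \<ge> 1"
proof -
  have "16 * n * max 1 N \<le> (1 + 16 * n) * n * max 1 N"
    using card_ge_one mult_mono[of 16 "1 + 16 * n" n n] by (intro mult_right_mono) auto
  thus 1: "16 * n * max 1 N \<le> b r" using large by simp
  have "1 * n * max 1 N \<le> (1 + 16 * n) * n * max 1 N"
    using card_ge_one by (intro mult_right_mono) auto
  thus 2: "n * max 1 N \<le> b r" using large by simp
  have "1 * 1 \<le> n * max 1 N" using card_ge_one by (intro mult_mono) auto
  thus "b r \<ge> 1" using 2 by simp
qed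

text \<open>Splitting off the largest variable, \<open>\<sigma>\<^sub>k = \<sigma>\<^sub>k\<^sub>-\<^sub>1 (b r + \<sigma>\<^sub>k / \<sigma>\<^sub>k\<^sub>-\<^sub>1)\<close> with the symmetric functions on the
  right in the remaining variables, gives \<open>log \<sigma>\<^sub>k\<close> more concavity than that of \<open>\<sigma>\<^sub>k\<^bsup>1/k\<^esup>\<close>.\<close>

lemma esym_split: "esym k I b = esym (k - 1) (I - {r}) b * (b r + qsym k (I - {r}) b)"
proof -
  have "esym (k - 1) (I - {r}) b > 0" using I k bpos by (intro esym_pos) auto
  thus ?thesis using esym_remove[OF I, of k b] by (simp add: qsym_def algebra_simps)
qed

text \<open>Dropping r lowers sigma_k, so the bound N passes to the remaining variables. With R
  their ratio q_k, b r + R then exceeds b r by a factor of at most 1 + 1 / (16 n).\<close>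

lemma qsym_rest_le: "0 < qsym k (I - {r}) b" "qsym k (I - {r}) b \<le> max 1 N" "qsym k (I - {r}) b \<le> b r / (16 * n)"
proof -
  show "0 < qsym k (I - {r}) b" using I k bpos by (intro qsym_pos) auto
  have "esym k (I - {r}) b \<le> esym k I b"
    using esym_remove[OF I, of k b] esym_nonneg[of "I - {r}" b "k - 1"] bpos[OF I(2)] bpos
    by (simp add: less_imp_le)
  thus 1: "qsym k (I - {r}) b \<le> max 1 N"
    using I k bpos N by (intro qsym_le_max) auto
  show "qsym k (I - {r}) b \<le> b r / (16 * n)"
    using order_trans[OF mult_left_mono[OF 1, of "16 * n"] large_bounds(1)] card_ge_one by (simp add: field_simps)
qed

lemma top_derivative: "esym (k - 1) (I - {r}) b / esym k I b = 1 / (b r + qsym k (I - {r}) b)"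
proof -
  have "esym (k - 1) (I - {r}) b > 0" using I k bpos by (intro esym_pos) auto
  thus ?thesis unfolding esym_split by simp
qed

text \<open>Multiplied by \<open>b r\<close> this says that the r-entry of the linearised operator
  is at least b r / 2, the coercivity used at the end of the maximum-point estimate.\<close>

lemma top_derivative_ge: "b r * (esym (k - 1) (I - {r}) b / esym k I b) \<ge> 1 / 2"
proof -
  have "b r / (16 * n) \<le> b r" using card_ge_one large_bounds(3) by (simp add: field_simps mult_le_cancel_left1)
  hence "qsym k (I - {r}) b \<le> b r" using qsym_rest_le(3) by linarith
  thus ?thesis unfolding top_derivative using qsym_rest_le(1) large_bounds(3) by (simp add: field_simps)
qed

text \<open>\<open>Rj\<close> is the partial derivative in \<open>b j\<close> of R = sigma_k /
  sigma_(k-1), taken in the variables other than r. With A, B, P as in the proof, 0 <= Rj <= A / P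
  <= 1, so Rj^2 <= (A / B) (B / P); the ratio A / B is bounded by \<open>max 1 N\<close>, and
  \<open>large\<close> trades it for \<open>b r\<close>.\<close>

lemma remaining_derivative:
  assumes j: "j \<in> I - {r}"
  defines "P \<equiv> esym (k - 1) (I - {r}) b" and "R \<equiv> qsym k (I - {r}) b"
  defines "Rj \<equiv> (esym (k - 1) (I - {r} - {j}) b - R * esym (k - 2) (I - {r} - {j}) b) / P"
  shows "(1 + 16 * n) * n * Rj\<^sup>2 / (b r + R) \<le> esym (k - 1) (I - {j}) b / esym k I b"
proof -
  let ?J = "I - {r} - {j}"
  have j': "j \<in> I" "j \<noteq> r" using j by auto
  have c: "card ?J = card I - 2" using I j' by (simp add: card_Diff_singleton)
  have fJ: "finite ?J" "\<And>i. i \<in> ?J \<Longrightarrow> b i > 0" using I bpos by auto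
  define A B C where "A = esym (k - 1) ?J b" and "B = esym (k - 2) ?J b" and "C = esym k ?J b"
  have AB: "A > 0" "B > 0" unfolding A_def B_def using fJ k c by (auto intro!: esym_pos)
  have C: "C \<ge> 0" unfolding C_def using fJ by (intro esym_nonneg) (auto intro: less_imp_le)
  have bj: "b j > 0" using bpos j' by auto
  have P: "P = A + b j * B"
    unfolding P_def A_def B_def using esym_remove[of "I - {r}" j "k - 1" b] I j by simp
  have Q: "esym k (I - {r}) b = C + b j * A"
    unfolding A_def C_def using esym_remove[of "I - {r}" j k b] I j by simp
  have R: "R * P = C + b j * A" unfolding R_def qsym_def using P AB bj Q P_def
    by (simp add: add_pos_pos less_imp_neq[symmetric])
  have Ppos: "P > 0" using P AB bj by (simp add: add_pos_pos)
  have Rpos: "R > 0" unfolding R_def by (rule qsym_rest_le)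
  \<comment> \<open>Newton's inequality decides the sign of \<open>Rj\<close>. For k = n - 1 only k
    - 1 variables are left in \<open>?J\<close>, so C vanishes.\<close>
  have CB: "C * B \<le> A\<^sup>2"
  proof (cases "k \<le> int (card ?J)")
    case True
    have "qsym k ?J b \<le> qsym (k - 1) ?J b" using qsym_antimono[of ?J b "k - 1"] fJ True k by simp
    thus ?thesis using AB by (simp add: qsym_def A_def B_def C_def field_simps power2_eq_square)
  next
    case False
    hence "C = 0" unfolding C_def using fJ by (intro esym_gt_card) auto
    thus ?thesis by simp
  qed
  have "Rj * P\<^sup>2 = A * P - R * P * B"
    unfolding Rj_def A_def[symmetric] B_def[symmetric] using Ppos by (simp add: power2_eq_square field_simps)
  also have "\<dots> = A * P - (C + b j * A) * B" unfolding R ..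
  also have "\<dots> = A\<^sup>2 - C * B" unfolding P by (simp add: algebra_simps power2_eq_square)
  finally have "Rj * P\<^sup>2 \<ge> 0" using CB by simp
  hence Rj0: "Rj \<ge> 0" using Ppos by (simp add: zero_le_mult_iff)
  have RjA: "Rj \<le> A / P"
    unfolding Rj_def A_def[symmetric] B_def[symmetric] using Ppos AB Rpos by (simp add: divide_right_mono)
  have AP: "A / P \<le> 1" using P AB bj Ppos by simp
  have "Rj\<^sup>2 \<le> (A / P)\<^sup>2" using Rj0 RjA by (rule power_mono[rotated])
  also have "\<dots> \<le> A / P" using mult_left_le[OF AP, of "A / P"] AB Ppos by (simp add: power2_eq_square)
  finally have Rj2: "Rj\<^sup>2 \<le> A / P" .
  \<comment> \<open>Because b r >= 1, the values sigma_(k-1) of the remaining variables are at most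
    sigma_k <= N, so the bound on ratios applies to them as well.\<close>
  have r: "A / B \<le> max 1 N"
  proof -
    have "A \<le> P" using P AB bj by simp
    also have "P \<le> b r * P" using large_bounds(3) Ppos by simp
    also have "\<dots> \<le> P * (b r + R)" using Ppos Rpos by (simp add: algebra_simps)
    also have "\<dots> \<le> N" using N unfolding esym_split P_def R_def .
    finally have "qsym (k - 1) ?J b \<le> max 1 N"
      using fJ k c by (intro qsym_le_max) (auto simp: A_def)
    thus ?thesis by (simp add: qsym_def A_def B_def)
  qed
  have "(1 + 16 * n) * n * Rj\<^sup>2 \<le> (1 + 16 * n) * n * (A / B * (B / P))"
    using Rj2 card_ge_one AB by (intro mult_left_mono) auto
  also have "\<dots> = ((1 + 16 * n) * n * (A / B)) * (B / P)" by (simp add: mult.assoc)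
  also have "\<dots> \<le> b r * (B / P)"
    using order_trans[OF mult_left_mono[OF r, of "(1 + 16 * n) * n"] large] card_ge_one AB Ppos
    by (intro mult_right_mono) auto
  also have "\<dots> \<le> (A + b r * B) / P" using AB Ppos by (simp add: field_simps)
  finally have "(1 + 16 * n) * n * Rj\<^sup>2 / (b r + R) \<le> (A + b r * B) / P / (b r + R)"
    using large_bounds(3) Rpos by (intro divide_right_mono) auto
  also have "A + b r * B = esym (k - 1) (I - {j}) b"
  proof -
    have "I - {j} - {r} = ?J" by auto
    thus ?thesis using esym_remove[of "I - {j}" r "k - 1" b] I j' by (simp add: A_def B_def)
  qed
  also have "\<dots> / P / (b r + R) = esym (k - 1) (I - {j}) b / esym k I b"
    unfolding esym_split P_def R_def by simp
  finally show ?thesis .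
qed

text \<open>With P and R the functions sigma_(k-1) and sigma_k / sigma_(k-1) of the variables other
  than r, log sigma_k = log P + log (b r + R), and D2 - s^2 is its second derivative along Y.
  Concavity of R bounds the part of log (b r + R) by - a^2; concavity of P^(1/(k-1)) adds a further
  multiple of a^2, and this surplus produces the gain 1 / (16 n).\<close>

lemma diagonal_estimate:
  fixes Y :: "'a \<Rightarrow> real"
  defines "S \<equiv> \<lambda>i. esym (k - 1) (I - {i}) b / esym k I b"
  defines "s \<equiv> \<Sum>i\<in>I. S i * Y i"
  defines "D2 \<equiv> (\<Sum>i\<in>I. \<Sum>j\<in>I-{i}. Y i * Y j * esym (k - 2) (I - {i} - {j}) b) / esym k I b"
  shows "b r * (D2 - s\<^sup>2) + S r * Y r ^ 2 - 2 * (\<Sum>j\<in>I-{r}. S j * Y j ^ 2)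
    \<le> - (1 / (16 * n)) * (S r * Y r ^ 2) + b r * s\<^sup>2"
proof -
  let ?I = "I - {r}"
  have fI: "finite ?I" "\<And>i. i \<in> ?I \<Longrightarrow> b i > 0" using I bpos by auto
  have cI: "int (card ?I) = int (card I) - 1" using card_Suc_Diff1[OF I] by simp
  define P R where "P = esym (k - 1) ?I b" and "R = qsym k ?I b"
  define T where "T = b r + R"
  define Rd where "Rd j = (esym (k - 1) (?I - {j}) b - R * esym (k - 2) (?I - {j}) b) / P" for j
  have Ppos: "P > 0" unfolding P_def using fI k cI by (intro esym_pos) auto
  have Rpos: "R > 0" unfolding R_def by (rule qsym_rest_le)
  have Tpos: "T > 0" unfolding T_def using Rpos large_bounds(3) by simp
  have sig: "esym k I b = P * T" unfolding esym_split P_def R_def T_def ..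
  define P1 where "P1 = (\<Sum>i\<in>?I. Y i * esym (k - 2) (?I - {i}) b)"
  define Q1 where "Q1 = (\<Sum>i\<in>?I. Y i * esym (k - 1) (?I - {i}) b)"
  obtain P2 where JP: "jet2 (\<lambda>t. esym (k - 1) ?I (\<lambda>i. b i + t * Y i)) P P1 P2"
    using jet2_esym[OF fI(1), of "k - 1" b Y] unfolding P1_def P_def by auto
  obtain Q2 where JQ: "jet2 (\<lambda>t. esym k ?I (\<lambda>i. b i + t * Y i)) (esym k ?I b) Q1 Q2"
    using jet2_esym[OF fI(1), of k b Y] unfolding Q1_def by auto
  have R': "esym k ?I b / P = R" by (simp add: R_def P_def qsym_def)
  obtain r1 r2 where JR: "jet2 (\<lambda>t. esym k ?I (\<lambda>i. b i + t * Y i) / esym (k - 1) ?I (\<lambda>i. b i + t * Y i)) R r1 r2"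
    and Q1: "Q1 = r1 * P + R * P1" and Q2: "Q2 = r2 * P + 2 * r1 * P1 + R * P2"
    using jet2_divide[OF JQ JP] Ppos unfolding R' by auto
  have r2: "r2 \<le> 0"
    by (rule qsym_line_concave[of ?I b k Y R r1]) (use fI k cI JR in \<open>auto simp: qsym_def\<close>)
  have PP: "P2 * P \<le> (1 - 1 / of_int (k - 1)) * P1\<^sup>2"
    by (rule esym_log_concave[OF fI _ _ JP]) (use k cI in auto)
  have J: "jet2 (\<lambda>t. esym k ?I (\<lambda>i. b i + t * Y i) + (b r + t * Y r) * esym (k - 1) ?I (\<lambda>i. b i + t * Y i))
     (esym k ?I b + b r * P) (Q1 + (Y r * P + b r * P1)) (Q2 + (0 * P + 2 * Y r * P1 + b r * P2))"
    by (intro jet2_add jet2_mult jet2_linear JP JQ)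
  have e: "esym k ?I (\<lambda>i. b i + t * Y i) + (b r + t * Y r) * esym (k - 1) ?I (\<lambda>i. b i + t * Y i)
     = esym k I (\<lambda>i. b i + t * Y i)" for t
    using esym_remove[OF I] by simp
  note U = jet2_unique[OF J[unfolded e] jet2_esym[OF I(1)]]
  have s: "s * (P * T) = Q1 + (Y r * P + b r * P1)"
    unfolding U(2) s_def S_def sig using Ppos Tpos
    by (simp add: sum_divide_distrib[symmetric] mult.commute)
  have D2: "D2 * (P * T) = Q2 + (2 * Y r * P1 + b r * P2)"
    using U(3) unfolding D2_def sig using Ppos Tpos by simp
  \<comment> \<open>The logarithmic derivatives along Y of T = b r + R and of P; they add up to
    s.\<close>
  define a c where "a = (Y r + r1) / T" and "c = P1 / P"
  have a: "Y r + r1 = a * T" and c: "P1 = c * P" using Ppos Tpos by (auto simp: a_def c_def)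
  have "s * (P * T) = (a + c) * (P * T)"
    unfolding s Q1 using a c by (simp add: T_def algebra_simps) (metis (no_types) a T_def distrib_right mult.commute)
  hence sac: "s = a + c" using Ppos Tpos by simp
  have "D2 * (P * T) * P = (r2 * P + 2 * (a * T) * P1 + T * P2) * P"
    unfolding D2 Q2 a[symmetric] by (simp add: T_def algebra_simps)
  also have "\<dots> = r2 * P\<^sup>2 + 2 * a * c * T * P\<^sup>2 + T * (P2 * P)"
    unfolding c by (simp add: algebra_simps power2_eq_square)
  also have "\<dots> \<le> 0 + 2 * a * c * T * P\<^sup>2 + T * ((1 - 1 / of_int (k - 1)) * P1\<^sup>2)"
  proof -
    have "r2 * P\<^sup>2 \<le> 0" using r2 by (intro mult_nonpos_nonneg) auto
    moreover have "T * (P2 * P) \<le> T * ((1 - 1 / of_int (k - 1)) * P1\<^sup>2)"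
      using PP Tpos by (intro mult_left_mono) auto
    ultimately show ?thesis by linarith
  qed
  also have "\<dots> = (2 * a * c + (1 - 1 / of_int (k - 1)) * c\<^sup>2) * (P * T) * P"
    unfolding c by (simp add: algebra_simps power2_eq_square)
  finally have "D2 \<le> 2 * a * c + (1 - 1 / of_int (k - 1)) * c\<^sup>2"
    using Ppos Tpos by simp
  hence D2s: "D2 - s\<^sup>2 \<le> - a\<^sup>2 - c\<^sup>2 / of_int (k - 1)"
    unfolding sac by (simp add: power2_eq_square algebra_simps)
  have K: "1 \<le> real_of_int (k - 1)" "real_of_int (k - 1) \<le> n" using k n by linarith+
  \<comment> \<open>Since c = s - a, either s is large or c^2 is comparable to a^2. Division by k -
    1 <= n leaves the surplus a^2 / (2 n), up to s^2.\<close>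
  have "c\<^sup>2 / of_int (k - 1) \<ge> a\<^sup>2 / (2 * n) - s\<^sup>2"
  proof -
    have "a\<^sup>2 \<le> 2 * (c\<^sup>2 + s\<^sup>2)" unfolding sac using zero_le_power2[of "2 * c + a"]
      by (simp add: power2_eq_square algebra_simps)
    hence c2: "a\<^sup>2 / 2 - s\<^sup>2 \<le> c\<^sup>2" by simp
    have "a\<^sup>2 / (2 * n) - s\<^sup>2 \<le> a\<^sup>2 / (2 * of_int (k - 1)) - s\<^sup>2 / of_int (k - 1)"
      using K by (intro diff_mono divide_left_mono) (auto simp: divide_le_eq mult_le_cancel_left1)
    also have "\<dots> = (a\<^sup>2 / 2 - s\<^sup>2) / of_int (k - 1)" by (simp add: diff_divide_distrib)
    also have "\<dots> \<le> c\<^sup>2 / of_int (k - 1)" using c2 K by (intro divide_right_mono) auto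
    finally show ?thesis .
  qed
  with D2s have "D2 - s\<^sup>2 \<le> - (1 + 1 / (2 * n)) * a\<^sup>2 + s\<^sup>2" by (simp add: algebra_simps)
  hence first: "b r * (D2 - s\<^sup>2) \<le> b r * (- (1 + 1 / (2 * n)) * a\<^sup>2 + s\<^sup>2)"
    using large_bounds(3) by (intro mult_left_mono) auto
  \<comment> \<open>A factor 1 + \<epsilon> is spent three times: in Young's inequality for Y r = a
    T - r1, in T <= (1 + \<epsilon>) b r, and on the gain itself. As (1 + \<epsilon>)^3 <= 1 + 7
    \<epsilon>, the value 1 / (16 n) fits into the surplus 1 / (2 n).\<close>
  define \<epsilon> where "\<epsilon> = 1 / (16 * n)"
  have eps: "0 < \<epsilon>" "\<epsilon> \<le> 1" "1 / \<epsilon> = 16 * n" using card_ge_one by (auto simp: \<epsilon>_def)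
  have T_le: "T \<le> (1 + \<epsilon>) * b r"
    unfolding T_def \<epsilon>_def R_def using qsym_rest_le(3) by (simp add: algebra_simps)
  have r1: "r1 = (\<Sum>j\<in>?I. Y j * Rd j)"
  proof -
    have "r1 * P = Q1 - R * P1" unfolding Q1 by simp
    also have "\<dots> = (\<Sum>j\<in>?I. Y j * (Rd j * P))"
    proof -
      have RdP: "Rd j * P = esym (k - 1) (?I - {j}) b - R * esym (k - 2) (?I - {j}) b" for j
        unfolding Rd_def using Ppos by simp
      show ?thesis unfolding RdP Q1_def P1_def
        by (simp add: sum_distrib_left sum_subtractf[symmetric] algebra_simps)
    qed
    also have "\<dots> = (\<Sum>j\<in>?I. Y j * Rd j) * P"
      by (simp add: sum_distrib_right mult.assoc)
    finally show ?thesis using Ppos by simp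
  qed
  have So: "S r = 1 / T" unfolding S_def T_def R_def by (rule top_derivative)
  have "Y r ^ 2 \<le> (1 + \<epsilon>) * (a * T)\<^sup>2 + (1 + 1 / \<epsilon>) * r1\<^sup>2"
  proof -
    have "(1 + \<epsilon>) * x\<^sup>2 + (1 + 1 / \<epsilon>) * y\<^sup>2 - (x - y)\<^sup>2 = (\<epsilon> * x + y)\<^sup>2 / \<epsilon>" for x y
      using eps(1) by (simp add: field_simps power2_eq_square)
    from this[of "a * T" r1] have "(1 + \<epsilon>) * (a * T)\<^sup>2 + (1 + 1 / \<epsilon>) * r1\<^sup>2 - (a * T - r1)\<^sup>2 \<ge> 0"
      using eps(1) by simp
    moreover have "Y r = a * T - r1" using a by simp
    ultimately show ?thesis by simp
  qed
  hence "S r * Y r ^ 2 \<le> 1 / T * ((1 + \<epsilon>) * (a * T)\<^sup>2 + (1 + 1 / \<epsilon>) * r1\<^sup>2)"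
    unfolding So using Tpos by (intro mult_left_mono) auto
  also have "\<dots> = (1 + \<epsilon>) * a\<^sup>2 * T + (1 + 16 * n) * r1\<^sup>2 / T"
    using Tpos eps(3) by (simp add: field_simps power2_eq_square)
  finally have "(1 + \<epsilon>) * (S r * Y r ^ 2) \<le> (1 + \<epsilon>) * ((1 + \<epsilon>) * a\<^sup>2 * T + (1 + 16 * n) * r1\<^sup>2 / T)"
    using eps by (intro mult_left_mono) auto
  also have "\<dots> = (1 + \<epsilon>)\<^sup>2 * a\<^sup>2 * T + (1 + \<epsilon>) * ((1 + 16 * n) * r1\<^sup>2 / T)"
    by (simp add: algebra_simps power2_eq_square)
  also have "\<dots> \<le> (1 + \<epsilon>)\<^sup>2 * a\<^sup>2 * ((1 + \<epsilon>) * b r) + 2 * (\<Sum>j\<in>?I. S j * Y j ^ 2)"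
  proof (intro add_mono mult_left_mono T_le mult_mono)
    have "r1\<^sup>2 \<le> n * (\<Sum>j\<in>?I. Rd j ^ 2 * Y j ^ 2)"
      unfolding r1 using fI(1) I n by (intro sum_mult_square_le) (auto simp: card_Diff_singleton)
    hence "(1 + 16 * n) * r1\<^sup>2 / T \<le> (1 + 16 * n) * (n * (\<Sum>j\<in>?I. Rd j ^ 2 * Y j ^ 2)) / T"
      using card_ge_one Tpos by (intro divide_right_mono mult_left_mono) auto
    also have "\<dots> = (\<Sum>j\<in>?I. ((1 + 16 * n) * n * Rd j ^ 2 / T) * Y j ^ 2)"
      by (simp add: sum_distrib_left sum_divide_distrib mult_ac)
    also have "\<dots> \<le> (\<Sum>j\<in>?I. S j * Y j ^ 2)"
      using remaining_derivative unfolding S_def T_def R_def Rd_def P_def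
      by (intro sum_mono mult_right_mono) auto
    finally show "(1 + 16 * n) * r1\<^sup>2 / T \<le> (\<Sum>j\<in>?I. S j * Y j ^ 2)" .
  qed (use eps card_ge_one Tpos in auto)
  also have "(1 + \<epsilon>)\<^sup>2 * a\<^sup>2 * ((1 + \<epsilon>) * b r) \<le> (1 + 1 / (2 * n)) * a\<^sup>2 * b r"
  proof -
    have "(1 + \<epsilon>) ^ 3 \<le> 1 + 7 * \<epsilon>"
    proof -
      have "\<epsilon>\<^sup>2 \<le> \<epsilon>" "\<epsilon> ^ 3 \<le> \<epsilon>" using eps power_decreasing[of 1 2 \<epsilon>] power_decreasing[of 1 3 \<epsilon>] by auto
      thus ?thesis by (simp add: power3_eq_cube power2_eq_square algebra_simps)
    qed
    also have "\<dots> \<le> 1 + 1 / (2 * n)" using card_ge_one by (simp add: \<epsilon>_def field_simps)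
    finally have "(1 + \<epsilon>) ^ 3 * (a\<^sup>2 * b r) \<le> (1 + 1 / (2 * n)) * (a\<^sup>2 * b r)"
      using large_bounds(3) by (intro mult_right_mono) auto
    thus ?thesis by (simp add: power3_eq_cube power2_eq_square mult_ac)
  qed
  finally have second: "(1 + \<epsilon>) * (S r * Y r ^ 2) \<le> (1 + 1 / (2 * n)) * a\<^sup>2 * b r + 2 * (\<Sum>j\<in>?I. S j * Y j ^ 2)"
    by simp
  from first second show ?thesis unfolding \<epsilon>_def by (simp add: algebra_simps)
qed

text \<open>Here \<open>b\<close> are the reciprocals of the eigenvalues of \<open>D\<^sup>2u\<close> and \<open>X i j\<close> the third derivatives
  \<open>u\<^sub>r\<^sub>i\<^sub>j\<close>; \<open>G\<close> and \<open>D\<close> are the first derivative of \<open>log (\<sigma>\<^sub>n / \<sigma>\<^sub>n\<^sub>-\<^sub>k)\<close> at \<open>D\<^sup>2u\<close> and its second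
  derivative in the direction \<open>X\<close>. The gain \<open>1 / (16 * n)\<close> is what
  absorbs the gradient terms of the cut-off \<open>(- u)\<^sup>\<beta>\<close>.\<close>

lemma third_order_estimate:
  fixes X :: "'a \<Rightarrow> 'a \<Rightarrow> real"
  assumes X: "\<And>i j. X i j = X j i"
  defines "S \<equiv> \<lambda>i. esym (k - 1) (I - {i}) b / esym k I b"
  defines "G \<equiv> \<lambda>i. (b i)\<^sup>2 * S i"
  defines "D \<equiv> (\<Sum>i\<in>I. \<Sum>j\<in>I-{i}. (X i i * X j j - (X i j)\<^sup>2) * (b i * b j * (1 - esym k (I - {i} - {j}) b / esym k I b)))
    - (\<Sum>i\<in>I. b i * X i i)\<^sup>2 + (\<Sum>i\<in>I. X i i * (b i * (esym k (I - {i}) b / esym k I b)))\<^sup>2"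
  shows "- 2 * (\<Sum>i\<in>I. \<Sum>j\<in>I-{r}. G i * (X i j)\<^sup>2 * (b j * (b r + b j))) - (\<Sum>i\<in>I. G i * (b r * X i r)\<^sup>2)
    \<le> b r * D - 1 / (16 * n) * (\<Sum>i\<in>I. G i * (b r * X i r)\<^sup>2) + b r * (\<Sum>i\<in>I. G i * X i i)\<^sup>2"
proof -
  let ?\<sigma> = "esym k I b"
  have sig: "?\<sigma> > 0" using I k bpos by (intro esym_pos) auto
  have S0: "S i \<ge> 0" if "i \<in> I" for i
    unfolding S_def using that sig bpos by (intro divide_nonneg_pos esym_nonneg) (auto intro: less_imp_le)
  have G0: "G i \<ge> 0" if "i \<in> I" for i unfolding G_def using S0[OF that] by simp
  \<comment> \<open>For i \<noteq> j, the second derivative of sigma_k in \<open>b i\<close> and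
    \<open>b j\<close>, divided by sigma_k.\<close>
  define e where "e i j = esym (k - 2) (I - {i} - {j}) b / ?\<sigma>" for i j
  have e_sym: "e i j = e j i" for i j unfolding e_def by (simp add: Diff_insert2[symmetric] insert_commute)
  have e0: "e i j \<ge> 0" for i j
    unfolding e_def using sig bpos by (intro divide_nonneg_pos esym_nonneg) (auto intro: less_imp_le)
  have S1: "esym k (I - {i}) b / ?\<sigma> = 1 - b i * S i" if "i \<in> I" for i
    using esym_remove[OF I(1) that, of k b] sig by (simp add: S_def field_simps)
  \<comment> \<open>Inclusion and exclusion over the k-subsets that meet {i, j}. This splits the
    off-diagonal coefficients of D into first-order parts S and a second-order part e.\<close>
  have S2: "1 - esym k (I - {i} - {j}) b / ?\<sigma> = b i * S i + b j * S j - b i * b j * e i j"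
    if ij: "i \<in> I" "j \<in> I - {i}" for i j
  proof -
    have "I - {j} - {i} = I - {i} - {j}" by auto
    hence "esym (k - 1) (I - {j}) b = esym (k - 1) (I - {i} - {j}) b + b i * esym (k - 2) (I - {i} - {j}) b"
      using esym_remove[of "I - {j}" i "k - 1" b] I ij by auto
    moreover have "?\<sigma> = esym k (I - {i}) b + b i * esym (k - 1) (I - {i}) b"
      using esym_remove[OF I(1) ij(1), of k b] .
    moreover have "esym k (I - {i}) b = esym k (I - {i} - {j}) b + b j * esym (k - 1) (I - {i} - {j}) b"
      using esym_remove[of "I - {i}" j k b] I ij by simp
    ultimately have "?\<sigma> - esym k (I - {i} - {j}) b
       = b i * esym (k - 1) (I - {i}) b + b j * esym (k - 1) (I - {j}) b - b i * b j * esym (k - 2) (I - {i} - {j}) b"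
      by (simp add: algebra_simps)
    hence "(?\<sigma> - esym k (I - {i} - {j}) b) / ?\<sigma> = b i * S i + b j * S j - b i * b j * e i j"
      unfolding S_def e_def by (simp add: diff_divide_distrib add_divide_distrib)
    thus ?thesis using sig by (simp add: diff_divide_distrib)
  qed
  \<comment> \<open>Only \<open>b r\<close> is split off. In \<open>off\<close>, the two terms on
    the right are what row r of the left-hand sum and the part H of D offer in exchange for the
    entries of column r.\<close>
  have Sj: "S j \<le> S r + b r * e r j" if j: "j \<in> I - {r}" for j
  proof -
    have "esym (k - 1) (I - {j}) b = esym (k - 1) (I - {r} - {j}) b + b r * esym (k - 2) (I - {r} - {j}) b"
      using esym_remove[of "I - {j}" r "k - 1" b] I j by (auto simp: Diff_insert2[symmetric] insert_commute)
    moreover have "esym (k - 1) (I - {r} - {j}) b \<le> esym (k - 1) (I - {r}) b"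
    proof -
      have "esym (k - 2) (I - {r} - {j}) b \<ge> 0" using bpos by (intro esym_nonneg) (auto intro: less_imp_le)
      thus ?thesis using esym_remove[of "I - {r}" j "k - 1" b] I j bpos[of j] by simp
    qed
    ultimately have "esym (k - 1) (I - {j}) b / ?\<sigma> \<le> (esym (k - 1) (I - {r}) b + b r * esym (k - 2) (I - {r} - {j}) b) / ?\<sigma>"
      using sig by (intro divide_right_mono) auto
    thus ?thesis unfolding S_def e_def by (simp add: add_divide_distrib)
  qed
  have swap: "(\<Sum>i\<in>I. \<Sum>j\<in>I-{i}. f i j) = (\<Sum>i\<in>I. \<Sum>j\<in>I-{i}. f j i)" for f :: "'a \<Rightarrow> 'a \<Rightarrow> real"
  proof -
    have r: "(\<Sum>j\<in>I-{i}. h j) = (\<Sum>j\<in>I. if j = i then 0 else h j)" for h :: "'a \<Rightarrow> real" and i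
      using I(1) by (intro sum.mono_neutral_cong_left) auto
    have "(\<Sum>i\<in>I. \<Sum>j\<in>I-{i}. f i j) = (\<Sum>j\<in>I. \<Sum>i\<in>I. if j = i then 0 else f i j)"
      unfolding r by (rule sum.swap)
    thus ?thesis unfolding r by (simp add: eq_commute)
  qed
  have split_row: "(\<Sum>i\<in>I. \<Sum>j\<in>I-{i}. f i j) = (\<Sum>i\<in>I. \<Sum>j\<in>I-{r}-{i}. f i j) + (\<Sum>i\<in>I-{r}. f i r)"
    for f :: "'a \<Rightarrow> 'a \<Rightarrow> real"
  proof -
    have "(\<Sum>j\<in>I-{i}. f i j) = (\<Sum>j\<in>I-{r}-{i}. f i j) + (if i = r then 0 else f i r)" if "i \<in> I" for i
    proof (cases "i = r")
      case False
      hence "I - {i} = insert r (I - {r} - {i})" using I by auto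
      thus ?thesis using I False by simp
    qed simp
    hence "(\<Sum>i\<in>I. \<Sum>j\<in>I-{i}. f i j) = (\<Sum>i\<in>I. \<Sum>j\<in>I-{r}-{i}. f i j) + (\<Sum>i\<in>I. if i = r then 0 else f i r)"
      by (simp add: sum.distrib)
    also have "(\<Sum>i\<in>I. if i = r then 0 else f i r) = (\<Sum>i\<in>I-{r}. f i r)"
      using I(1) by (intro sum.mono_neutral_cong_right) auto
    finally show ?thesis .
  qed
  have split_d: "(\<Sum>i\<in>I. \<Sum>j\<in>I-{r}. f i j) = (\<Sum>i\<in>I. \<Sum>j\<in>I-{r}-{i}. f i j) + (\<Sum>i\<in>I-{r}. f i i)"
    for f :: "'a \<Rightarrow> 'a \<Rightarrow> real"
  proof -
    have "(\<Sum>j\<in>I-{r}. f i j) = (\<Sum>j\<in>I-{r}-{i}. f i j) + (if i = r then 0 else f i i)" if "i \<in> I" for i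
    proof (cases "i = r")
      case False
      hence "I - {r} = insert i (I - {r} - {i})" using that by auto
      thus ?thesis using I False sum.remove[of "I - {r}" i "f i"] that by simp
    qed simp
    hence "(\<Sum>i\<in>I. \<Sum>j\<in>I-{r}. f i j) = (\<Sum>i\<in>I. \<Sum>j\<in>I-{r}-{i}. f i j) + (\<Sum>i\<in>I. if i = r then 0 else f i i)"
      by (simp add: sum.distrib)
    also have "(\<Sum>i\<in>I. if i = r then 0 else f i i) = (\<Sum>i\<in>I-{r}. f i i)"
      using I(1) by (intro sum.mono_neutral_cong_right) auto
    finally show ?thesis .
  qed
  have ge_row: "(\<Sum>i\<in>I. \<Sum>j\<in>I-{r}-{i}. f i j) \<ge> (\<Sum>j\<in>I-{r}. f r j)"
    if "\<And>i j. i \<in> I \<Longrightarrow> j \<in> I \<Longrightarrow> f i j \<ge> 0" for f :: "'a \<Rightarrow> 'a \<Rightarrow> real"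
  proof -
    have "(\<Sum>i\<in>I. \<Sum>j\<in>I-{r}-{i}. f i j) = (\<Sum>j\<in>I-{r}-{r}. f r j) + (\<Sum>i\<in>I-{r}. \<Sum>j\<in>I-{r}-{i}. f i j)"
      by (rule sum.remove[OF I])
    moreover have "(\<Sum>i\<in>I-{r}. \<Sum>j\<in>I-{r}-{i}. f i j) \<ge> 0" using that by (intro sum_nonneg) auto
    ultimately show ?thesis by simp
  qed
  \<comment> \<open>To first order, \<open>b i\<close> changes by \<open>- Y i\<close> when its
    reciprocal, the i-th eigenvalue, changes by \<open>X i i\<close>. The diagonal part of D thus
    becomes a statement on sigma_k at b in the direction Y.\<close>
  define y where "y i = b i * X i i" for i
  define Y where "Y i = b i * y i" for i
  define A where "A = (\<Sum>i\<in>I. y i)"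
  define s where "s = (\<Sum>i\<in>I. S i * Y i)"
  have s_alt: "(\<Sum>i\<in>I. G i * X i i) = s"
    unfolding s_def G_def Y_def y_def by (intro sum.cong) (auto simp: power2_eq_square)
  define D2 where "D2 = (\<Sum>i\<in>I. \<Sum>j\<in>I-{i}. Y i * Y j * e i j)"
  have A2: "(\<Sum>i\<in>I. X i i * (b i * (esym k (I - {i}) b / ?\<sigma>))) = A - s"
  proof -
    have "(\<Sum>i\<in>I. X i i * (b i * (esym k (I - {i}) b / ?\<sigma>))) = (\<Sum>i\<in>I. y i - S i * Y i)"
      by (intro sum.cong refl) (simp add: S1 y_def Y_def algebra_simps)
    thus ?thesis by (simp add: A_def s_def sum_subtractf)
  qed
  have OD1: "(\<Sum>i\<in>I. \<Sum>j\<in>I-{i}. X i i * X j j * (b i * b j * (1 - esym k (I - {i} - {j}) b / ?\<sigma>)))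
     = 2 * A * s - 2 * (\<Sum>i\<in>I. S i * b i * (y i)\<^sup>2) - D2"
  proof -
    have "(\<Sum>i\<in>I. \<Sum>j\<in>I-{i}. X i i * X j j * (b i * b j * (1 - esym k (I - {i} - {j}) b / ?\<sigma>)))
      = (\<Sum>i\<in>I. \<Sum>j\<in>I-{i}. y j * (S i * Y i) + y i * (S j * Y j) - Y i * Y j * e i j)"
      by (intro sum.cong refl) (simp add: S2 y_def Y_def algebra_simps)
    also have "\<dots> = 2 * (\<Sum>i\<in>I. \<Sum>j\<in>I-{i}. y j * (S i * Y i)) - D2"
      using swap[of "\<lambda>i j. y j * (S i * Y i)"] by (simp add: sum.distrib sum_subtractf D2_def)
    also have "(\<Sum>i\<in>I. \<Sum>j\<in>I-{i}. y j * (S i * Y i)) = (\<Sum>i\<in>I. (A - y i) * (S i * Y i))"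
      using I(1) by (intro sum.cong refl) (simp add: A_def sum_distrib_right[symmetric] sum_diff1)
    also have "\<dots> = A * s - (\<Sum>i\<in>I. S i * b i * (y i)\<^sup>2)"
      by (simp add: s_def Y_def sum_distrib_left sum_subtractf[symmetric] algebra_simps power2_eq_square)
    finally show ?thesis by simp
  qed
  \<comment> \<open>Column r is kept apart as V': the multiple of V cancels against the left-hand
    sum, whereas V' carries the large weight \<open>b r\<close> and has to be paid for in
    \<open>off\<close>.\<close>
  define V where "V = (\<Sum>i\<in>I. \<Sum>j\<in>I-{r}-{i}. G i * (X i j)\<^sup>2 * b j)"
  define V' where "V' = (\<Sum>i\<in>I-{r}. G i * (X i r)\<^sup>2 * b r)"
  define H where "H = (\<Sum>i\<in>I. \<Sum>j\<in>I-{i}. (X i j)\<^sup>2 * ((b i)\<^sup>2 * (b j)\<^sup>2 * e i j))"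
  have OD2: "(\<Sum>i\<in>I. \<Sum>j\<in>I-{i}. (X i j)\<^sup>2 * (b i * b j * (1 - esym k (I - {i} - {j}) b / ?\<sigma>)))
     = 2 * (V + V') - H"
  proof -
    have "(\<Sum>i\<in>I. \<Sum>j\<in>I-{i}. (X i j)\<^sup>2 * (b i * b j * (1 - esym k (I - {i} - {j}) b / ?\<sigma>)))
      = (\<Sum>i\<in>I. \<Sum>j\<in>I-{i}. G i * (X i j)\<^sup>2 * b j + G j * (X j i)\<^sup>2 * b i - (X i j)\<^sup>2 * ((b i)\<^sup>2 * (b j)\<^sup>2 * e i j))"
    proof (intro sum.cong refl)
      fix i j assume ij: "i \<in> I" "j \<in> I - {i}"
      show "(X i j)\<^sup>2 * (b i * b j * (1 - esym k (I - {i} - {j}) b / ?\<sigma>))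
        = G i * (X i j)\<^sup>2 * b j + G j * (X j i)\<^sup>2 * b i - (X i j)\<^sup>2 * ((b i)\<^sup>2 * (b j)\<^sup>2 * e i j)"
        unfolding S2[OF ij] X[of j i] G_def by (simp add: algebra_simps power2_eq_square)
    qed
    also have "\<dots> = 2 * (\<Sum>i\<in>I. \<Sum>j\<in>I-{i}. G i * (X i j)\<^sup>2 * b j) - H"
      using swap[of "\<lambda>i j. G i * (X i j)\<^sup>2 * b j"] by (simp add: sum.distrib sum_subtractf H_def)
    finally show ?thesis unfolding split_row V_def V'_def .
  qed
  have D: "D = - 2 * (\<Sum>i\<in>I. S i * b i * (y i)\<^sup>2) - (D2 - s\<^sup>2) - 2 * (V + V') + H"
  proof -
    have "D = (2 * A * s - 2 * (\<Sum>i\<in>I. S i * b i * (y i)\<^sup>2) - D2) - (2 * (V + V') - H) - A\<^sup>2 + (A - s)\<^sup>2"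
    proof -
      have "(\<Sum>i\<in>I. b i * X i i) = A" by (simp add: A_def y_def)
      thus ?thesis unfolding D_def A2 left_diff_distrib sum_subtractf OD1 OD2 by simp
    qed
    thus ?thesis by (simp add: power2_eq_square algebra_simps)
  qed
  have H: "H \<ge> 2 * (\<Sum>j\<in>I-{r}. (X r j)\<^sup>2 * ((b r)\<^sup>2 * (b j)\<^sup>2 * e r j))"
  proof -
    have "(\<Sum>i\<in>I-{r}. (X i r)\<^sup>2 * ((b i)\<^sup>2 * (b r)\<^sup>2 * e i r)) = (\<Sum>j\<in>I-{r}. (X r j)\<^sup>2 * ((b r)\<^sup>2 * (b j)\<^sup>2 * e r j))"
      by (intro sum.cong refl) (metis X e_sym mult.commute)
    moreover have "(\<Sum>i\<in>I. \<Sum>j\<in>I-{r}-{i}. (X i j)\<^sup>2 * ((b i)\<^sup>2 * (b j)\<^sup>2 * e i j)) \<ge> (\<Sum>j\<in>I-{r}. (X r j)\<^sup>2 * ((b r)\<^sup>2 * (b j)\<^sup>2 * e r j))"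
      using e0 by (intro ge_row) auto
    ultimately show ?thesis unfolding H_def split_row by simp
  qed
  have L: "(\<Sum>i\<in>I. \<Sum>j\<in>I-{r}. G i * (X i j)\<^sup>2 * (b j * (b r + b j)))
     \<ge> b r * V + (\<Sum>j\<in>I-{r}. G r * (X r j)\<^sup>2 * (b j)\<^sup>2) + (\<Sum>j\<in>I-{r}. S j * b j * (y j)\<^sup>2 * b r + S j * (Y j)\<^sup>2)"
  proof -
    have 1: "(\<Sum>j\<in>I-{r}. G j * (X j j)\<^sup>2 * (b j * (b r + b j))) = (\<Sum>j\<in>I-{r}. S j * b j * (y j)\<^sup>2 * b r + S j * (Y j)\<^sup>2)"
      by (intro sum.cong refl) (simp add: G_def y_def Y_def power2_eq_square algebra_simps)
    have "(\<Sum>i\<in>I. \<Sum>j\<in>I-{r}-{i}. G i * (X i j)\<^sup>2 * (b j * (b r + b j)))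
       = b r * V + (\<Sum>i\<in>I. \<Sum>j\<in>I-{r}-{i}. G i * (X i j)\<^sup>2 * (b j)\<^sup>2)"
      unfolding V_def by (simp add: sum_distrib_left sum.distrib[symmetric] algebra_simps power2_eq_square)
    moreover have "(\<Sum>i\<in>I. \<Sum>j\<in>I-{r}-{i}. G i * (X i j)\<^sup>2 * (b j)\<^sup>2) \<ge> (\<Sum>j\<in>I-{r}. G r * (X r j)\<^sup>2 * (b j)\<^sup>2)"
      using G0 by (intro ge_row) auto
    ultimately show ?thesis unfolding split_d 1 by simp
  qed
  define c0 where "c0 = 1 / (16 * n)"
  have c0: "0 \<le> c0" "c0 \<le> 1" using card_ge_one by (auto simp: c0_def)
  \<comment> \<open>The left-hand side of the estimate already offers one unit of G i (b r X i r)^2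
    and the gain takes back c0 of it. What then remains of V' has coefficient (1 + c0) S j, at most
    2 S j, and \<open>Sj\<close> covers it.\<close>
  have off: "2 * (\<Sum>j\<in>I-{r}. G r * (X r j)\<^sup>2 * (b j)\<^sup>2) + 2 * b r * (\<Sum>j\<in>I-{r}. (X r j)\<^sup>2 * ((b r)\<^sup>2 * (b j)\<^sup>2 * e r j))
     \<ge> 2 * b r * V' - (1 - c0) * (\<Sum>i\<in>I-{r}. G i * (b r * X i r)\<^sup>2)"
  proof -
    have "2 * b r * V' - (1 - c0) * (\<Sum>i\<in>I-{r}. G i * (b r * X i r)\<^sup>2)
      = (\<Sum>j\<in>I-{r}. (1 + c0) * S j * ((X r j)\<^sup>2 * (b r)\<^sup>2 * (b j)\<^sup>2))"
      unfolding V'_def sum_distrib_left sum_subtractf[symmetric]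
      by (intro sum.cong refl) (simp add: X[of _ r] G_def algebra_simps power2_eq_square)
    also have "\<dots> \<le> (\<Sum>j\<in>I-{r}. 2 * (S r + b r * e r j) * ((X r j)\<^sup>2 * (b r)\<^sup>2 * (b j)\<^sup>2))"
    proof (intro sum_mono mult_right_mono)
      fix j assume j: "j \<in> I - {r}"
      have "(1 + c0) * S j \<le> 2 * S j" using c0 S0[of j] j by (intro mult_right_mono) auto
      thus "(1 + c0) * S j \<le> 2 * (S r + b r * e r j)" using Sj[OF j] by simp
    qed auto
    also have "\<dots> = 2 * (\<Sum>j\<in>I-{r}. G r * (X r j)\<^sup>2 * (b j)\<^sup>2) + 2 * b r * (\<Sum>j\<in>I-{r}. (X r j)\<^sup>2 * ((b r)\<^sup>2 * (b j)\<^sup>2 * e r j))"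
      by (simp add: sum_distrib_left sum.distrib[symmetric] G_def algebra_simps power2_eq_square)
    finally show ?thesis .
  qed
  have diag: "b r * (D2 - s\<^sup>2) + S r * (Y r)\<^sup>2 - 2 * (\<Sum>j\<in>I-{r}. S j * (Y j)\<^sup>2)
    \<le> - c0 * (S r * (Y r)\<^sup>2) + b r * s\<^sup>2"
  proof -
    have "D2 = (\<Sum>i\<in>I. \<Sum>j\<in>I-{i}. Y i * Y j * esym (k - 2) (I - {i} - {j}) b) / ?\<sigma>"
      unfolding D2_def e_def by (simp add: sum_divide_distrib)
    thus ?thesis using diagonal_estimate[of Y] unfolding S_def s_def c0_def by simp
  qed
  have GX: "(\<Sum>i\<in>I. G i * (b r * X i r)\<^sup>2) = S r * (Y r)\<^sup>2 + (\<Sum>i\<in>I-{r}. G i * (b r * X i r)\<^sup>2)"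
    by (subst sum.remove[OF I]) (simp add: G_def Y_def y_def power2_eq_square)
  have SS: "b r * (\<Sum>i\<in>I. S i * b i * (y i)\<^sup>2) = S r * (Y r)\<^sup>2 + (\<Sum>j\<in>I-{r}. S j * b j * (y j)\<^sup>2 * b r)"
    by (subst sum.remove[OF I]) (simp add: Y_def power2_eq_square sum_distrib_left algebra_simps)
  have bH: "b r * H \<ge> b r * (2 * (\<Sum>j\<in>I-{r}. (X r j)\<^sup>2 * ((b r)\<^sup>2 * (b j)\<^sup>2 * e r j)))"
    using H large_bounds(3) by (intro mult_left_mono) auto
  have "b r * D = - 2 * (b r * (\<Sum>i\<in>I. S i * b i * (y i)\<^sup>2)) - b r * (D2 - s\<^sup>2) - 2 * (b r * V) - 2 * b r * V' + b r * H"
    unfolding D by (simp add: algebra_simps)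
  with SS L off diag bH show ?thesis
    unfolding s_alt GX c0_def[symmetric] by (simp add: sum.distrib algebra_simps)
qed

end

section \<open>Eigenvalues and elementary symmetric functions of a symmetric matrix\<close>

text \<open>A minimiser v of the quadratic form on the unit sphere of V is an eigenvector: the
  residual w = f v - l v lies in V and is orthogonal to v, and the first-order gain 2 t |w|^2 at v +
  t w contradicts minimality for small t < 0 unless w = 0.\<close>

lemma selfadjoint_eigenvector_in_subspace:
  fixes f :: "'a::euclidean_space \<Rightarrow> 'a"
  assumes f: "linear f" and sa: "\<And>x y. f x \<bullet> y = x \<bullet> f y"
    and V: "subspace V" "\<And>x. x \<in> V \<Longrightarrow> f x \<in> V" and ne: "x0 \<in> V" "x0 \<noteq> 0"
  obtains v l where "v \<in> V" "norm v = 1" "f v = l *\<^sub>R v"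
proof -
  let ?S = "V \<inter> sphere 0 1"
  have "compact ?S" using V(1) by (intro closed_Int_compact closed_subspace) auto
  moreover have "(1 / norm x0) *\<^sub>R x0 \<in> ?S"
    using ne V(1) by (auto simp: subspace_scale)
  moreover have "continuous_on ?S (\<lambda>x. x \<bullet> f x)"
    using f by (intro continuous_intros linear_continuous_on) (simp add: linear_linear)
  ultimately obtain v where v: "v \<in> ?S" "\<And>x. x \<in> ?S \<Longrightarrow> v \<bullet> f v \<le> x \<bullet> f x"
    by (metis continuous_attains_inf empty_iff)
  define l where "l = v \<bullet> f v"
  have vv: "v \<bullet> v = 1" using v(1) by (simp add: dot_square_norm)
  have min: "l * (x \<bullet> x) \<le> x \<bullet> f x" if "x \<in> V" for x
  proof (cases "x = 0")
    case False
    have "(1 / norm x) *\<^sub>R x \<in> ?S" using that V(1) False by (auto simp: subspace_scale)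
    from v(2)[OF this] have "l \<le> (x \<bullet> f x) / (norm x)\<^sup>2"
      by (simp add: l_def linear_scale[OF f] power2_eq_square)
    thus ?thesis using False by (simp add: pos_le_divide_eq dot_square_norm)
  qed simp
  define w where "w = f v - l *\<^sub>R v"
  have wV: "w \<in> V" unfolding w_def using V v(1) by (intro subspace_diff subspace_scale) auto
  have wv: "w \<bullet> v = 0" 
    unfolding w_def inner_diff_left inner_scaleR_left vv l_def by (simp add: inner_commute)
  have fvw: "w \<bullet> f v = w \<bullet> w"
    unfolding w_def by (simp add: inner_diff_right) (use wv in \<open>simp add: w_def inner_commute\<close>)
  have q: "0 \<le> 2 * t * (w \<bullet> w) + t\<^sup>2 * (w \<bullet> f w - l * (w \<bullet> w))" for t
  proof -
    have "v + t *\<^sub>R w \<in> V" using V v(1) wV by (intro subspace_add subspace_scale) auto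
    from min[OF this] have "l * ((v + t *\<^sub>R w) \<bullet> (v + t *\<^sub>R w)) \<le> (v + t *\<^sub>R w) \<bullet> (f v + t *\<^sub>R f w)"
      by (simp add: linear_add[OF f] linear_scale[OF f])
    moreover have "v \<bullet> f w = w \<bullet> w" using sa[of v w] fvw by (simp add: inner_commute)
    moreover have "v \<bullet> w = 0" using wv by (simp add: inner_commute)
    ultimately show ?thesis
      using wv fvw vv by (simp add: inner_add_left inner_add_right l_def[symmetric] algebra_simps power2_eq_square)
  qed
  have "w \<bullet> w = 0"
  proof (rule ccontr)
    assume "w \<bullet> w \<noteq> 0"
    hence p: "w \<bullet> w > 0" by (simp add: order_less_le)
    define c where "c = \<bar>w \<bullet> f w - l * (w \<bullet> w)\<bar> + 1"
    have c: "c > 0" "w \<bullet> f w - l * (w \<bullet> w) \<le> c" by (auto simp: c_def)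
    define t where "t = - (w \<bullet> w) / c"
    have "t\<^sup>2 * (w \<bullet> f w - l * (w \<bullet> w)) \<le> t\<^sup>2 * c" using c by (intro mult_left_mono) auto
    also have "\<dots> = - t * (w \<bullet> w)" using c by (simp add: t_def power2_eq_square)
    finally have "0 \<le> t * (w \<bullet> w)" using q[of t] by simp
    moreover have "t < 0" using p c by (simp add: t_def)
    ultimately show False using p by (simp add: zero_le_mult_iff)
  qed
  hence "f v = l *\<^sub>R v" by (simp add: w_def)
  thus ?thesis using that v(1) by auto
qed

text \<open>A largest orthonormal set of eigenvectors spans: its orthogonal complement is invariant
  under f and, if nonzero, would hold one more eigenvector.\<close>

lemma selfadjoint_orthonormal_eigenbasis:
  fixes f :: "'a::euclidean_space \<Rightarrow> 'a"
  assumes f: "linear f" and sa: "\<And>x y. f x \<bullet> y = x \<bullet> f y"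
  obtains B where "finite B" "card B = DIM('a)" "pairwise orthogonal B"
    "\<And>v. v \<in> B \<Longrightarrow> norm v = 1" "\<And>v. v \<in> B \<Longrightarrow> \<exists>l. f v = l *\<^sub>R v"
proof -
  define Q where "Q B \<longleftrightarrow> pairwise orthogonal B \<and> (\<forall>v\<in>B. norm v = 1 \<and> (\<exists>l. f v = l *\<^sub>R v))" for B
  have ind: "independent B" if "Q B" for B
    using that unfolding Q_def by (intro pairwise_orthogonal_independent) auto
  have "Q {}" by (simp add: Q_def)
  moreover have "\<forall>B. Q B \<longrightarrow> card B < Suc (DIM('a))"
    using ind independent_bound by (auto simp: less_Suc_eq_le)
  ultimately obtain B where B: "Q B" "\<And>C. Q C \<Longrightarrow> card C \<le> card B"
    using ex_has_greatest_nat[of Q "{}" card "Suc (DIM('a))"] by metis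
  have fB: "finite B" using ind[OF B(1)] independent_bound by blast
  have sp: "span B = UNIV"
  proof (rule ccontr)
    assume "span B \<noteq> UNIV"
    hence "span B \<subset> span UNIV" by auto
    then obtain x0 where x0: "x0 \<noteq> 0" "\<And>y. y \<in> span B \<Longrightarrow> orthogonal x0 y"
      by (rule orthogonal_to_subspace_exists_gen) blast
    let ?V = "{x. \<forall>y\<in>B. orthogonal y x}"
    have V: "subspace ?V" by (rule subspace_orthogonal_to_vectors)
    have "x0 \<in> ?V" using x0 span_base by (auto simp: orthogonal_commute)
    moreover have "f x \<in> ?V" if "x \<in> ?V" for x
    proof (safe)
      fix y assume y: "y \<in> B"
      then obtain l where "f y = l *\<^sub>R y" using B(1) by (auto simp: Q_def)
      moreover have "y \<bullet> x = 0" using that y by (auto simp: orthogonal_def)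
      ultimately show "orthogonal y (f x)" using sa[of y x] by (simp add: orthogonal_def)
    qed
    ultimately obtain v l where v: "v \<in> ?V" "norm v = 1" "f v = l *\<^sub>R v"
      using selfadjoint_eigenvector_in_subspace[OF f sa V] x0(1) by blast
    have "v \<notin> B" using v by (auto simp: orthogonal_def)
    moreover have "Q (insert v B)"
      using B(1) v unfolding Q_def by (auto simp: pairwise_insert orthogonal_commute)
    ultimately show False using B(2)[of "insert v B"] fB by simp
  qed
  have "card B = DIM('a)" using ind[OF B(1)] sp by (metis dim_UNIV dim_eq_card_independent dim_span)
  thus ?thesis using that[of B] fB B(1) by (auto simp: Q_def)
qed

text \<open>Indexing by \<open>'n\<close> itself makes such a family a basis of
  \<open>real^'n\<close> and lets the eigenvalues be a function on the same index type.\<close>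

definition orthonormal_family :: "('n \<Rightarrow> real^'n) \<Rightarrow> bool" where
  "orthonormal_family e \<longleftrightarrow> (\<forall>i j. e i \<bullet> e j = (if i = j then 1 else 0))"

lemma symmetric_eigenbasis:
  fixes A :: "real^'n^'n"
  assumes "transpose A = A"
  obtains e l where "orthonormal_family e" "\<And>i::'n. A *v e i = l i *\<^sub>R e i"
proof -
  have sa: "(A *v x) \<bullet> y = x \<bullet> (A *v y)" for x y
    by (metis assms dot_lmul_matrix vector_transpose_matrix)
  obtain B where B: "finite B" "card B = DIM(real^'n)" "pairwise orthogonal B"
    "\<And>v. v \<in> B \<Longrightarrow> norm v = 1" "\<And>v. v \<in> B \<Longrightarrow> \<exists>l. A *v v = l *\<^sub>R v"
    using selfadjoint_orthonormal_eigenbasis[OF matrix_vector_mul_linear[of A] sa] by blast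
  have "card (UNIV :: 'n set) = card B" using B(2) by simp
  then obtain e where e: "bij_betw e (UNIV :: 'n set) B"
    using finite_same_card_bij[of "UNIV :: 'n set" B] B(1) by auto
  have eB: "e i \<in> B" for i using e by (auto simp: bij_betw_def)
  have "e i \<bullet> e j = (if i = j then 1 else 0)" for i j
    using B(3) B(4)[OF eB[of i]] eB[of i] eB[of j] e
    by (auto simp: pairwise_def orthogonal_def bij_betw_def inj_eq dot_square_norm)
  hence "orthonormal_family e" by (simp add: orthonormal_family_def)
  moreover obtain l where "\<And>i. A *v e i = l i *\<^sub>R e i" using B(5)[OF eB] by metis
  ultimately show ?thesis using that by blast
qed

lemma orthonormal_expand:
  fixes e :: "'n \<Rightarrow> real^'n"
  assumes "orthonormal_family e"
  shows "x = (\<Sum>i\<in>UNIV. (x \<bullet> e i) *\<^sub>R e i)"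
proof -
  have inj: "inj e"
  proof (rule injI)
    fix i j assume "e i = e j"
    thus "i = j" using assms unfolding orthonormal_family_def by (metis zero_neq_one)
  qed
  have "independent (range e)"
    using assms by (intro pairwise_orthogonal_independent)
      (auto simp: orthonormal_family_def pairwise_def orthogonal_def split: if_splits,
       metis inner_zero_left zero_neq_one)
  moreover have "card (range e) = DIM(real^'n)" using inj by (simp add: card_image)
  ultimately have sp: "span (range e) = UNIV"
    by (metis card_eq_dim dim_UNIV finiteI_independent subset_UNIV top.extremum_uniqueI)
  let ?y = "x - (\<Sum>i\<in>UNIV. (x \<bullet> e i) *\<^sub>R e i)"
  have d: "e i \<bullet> e j = (if i = j then 1 else 0)" for i j
    using assms by (simp add: orthonormal_family_def)
  have "orthogonal ?y z" if "z \<in> range e" for z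
    using that by (auto simp: orthogonal_def inner_diff_left inner_sum_left d if_distrib cong: if_cong)
  hence "orthogonal ?y ?y" using orthogonal_to_span[of ?y "range e" ?y] sp by auto
  thus ?thesis by (simp add: orthogonal_self)
qed

lemma det_in_basis:
  fixes A :: "real^'n^'n"
  assumes "orthonormal_family e"
  shows "det (\<chi> i j. e i \<bullet> (A *v e j)) = det A"
proof -
  define P :: "real^'n^'n" where "P = (\<chi> i j. e j $ i)"
  have "transpose P ** P = mat 1"
    using assms by (simp add: P_def vec_eq_iff matrix_matrix_mult_def transpose_def mat_def orthonormal_family_def inner_vec_def)
  hence "det (transpose P) * det P = 1" by (metis det_I det_mul)
  moreover have "(\<chi> i j. e i \<bullet> (A *v e j)) = transpose P ** A ** P"
    by (simp add: P_def vec_eq_iff matrix_matrix_mult_def transpose_def inner_vec_def matrix_vector_mult_def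
        sum_distrib_left sum_distrib_right)
      (subst sum.swap, simp add: mult_ac)
  ultimately show ?thesis by (simp add: det_mul)
qed

section \<open>Characteristic polynomial and eigenvalues in an orthonormal eigenbasis\<close>

lemma poly_det:
  fixes M :: "real poly^'n^'n"
  shows "poly (det M) s = det (\<chi> i j. poly (M $ i $ j) s)"
proof -
  have "poly (of_int z :: real poly) s = of_int z" for z
    by (simp add: of_int_poly)
  thus ?thesis by (simp add: det_def poly_sum poly_prod)
qed

lemma shifted_matrix_mult:
  fixes A :: "real^'n^'n"
  shows "(\<chi> i j. (if i = j then s else 0) + c * A $ i $ j) *v x = s *\<^sub>R x + c *\<^sub>R (A *v x)" (is "?M *v x = _")
proof (unfold vec_eq_iff, rule allI)
  fix a
  have "(?M *v x) $ a = (\<Sum>j\<in>UNIV. (if a = j then s * x $ j else 0) + c * (A $ a $ j * x $ j))"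
    unfolding matrix_vector_mult_def by (simp, rule sum.cong) (auto simp: algebra_simps)
  also have "\<dots> = s * x $ a + c * (A *v x) $ a"
    by (simp add: sum.distrib sum_distrib_left matrix_vector_mult_def)
  finally show "(?M *v x) $ a = (s *\<^sub>R x + c *\<^sub>R (A *v x)) $ a" by simp
qed

text \<open>The parameter c serves two cases: c = -1 is the characteristic polynomial, and c = 1 is
  the determinant of s I + A, whose coefficients in s are the sigma_j.\<close>

lemma det_eigenbasis:
  fixes A :: "real^'n^'n"
  assumes e: "orthonormal_family e" and A: "\<And>i. A *v e i = l i *\<^sub>R e i"
  shows "det (\<chi> i j. (if i = j then s else 0) + c * A $ i $ j) = (\<Prod>i\<in>UNIV. s + c * l i)"
proof -
  let ?M = "\<chi> i j. (if i = j then s else 0) + c * A $ i $ j"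
  have Me: "?M *v e j = (s + c * l j) *\<^sub>R e j" for j
    unfolding shifted_matrix_mult A by (simp add: scaleR_left_distrib)
  have "e i \<bullet> (?M *v e j) = (if i = j then s + c * l i else 0)" for i j
    unfolding Me using e by (simp add: orthonormal_family_def)
  hence "det ?M = det (\<chi> i j. if i = j then s + c * l i else 0)"
    unfolding det_in_basis[OF e, of ?M, symmetric] by (simp only:)
  also have "\<dots> = (\<Prod>i\<in>UNIV. s + c * l i)" by (subst det_diagonal) auto
  finally show ?thesis .
qed

lemma char_polynomial_eigenbasis:
  fixes A :: "real^'n^'n"
  assumes e: "orthonormal_family e" and A: "\<And>i. A *v e i = l i *\<^sub>R e i"
  shows "char_polynomial A = (\<Prod>i\<in>UNIV. [:- l i, 1:])"
proof -
  have "poly (char_polynomial A) s = poly (\<Prod>i\<in>UNIV. [:- l i, 1:]) s" for s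
  proof -
    have "poly (char_polynomial A) s = det (\<chi> i j. (if i = j then s else 0) + (- 1) * A $ i $ j)"
      unfolding char_polynomial_def poly_det by (intro arg_cong[of _ _ det]) (simp add: vec_eq_iff)
    thus ?thesis unfolding det_eigenbasis[OF assms] by (simp add: poly_prod)
  qed
  thus ?thesis by (metis poly_eq_poly_eq_iff ext)
qed

lemma eigvals_eigenbasis:
  fixes A :: "real^'n^'n"
  assumes e: "orthonormal_family e" and A: "\<And>i. A *v e i = l i *\<^sub>R e i"
  shows "eigvals A = image_mset l (mset_set UNIV)"
proof -
  have "(\<Sum>i\<in>J. {#l i#}) = image_mset l (mset_set J)" if "finite J" for J
    using that by (induction J rule: finite_induct) auto
  thus ?thesis
    unfolding eigvals_def char_polynomial_eigenbasis[OF assms] by (subst proots_prod) auto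
qed

lemma lambda_min_eigenbasis:
  fixes A :: "real^'n^'n"
  assumes "orthonormal_family e" "\<And>i. A *v e i = l i *\<^sub>R e i"
  shows "lambda_min A = Min (range l)"
  unfolding lambda_min_def eigvals_eigenbasis[OF assms] by simp

section \<open>Elementary symmetric functions as coefficients of polynomials\<close>

lemma coeff_prod_esym:
  assumes "finite I"
  shows "coeff (\<Prod>i\<in>I. [:1, b i:]) j = esym (int j) I b"
  using assms
proof (induction I arbitrary: j rule: finite_induct)
  case empty
  show ?case by (simp add: esym_empty)
next
  case (insert x I)
  show ?case
  proof (cases j)
    case 0
    thus ?thesis using insert by (simp add: esym_insert esym_neg)
  next
    case (Suc j')
    thus ?thesis using insert by (simp add: esym_insert)
  qed
qed

lemma coeff_prod_esym_complement:
  assumes "finite I"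
  shows "coeff (\<Prod>i\<in>I. [:l i, 1:]) j = esym (int (card I) - int j) I l"
  using assms
proof (induction I arbitrary: j rule: finite_induct)
  case empty
  show ?case by (simp add: esym_empty)
next
  case (insert x I)
  have e: "esym (1 + int (card I) - int j) (insert x I) l
    = esym (1 + int (card I) - int j) I l + l x * esym (int (card I) - int j) I l"
    using esym_insert[OF insert.hyps, of "1 + int (card I) - int j" l] by (simp add: algebra_simps)
  show ?case
  proof (cases j)
    case 0
    thus ?thesis using insert e by (simp add: esym_gt_card)
  next
    case (Suc j')
    thus ?thesis using insert e by (simp add: algebra_simps)
  qed
qed

text \<open>A product over a subset is the full product times the product of the reciprocals over
  the complement. This turns sigma_n / sigma_(n-k) of the eigenvalues into 1 / sigma_k of their
  reciprocals.\<close>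

lemma esym_complement:
  assumes "finite I" "\<And>i. i \<in> I \<Longrightarrow> l i * b i = 1"
  shows "esym (int (card I) - m) I l = prod l I * esym m I b"
  using assms
proof (induction I arbitrary: m rule: finite_induct)
  case empty
  show ?case by (simp add: esym_empty)
next
  case (insert x I)
  have IH: "esym (int (card I) - m) I l = prod l I * esym m I b" for m
    using insert by auto
  have "esym (int (card (insert x I)) - m) (insert x I) l
     = esym (int (card I) - (m - 1)) I l + l x * esym (int (card I) - m) I l"
    using insert.hyps esym_insert[OF insert.hyps, of "int (card (insert x I)) - m" l] by (simp add: algebra_simps)
  also have "\<dots> = prod l I * (l x * b x) * esym (m - 1) I b + l x * prod l I * esym m I b"
    unfolding IH using insert.prems[of x] by simp
  also have "\<dots> = prod l (insert x I) * esym m (insert x I) b"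
    using insert.hyps by (simp add: esym_insert algebra_simps)
  finally show ?case .
qed

text \<open>The sorted list and the family \<open>l\<close> enumerate the same multiset by different
  index sets. Both sums are coefficients of the product of 1 + x T over that multiset, which does
  not see the enumeration.\<close>

lemma sigma_eigenbasis:
  fixes A :: "real^'n^'n"
  assumes "orthonormal_family e" "\<And>i. A *v e i = l i *\<^sub>R e i"
  shows "sigma j A = esym (int j) UNIV l"
proof -
  define xs where "xs = sorted_list_of_multiset (eigvals A)"
  have xs: "mset xs = image_mset l (mset_set UNIV)"
    by (simp add: xs_def eigvals_eigenbasis[OF assms])
  have "sigma j A = esym (int j) {..<length xs} ((!) xs)"
    unfolding sigma_def elem_sym_def esym_def xs_def[symmetric] by simp
  also have "\<dots> = coeff (\<Prod>i<length xs. [:1, xs ! i:]) j" by (simp add: coeff_prod_esym)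
  also have "(\<Prod>i<length xs. [:1, xs ! i:]) = prod_list (map (\<lambda>x. [:1, x:]) xs)"
    by (simp add: prod.list_conv_set_nth lessThan_atLeast0)
  also have "\<dots> = prod_mset (image_mset (\<lambda>x. [:1, x:]) (mset xs))"
    by (metis mset_map prod_mset_prod_list)
  also have "\<dots> = (\<Prod>i\<in>UNIV. [:1, l i:])"
    unfolding xs by (simp add: prod_unfold_prod_mset image_mset.compositionality comp_def)
  also have "coeff \<dots> j = esym (int j) UNIV l" by (rule coeff_prod_esym) simp
  finally show ?thesis .
qed

lemma hess_quot_eigenbasis:
  fixes A :: "real^'n^'n"
  assumes "orthonormal_family e" "\<And>i. A *v e i = l i *\<^sub>R e i" "k \<le> CARD('n)"
    and "\<And>i. l i \<noteq> 0"
  shows "hess_quot k A = 1 / esym (int k) UNIV (\<lambda>i. 1 / l i)"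
proof -
  have "prod l UNIV \<noteq> 0" using assms(4) by simp
  moreover have "sigma CARD('n) A = prod l UNIV"
    unfolding sigma_eigenbasis[OF assms(1,2)] using esym_card[of "UNIV :: 'n set" l] by simp
  moreover have "sigma (CARD('n) - k) A = prod l UNIV * esym (int k) UNIV (\<lambda>i. 1 / l i)"
    unfolding sigma_eigenbasis[OF assms(1,2)]
    using esym_complement[of UNIV l "\<lambda>i. 1 / l i" "int k"] assms(3,4) by (simp add: of_nat_diff)
  ultimately show ?thesis by (simp add: hess_quot_def)
qed

text \<open>Lagrange interpolation at 0, ..., n. Applied to det (s I + H) it writes sigma_(n-k)(H)
  as a fixed linear combination of determinants, which can be differentiated even where eigenvalues
  cross.\<close>

lemma coeff_functional:
  obtains w :: "nat \<Rightarrow> real" where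
    "\<And>p :: real poly. degree p \<le> n \<Longrightarrow> coeff p k = (\<Sum>m\<le>n. w m * poly p (real m))"
proof -
  define L where "L m = (\<Prod>l\<in>{..n}-{m}. smult (1 / (real m - real l)) [:- real l, 1:])" for m
  have deg: "degree (L m) \<le> n" if "m \<le> n" for m
  proof -
    have "degree (L m) \<le> (\<Sum>l\<in>{..n}-{m}. degree (smult (1 / (real m - real l)) [:- real l, 1:]))"
      unfolding L_def by (rule order_trans[OF degree_prod_sum_le]) (simp_all add: comp_def)
    also have "\<dots> \<le> (\<Sum>l\<in>{..n}-{m}. 1)" by (intro sum_mono) (simp add: degree_smult_le)
    also have "\<dots> = n" using that by simp
    finally show ?thesis .
  qed
  have val: "poly (L m) (real j) = (if j = m then 1 else 0)" if "m \<le> n" "j \<le> n" for m j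
  proof (cases "j = m")
    case True
    thus ?thesis by (auto simp: L_def poly_prod diff_divide_distrib[symmetric] intro!: prod.neutral)
  next
    case False
    hence "j \<in> {..n} - {m}" using that by auto
    thus ?thesis using False by (auto simp: L_def poly_prod intro!: prod_zero bexI[of _ j])
  qed
  show ?thesis
  proof (rule that[of "\<lambda>m. coeff (L m) k"])
    fix p :: "real poly" assume p: "degree p \<le> n"
    let ?q = "\<Sum>m\<le>n. smult (poly p (real m)) (L m)"
    have "p = ?q"
    proof (rule poly_eqI_degree[of "real ` {..n}"])
      fix x assume "x \<in> real ` {..n}"
      then obtain j where j: "x = real j" "j \<le> n" by auto
      have "poly ?q x = (\<Sum>m\<le>n. poly p (real m) * (if j = m then 1 else 0))"
        unfolding poly_sum using val j by (intro sum.cong) auto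
      thus "poly p x = poly ?q x" using j by (simp add: if_distrib cong: if_cong)
    next
      have "degree ?q \<le> n"
        by (intro degree_sum_le) (auto intro!: order_trans[OF degree_smult_le] deg)
      thus "degree ?q < card (real ` {..n})" by (simp add: card_image)
    qed (use p in \<open>simp add: card_image\<close>)
    hence "coeff p k = coeff ?q k" by simp
    thus "coeff p k = (\<Sum>m\<le>n. coeff (L m) k * poly p (real m))" by (simp add: coeff_sum mult.commute)
  qed
qed

text \<open>In the Leibniz expansion at a diagonal matrix, a permutation moving more than two points
  keeps a vanishing off-diagonal factor after two differentiations; only the identity and the
  transpositions contribute.\<close>

lemma jet2_det:
  fixes M :: "real \<Rightarrow> real^'n^'n"
  assumes J: "\<And>i j. jet2 (\<lambda>t. M t $ i $ j) (if i = j then d i else 0) (X i j) (Z i j)"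
  shows "jet2 (\<lambda>t. det (M t)) (\<Prod>i\<in>UNIV. d i) (\<Sum>i\<in>UNIV. X i i * (\<Prod>l\<in>UNIV-{i}. d l))
    ((\<Sum>i\<in>UNIV. Z i i * (\<Prod>l\<in>UNIV-{i}. d l)) +
     (\<Sum>i\<in>UNIV. \<Sum>j\<in>UNIV-{i}. (X i i * X j j - X i j * X j i) * (\<Prod>l\<in>UNIV-{i}-{j}. d l)))"
proof -
  let ?P = "{p. p permutes (UNIV :: 'n set)}"
  let ?m = "\<lambda>i j. if i = j then d i else 0"
  have fP: "finite ?P" by (simp add: finite_permutations)
  have idP: "id \<in> ?P" by (simp add: permutes_id)
  have J1: "jet2 (\<lambda>t. \<Sum>p\<in>?P. of_int (sign p) * (\<Prod>i\<in>UNIV. M t $ i $ p i))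
    (\<Sum>p\<in>?P. of_int (sign p) * (\<Prod>i\<in>UNIV. ?m i (p i)))
    (\<Sum>p\<in>?P. of_int (sign p) * (\<Sum>i\<in>UNIV. X i (p i) * (\<Prod>l\<in>UNIV-{i}. ?m l (p l))))
    (\<Sum>p\<in>?P. of_int (sign p) * ((\<Sum>i\<in>UNIV. Z i (p i) * (\<Prod>l\<in>UNIV-{i}. ?m l (p l))) +
       (\<Sum>i\<in>UNIV. \<Sum>j\<in>UNIV-{i}. X i (p i) * X j (p j) * (\<Prod>l\<in>UNIV-{i}-{j}. ?m l (p l)))))"
    by (intro jet2_sum fP jet2_cmult jet2_prod J) auto
  have zero: "(\<Prod>l\<in>L. ?m l (p l)) = 0" if "l \<in> L" "p l \<noteq> l" for L p l
    using that by (intro prod_zero) (auto intro!: bexI[of _ l])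
  \<comment> \<open>A permutation that fixes every point but i fixes i as well.\<close>
  have one: "(\<Sum>p\<in>?P. of_int (sign p) * (W p * (\<Prod>l\<in>UNIV-{i}. ?m l (p l)))) = W id * (\<Prod>l\<in>UNIV-{i}. d l)"
    for W :: "('n \<Rightarrow> 'n) \<Rightarrow> real" and i
  proof -
    have "(\<Sum>p\<in>?P. of_int (sign p) * (W p * (\<Prod>l\<in>UNIV-{i}. ?m l (p l))))
      = (\<Sum>p\<in>{id}. of_int (sign p) * (W p * (\<Prod>l\<in>UNIV-{i}. ?m l (p l))))"
    proof (rule sum.mono_neutral_right[OF fP], use idP in blast, safe)
      fix p assume p: "p permutes UNIV" "of_int (sign p) * (W p * (\<Prod>l\<in>UNIV-{i}. ?m l (p l))) \<noteq> 0"
      hence l: "p l = l" if "l \<noteq> i" for l using zero[of l "UNIV - {i}" p] that by auto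
      have "p i = i"
      proof (rule ccontr)
        assume "p i \<noteq> i"
        hence "p (p i) = p i" by (rule l)
        thus False using permutes_inj[OF p(1)] \<open>p i \<noteq> i\<close> by (auto dest: injD)
      qed
      hence "p x = id x" for x using l by (cases "x = i") auto
      thus "p = id" by blast
    qed
    thus ?thesis by simp
  qed
  have two: "(\<Sum>p\<in>?P. of_int (sign p) * (X i (p i) * X j (p j) * (\<Prod>l\<in>UNIV-{i}-{j}. ?m l (p l))))
     = (X i i * X j j - X i j * X j i) * (\<Prod>l\<in>UNIV-{i}-{j}. d l)" if ij: "i \<noteq> j" for i j
  proof -
    let ?t = "Transposition.transpose i j"
    let ?f = "\<lambda>p. of_int (sign p) * (X i (p i) * X j (p j) * (\<Prod>l\<in>UNIV-{i}-{j}. ?m l (p l)))"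
    have ne: "?t \<noteq> id" using ij by (metis id_apply transpose_apply_first)
    have "sum ?f ?P = sum ?f {id, ?t}"
    proof (rule sum.mono_neutral_right[OF fP])
      show "{id, ?t} \<subseteq> ?P" using idP permutes_swap_id[of i UNIV j] by auto
      show "\<forall>p\<in>?P - {id, ?t}. ?f p = 0"
      proof (rule ballI, rule ccontr)
        fix p assume p: "p \<in> ?P - {id, ?t}" "?f p \<noteq> 0"
        hence l: "p l = l" if "l \<noteq> i" "l \<noteq> j" for l using zero[of l "UNIV - {i} - {j}" p] that by auto
        have inj: "inj p" using p permutes_inj by auto
        have "p i \<in> {i, j}" "p j \<in> {i, j}" using l inj by (metis injD insertCI)+
        moreover have "p i \<noteq> p j" using inj ij by (auto dest: injD)
        ultimately consider "p i = i" "p j = j" | "p i = j" "p j = i" by auto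
        thus False
        proof cases
          case 1
          hence "p x = id x" for x using l by (cases "x = i"; cases "x = j") auto
          thus False using p by blast
        next
          case 2
          hence "p x = ?t x" for x using l by (cases "x = i"; cases "x = j") auto
          thus False using p by blast
        qed
      qed
    qed
    also have "\<dots> = ?f id + ?f ?t" using ne by simp
    also have "(\<Prod>l\<in>UNIV-{i}-{j}. ?m l (?t l)) = (\<Prod>l\<in>UNIV-{i}-{j}. d l)"
      by (intro prod.cong) (auto simp: Transposition.transpose_def)
    finally show ?thesis using ij by (simp add: sign_swap_id algebra_simps)
  qed
  have a0: "(\<Sum>p\<in>?P. of_int (sign p) * (\<Prod>i\<in>UNIV. ?m i (p i))) = (\<Prod>i\<in>UNIV. d i)"
  proof -
    have "(\<Sum>p\<in>?P. of_int (sign p) * (\<Prod>i\<in>UNIV. ?m i (p i))) = (\<Sum>p\<in>{id}. of_int (sign p) * (\<Prod>i\<in>UNIV. ?m i (p i)))"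
    proof (rule sum.mono_neutral_right[OF fP], use idP in blast, safe)
      fix p assume p: "p permutes UNIV" "of_int (sign p) * (\<Prod>i\<in>UNIV. ?m i (p i)) \<noteq> 0"
      hence "p l = id l" for l using zero[of l UNIV p] by auto
      thus "p = id" by blast
    qed
    thus ?thesis by simp
  qed
  have a1: "(\<Sum>p\<in>?P. of_int (sign p) * (\<Sum>i\<in>UNIV. V i (p i) * (\<Prod>l\<in>UNIV-{i}. ?m l (p l))))
     = (\<Sum>i\<in>UNIV. V i i * (\<Prod>l\<in>UNIV-{i}. d l))" for V
    unfolding sum_distrib_left by (subst sum.swap) (simp add: one)
  have a2: "(\<Sum>p\<in>?P. of_int (sign p) * (\<Sum>i\<in>UNIV. \<Sum>j\<in>UNIV-{i}. X i (p i) * X j (p j) * (\<Prod>l\<in>UNIV-{i}-{j}. ?m l (p l))))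
     = (\<Sum>i\<in>UNIV. \<Sum>j\<in>UNIV-{i}. (X i i * X j j - X i j * X j i) * (\<Prod>l\<in>UNIV-{i}-{j}. d l))"
  proof -
    have "(\<Sum>p\<in>?P. of_int (sign p) * (\<Sum>i\<in>UNIV. \<Sum>j\<in>UNIV-{i}. X i (p i) * X j (p j) * (\<Prod>l\<in>UNIV-{i}-{j}. ?m l (p l))))
      = (\<Sum>i\<in>UNIV. \<Sum>j\<in>UNIV-{i}. \<Sum>p\<in>?P. of_int (sign p) * (X i (p i) * X j (p j) * (\<Prod>l\<in>UNIV-{i}-{j}. ?m l (p l))))"
      unfolding sum_distrib_left by (subst sum.swap) (rule sum.cong[OF refl], rule sum.swap)
    also have "\<dots> = (\<Sum>i\<in>UNIV. \<Sum>j\<in>UNIV-{i}. (X i i * X j j - X i j * X j i) * (\<Prod>l\<in>UNIV-{i}-{j}. d l))"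
      using two by (intro sum.cong refl) auto
    finally show ?thesis .
  qed
  show ?thesis using J1 unfolding a0 distrib_left sum.distrib a1 a2 det_def .
qed

text \<open>The basis \<open>e\<close> is an eigenbasis at t = 0 and is then held fixed. G and D
  belong to log (sigma_n / sigma_(n-k)); the square at the end of the second formula passes from the
  second derivative of the logarithm to that of the quotient.\<close>

lemma jet2_hess_quot:
  fixes H :: "real \<Rightarrow> real^'n^'n" and l :: "'n \<Rightarrow> real"
  assumes e: "orthonormal_family e"
    and symm: "\<forall>\<^sub>F t in nhds 0. transpose (H t) = H t"
    and J: "\<And>i j. jet2 (\<lambda>t. e i \<bullet> (H t *v e j)) (if i = j then l i else 0) (X i j) (Z i j)"
    and l: "\<And>i. l i > 0" and k: "k \<le> CARD('n)" and X: "\<And>i j. X i j = X j i"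
  defines "b \<equiv> \<lambda>i. 1 / l i"
  defines "G \<equiv> \<lambda>i. (b i)\<^sup>2 * (esym (int k - 1) (UNIV - {i}) b / esym (int k) UNIV b)"
  defines "D \<equiv> (\<Sum>i\<in>UNIV. \<Sum>j\<in>UNIV-{i}. (X i i * X j j - (X i j)\<^sup>2) * (b i * b j * (1 - esym (int k) (UNIV - {i} - {j}) b / esym (int k) UNIV b)))
    - (\<Sum>i\<in>UNIV. b i * X i i)\<^sup>2 + (\<Sum>i\<in>UNIV. X i i * (b i * (esym (int k) (UNIV - {i}) b / esym (int k) UNIV b)))\<^sup>2"
  obtains g1 g2 where "jet2 (\<lambda>t. hess_quot k (H t)) (1 / esym (int k) UNIV b) g1 g2"
    "esym (int k) UNIV b * g1 = (\<Sum>i\<in>UNIV. G i * X i i)"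
    "esym (int k) UNIV b * g2 = (\<Sum>i\<in>UNIV. G i * Z i i) + D + (\<Sum>i\<in>UNIV. G i * X i i)\<^sup>2"
proof -
  let ?E = "\<lambda>L. esym (int k) L b"
  let ?\<sigma> = "?E UNIV"
  have b: "b i > 0" "l i * b i = 1" for i using l[of i] by (auto simp: b_def)
  have sig: "?\<sigma> > 0" using b k by (intro esym_pos) auto
  define P where "P = prod l UNIV"
  have P: "P > 0" unfolding P_def using l by (intro prod_pos) auto
  have P1: "prod l (UNIV - {i}) = P * b i" for i
    unfolding P_def using prod.remove[of UNIV i l] b(2)[of i] by simp
  have P2: "prod l (UNIV - {i} - {j}) = P * (b i * b j)" if "j \<noteq> i" for i j
  proof -
    have "prod l (UNIV - {i}) = l j * prod l (UNIV - {i} - {j})"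
      using that by (intro prod.remove) auto
    hence "b j * prod l (UNIV - {i}) = (l j * b j) * prod l (UNIV - {i} - {j})" by (simp only: mult_ac)
    thus ?thesis unfolding P1 b(2) by (simp add: mult_ac)
  qed
  obtain w where w: "\<And>p :: real poly. degree p \<le> CARD('n) \<Longrightarrow> coeff p k = (\<Sum>m\<le>CARD('n). w m * poly p (real m))"
    using coeff_functional by blast
  have cf: "(\<Sum>m\<le>CARD('n). w m * (\<Prod>i\<in>L. real m + c i)) = esym (int (card L) - int k) L c" for L :: "'n set" and c
  proof -
    have "degree (\<Prod>i\<in>L. [:c i, 1:]) \<le> (\<Sum>i\<in>L. degree [:c i, 1:])"
      by (rule order_trans[OF degree_prod_sum_le]) (simp_all add: comp_def)
    also have "\<dots> \<le> CARD('n)" by (simp add: card_mono)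
    finally have "degree (\<Prod>i\<in>L. [:c i, 1:]) \<le> CARD('n)" .
    from w[OF this] have "(\<Sum>m\<le>CARD('n). w m * (\<Prod>i\<in>L. real m + c i)) = coeff (\<Prod>i\<in>L. [:c i, 1:]) k"
      by (simp add: poly_prod add.commute)
    thus ?thesis by (simp add: coeff_prod_esym_complement)
  qed
  have cfl: "(\<Sum>m\<le>CARD('n). w m * (\<Prod>i\<in>L. real m + l i)) = prod l L * ?E L" for L
    unfolding cf by (rule esym_complement) (use b in auto)
  \<comment> \<open>The matrix s I + H t written in the basis \<open>e\<close>: its determinant does
    not depend on the basis, and the jets of its entries are known.\<close>
  define M :: "real \<Rightarrow> real \<Rightarrow> real^'n^'n" where
    "M s t = (\<chi> i j. (if i = j then s else 0) + e i \<bullet> (H t *v e j))" for s t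
  have JM: "jet2 (\<lambda>t. det (M s t)) (\<Prod>i\<in>UNIV. s + l i) (\<Sum>i\<in>UNIV. X i i * (\<Prod>m\<in>UNIV-{i}. s + l m))
    ((\<Sum>i\<in>UNIV. Z i i * (\<Prod>m\<in>UNIV-{i}. s + l m)) +
     (\<Sum>i\<in>UNIV. \<Sum>j\<in>UNIV-{i}. (X i i * X j j - X i j * X j i) * (\<Prod>m\<in>UNIV-{i}-{j}. s + l m)))" for s
  proof (rule jet2_det[where d = "\<lambda>i. s + l i" and X = X and Z = Z])
    fix i j
    have "jet2 (\<lambda>t. (if i = j then s else 0) + e i \<bullet> (H t *v e j)) ((if i = j then s else 0) + (if i = j then l i else 0)) (0 + X i j) (0 + Z i j)"
      by (intro jet2_add jet2_const J)
    thus "jet2 (\<lambda>t. M s t $ i $ j) (if i = j then s + l i else 0) (X i j) (Z i j)"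
      by (simp add: M_def if_distrib cong: if_cong)
  qed
  define T where "T t = (\<Sum>m\<le>CARD('n). w m * det (M (real m) t))" for t
  have quot: "hess_quot k (H t) = det (M 0 t) / T t" if s: "transpose (H t) = H t" for t
  proof -
    obtain e' l' where el: "orthonormal_family e'" "\<And>i::'n. H t *v e' i = l' i *\<^sub>R e' i"
      using symmetric_eigenbasis[OF s] by blast
    have D: "det (M s t) = (\<Prod>i\<in>UNIV. s + l' i)" for s
    proof -
      have "e i \<bullet> ((\<chi> i j. (if i = j then s else 0) + 1 * H t $ i $ j) *v e j) = (if i = j then s else 0) + e i \<bullet> (H t *v e j)" for i j
        unfolding shifted_matrix_mult using e by (simp add: inner_add_right orthonormal_family_def)
      hence "M s t = (\<chi> i j. e i \<bullet> ((\<chi> i j. (if i = j then s else 0) + 1 * H t $ i $ j) *v e j))"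
        unfolding M_def by simp
      thus ?thesis using det_in_basis[OF e] det_eigenbasis[OF el, of s 1] by simp
    qed
    have "T t = esym (int (CARD('n) - k)) UNIV l'"
      unfolding T_def D cf using k by (simp add: of_nat_diff)
    moreover have "det (M 0 t) = esym (int CARD('n)) UNIV l'"
      unfolding D using esym_card[of "UNIV :: 'n set" l'] by simp
    ultimately show ?thesis by (simp add: hess_quot_def sigma_eigenbasis[OF el])
  qed
  define T1 where "T1 = (\<Sum>i\<in>UNIV. X i i * (P * b i * ?E (UNIV - {i})))"
  define T2 where "T2 = (\<Sum>i\<in>UNIV. Z i i * (P * b i * ?E (UNIV - {i}))) +
     (\<Sum>i\<in>UNIV. \<Sum>j\<in>UNIV-{i}. (X i i * X j j - (X i j)\<^sup>2) * (P * (b i * b j) * ?E (UNIV - {i} - {j})))"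
  have JT: "jet2 T (P * ?\<sigma>) T1 T2"
  proof -
    have J1: "jet2 T (\<Sum>m\<le>CARD('n). w m * (\<Prod>i\<in>UNIV. real m + l i))
      (\<Sum>m\<le>CARD('n). w m * (\<Sum>i\<in>UNIV. X i i * (\<Prod>q\<in>UNIV-{i}. real m + l q)))
      (\<Sum>m\<le>CARD('n). w m * ((\<Sum>i\<in>UNIV. Z i i * (\<Prod>q\<in>UNIV-{i}. real m + l q)) +
        (\<Sum>i\<in>UNIV. \<Sum>j\<in>UNIV-{i}. (X i i * X j j - X i j * X j i) * (\<Prod>q\<in>UNIV-{i}-{j}. real m + l q))))"
      unfolding T_def by (intro jet2_sum jet2_cmult JM) auto
    have a1: "(\<Sum>m\<le>CARD('n). w m * (\<Sum>i\<in>UNIV. V i * (\<Prod>q\<in>UNIV-{i}. real m + l q)))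
       = (\<Sum>i\<in>UNIV. V i * (P * b i * ?E (UNIV - {i})))" for V :: "'n \<Rightarrow> real"
    proof -
      have "(\<Sum>m\<le>CARD('n). w m * (\<Sum>i\<in>UNIV. V i * (\<Prod>q\<in>UNIV-{i}. real m + l q)))
        = (\<Sum>i\<in>UNIV. V i * (\<Sum>m\<le>CARD('n). w m * (\<Prod>q\<in>UNIV-{i}. real m + l q)))"
        unfolding sum_distrib_left by (subst sum.swap) (simp add: mult_ac)
      thus ?thesis unfolding cfl P1 .
    qed
    have a2: "(\<Sum>m\<le>CARD('n). w m * (\<Sum>i\<in>UNIV. \<Sum>j\<in>UNIV-{i}. V i j * (\<Prod>q\<in>UNIV-{i}-{j}. real m + l q)))
       = (\<Sum>i\<in>UNIV. \<Sum>j\<in>UNIV-{i}. V i j * (P * (b i * b j) * ?E (UNIV - {i} - {j})))" for V :: "'n \<Rightarrow> 'n \<Rightarrow> real"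
    proof -
      have "(\<Sum>m\<le>CARD('n). w m * (\<Sum>i\<in>UNIV. \<Sum>j\<in>UNIV-{i}. V i j * (\<Prod>q\<in>UNIV-{i}-{j}. real m + l q)))
        = (\<Sum>i\<in>UNIV. \<Sum>m\<le>CARD('n). \<Sum>j\<in>UNIV-{i}. w m * (V i j * (\<Prod>q\<in>UNIV-{i}-{j}. real m + l q)))"
        unfolding sum_distrib_left by (rule sum.swap)
      also have "\<dots> = (\<Sum>i\<in>UNIV. \<Sum>j\<in>UNIV-{i}. \<Sum>m\<le>CARD('n). w m * (V i j * (\<Prod>q\<in>UNIV-{i}-{j}. real m + l q)))"
        by (rule sum.cong[OF refl], rule sum.swap)
      also have "\<dots> = (\<Sum>i\<in>UNIV. \<Sum>j\<in>UNIV-{i}. V i j * (\<Sum>m\<le>CARD('n). w m * (\<Prod>q\<in>UNIV-{i}-{j}. real m + l q)))"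
        unfolding sum_distrib_left by (simp add: mult_ac)
      also have "\<dots> = (\<Sum>i\<in>UNIV. \<Sum>j\<in>UNIV-{i}. V i j * (P * (b i * b j) * ?E (UNIV - {i} - {j})))"
        unfolding cfl by (intro sum.cong refl) (simp add: P2)
      finally show ?thesis .
    qed
    have "X i j * X j i = (X i j)\<^sup>2" for i j by (simp add: X[of j i] power2_eq_square)
    thus ?thesis using J1 unfolding cfl distrib_left[of "w _"] sum.distrib a1 a2 T1_def T2_def P_def[symmetric] by simp
  qed
  define D1 where "D1 = (\<Sum>i\<in>UNIV. X i i * (P * b i))"
  define D2 where "D2 = (\<Sum>i\<in>UNIV. Z i i * (P * b i)) +
     (\<Sum>i\<in>UNIV. \<Sum>j\<in>UNIV-{i}. (X i i * X j j - (X i j)\<^sup>2) * (P * (b i * b j)))"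
  have JD: "jet2 (\<lambda>t. det (M 0 t)) P D1 D2"
  proof -
    have "X i j * X j i = (X i j)\<^sup>2" for i j by (simp add: X[of j i] power2_eq_square)
    moreover have "(\<Sum>i\<in>UNIV. \<Sum>j\<in>UNIV-{i}. V i j * prod l (UNIV-{i}-{j})) = (\<Sum>i\<in>UNIV. \<Sum>j\<in>UNIV-{i}. V i j * (P * (b i * b j)))"
      for V by (intro sum.cong refl) (simp add: P2)
    ultimately show ?thesis using JM[of 0] unfolding D1_def D2_def by (simp add: P1 P_def)
  qed
  obtain g1 g2 where g: "jet2 (\<lambda>t. det (M 0 t) / T t) (P / (P * ?\<sigma>)) g1 g2"
    and g1: "D1 = g1 * (P * ?\<sigma>) + P / (P * ?\<sigma>) * T1"
    and g2: "D2 = g2 * (P * ?\<sigma>) + 2 * g1 * T1 + P / (P * ?\<sigma>) * T2"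
    using jet2_divide[OF JD JT] P sig by auto
  have ev: "\<forall>\<^sub>F t in nhds 0. det (M 0 t) / T t = hess_quot k (H t)"
    using symm by eventually_elim (simp add: quot)
  have J: "jet2 (\<lambda>t. hess_quot k (H t)) (1 / ?\<sigma>) g1 g2"
    using jet2_cong[OF g ev] P by simp
  \<comment> \<open>A1 and A2 are the logarithmic derivatives at t = 0 of the numerator sigma_n and
    the denominator sigma_(n-k).\<close>
  define A1 where "A1 = (\<Sum>i\<in>UNIV. b i * X i i)"
  define A2 where "A2 = (\<Sum>i\<in>UNIV. X i i * (b i * (?E (UNIV - {i}) / ?\<sigma>)))"
  have D1: "D1 = P * A1" unfolding D1_def A1_def by (simp add: sum_distrib_left mult_ac)
  have T1: "T1 = P * ?\<sigma> * A2" unfolding T1_def A2_def using sig by (simp add: sum_distrib_left mult_ac)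
  have "P * (?\<sigma> * g1) = P * (A1 - A2)"
    using g1 P sig unfolding D1 T1 by (simp add: algebra_simps)
  hence s1: "?\<sigma> * g1 = A1 - A2" using P by simp
  have G: "G i = b i * (1 - ?E (UNIV - {i}) / ?\<sigma>)" for i
    using esym_remove[of UNIV i "int k" b] sig unfolding G_def by (simp add: field_simps power2_eq_square)
  have S1: "A1 - A2 = (\<Sum>i\<in>UNIV. G i * X i i)"
    unfolding A1_def A2_def sum_subtractf[symmetric] G by (simp add: algebra_simps)
  define OD where "OD = (\<Sum>i\<in>UNIV. \<Sum>j\<in>UNIV-{i}. (X i i * X j j - (X i j)\<^sup>2) * (b i * b j * (1 - ?E (UNIV - {i} - {j}) / ?\<sigma>)))"
  have "D2 - T2 / ?\<sigma> = P * ((\<Sum>i\<in>UNIV. G i * Z i i) + OD)"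
  proof -
    have "(\<Sum>i\<in>UNIV. Z i i * (P * b i)) - (\<Sum>i\<in>UNIV. Z i i * (P * b i * ?E (UNIV - {i}))) / ?\<sigma> = P * (\<Sum>i\<in>UNIV. G i * Z i i)"
      unfolding G sum_divide_distrib sum_subtractf[symmetric] sum_distrib_left by (simp add: algebra_simps)
    moreover have "(\<Sum>i\<in>UNIV. \<Sum>j\<in>UNIV-{i}. (X i i * X j j - (X i j)\<^sup>2) * (P * (b i * b j)))
      - (\<Sum>i\<in>UNIV. \<Sum>j\<in>UNIV-{i}. (X i i * X j j - (X i j)\<^sup>2) * (P * (b i * b j) * ?E (UNIV - {i} - {j}))) / ?\<sigma> = P * OD"
      unfolding OD_def sum_divide_distrib sum_subtractf[symmetric] sum_distrib_left
      by (intro sum.cong refl) (simp add: algebra_simps)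
    ultimately show ?thesis unfolding D2_def T2_def by (simp add: add_divide_distrib algebra_simps)
  qed
  moreover have "D2 - T2 / ?\<sigma> = P * (?\<sigma> * g2) + 2 * P * ((?\<sigma> * g1) * A2)"
    using g2 P sig unfolding T1 by (simp add: mult_ac)
  ultimately have "P * (?\<sigma> * g2) = P * ((\<Sum>i\<in>UNIV. G i * Z i i) + OD - 2 * (A1 - A2) * A2)"
    unfolding s1 by (simp add: algebra_simps)
  hence "?\<sigma> * g2 = (\<Sum>i\<in>UNIV. G i * Z i i) + OD - 2 * (A1 - A2) * A2" using P by simp
  also have "\<dots> = (\<Sum>i\<in>UNIV. G i * Z i i) + D + (A1 - A2)\<^sup>2"
    unfolding D_def OD_def[symmetric] A1_def[symmetric] A2_def[symmetric] by (simp add: power2_eq_square algebra_simps)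
  finally show ?thesis using that[OF J] s1 unfolding S1 by simp
qed

section \<open>Higher partial derivatives\<close>

context
  fixes k :: nat and S :: "'a::euclidean_space set" and u :: "'a \<Rightarrow> real"
  assumes C: "Ck_on k S u" and S: "open S"
begin

lemma partials_basis_differentiable:
  "set bs \<subseteq> Basis \<Longrightarrow> length bs < k \<Longrightarrow> x \<in> S \<Longrightarrow> partials bs u differentiable (at x)"
  using C S unfolding Ck_on_def differentiable_on_def by (metis at_within_open less_imp_le)

text \<open>\<open>Ck_on\<close> speaks of coordinate directions, whereas the eigenvectors at the
  maximum point are arbitrary ones. Iterated derivatives along any vectors are constant combinations
  of coordinate ones and so inherit their regularity.\<close>

lemma partials_expand:
  assumes "length vs \<le> k"
  obtains I c where "finite I" "\<And>bs. bs \<in> I \<Longrightarrow> set bs \<subseteq> Basis \<and> length bs = length vs"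
    "\<And>x. x \<in> S \<Longrightarrow> partials vs u x = (\<Sum>bs\<in>I. c bs * partials bs u x)"
  using assms
proof (induction vs arbitrary: thesis)
  case Nil
  show ?case by (rule Nil(1)[of "{[]}" "\<lambda>_. 1"]) auto
next
  case (Cons v vs)
  obtain I c where I: "finite I" "\<And>bs. bs \<in> I \<Longrightarrow> set bs \<subseteq> Basis \<and> length bs = length vs"
    "\<And>x. x \<in> S \<Longrightarrow> partials vs u x = (\<Sum>bs\<in>I. c bs * partials bs u x)"
    using Cons by auto
  define J where "J = (\<lambda>(b, bs). b # bs) ` (Basis \<times> I)"
  define d where "d bs = (v \<bullet> hd bs) * c (tl bs)" for bs
  show ?case
  proof (rule Cons.prems(1)[of J d])
    show "finite J" using I(1) by (auto simp: J_def)
    show "\<And>bs. bs \<in> J \<Longrightarrow> set bs \<subseteq> Basis \<and> length bs = length (v # vs)"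
      using I(2) by (auto simp: J_def) blast
    fix x assume x: "x \<in> S"
    have D: "(partials bs u has_derivative frechet_derivative (partials bs u) (at x)) (at x)" if "bs \<in> I" for bs
      using partials_basis_differentiable[OF _ _ x] I(2)[OF that] Cons.prems(2)
      by (simp add: frechet_derivative_works)
    have "((\<lambda>y. \<Sum>bs\<in>I. c bs * partials bs u y) has_derivative
        (\<lambda>h. \<Sum>bs\<in>I. c bs * frechet_derivative (partials bs u) (at x) h)) (at x)"
      by (intro has_derivative_sum has_derivative_mult_right D)
    hence "(partials vs u has_derivative (\<lambda>h. \<Sum>bs\<in>I. c bs * frechet_derivative (partials bs u) (at x) h)) (at x)"
      by (rule has_derivative_transform_within_open[OF _ S x]) (simp add: I(3))
    hence "partials (v # vs) u x = (\<Sum>bs\<in>I. c bs * frechet_derivative (partials bs u) (at x) v)"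
      by (simp add: frechet_derivative_at[symmetric])
    also have "\<dots> = (\<Sum>bs\<in>I. c bs * (\<Sum>b\<in>Basis. (v \<bullet> b) * partials (b # bs) u x))"
    proof (intro sum.cong refl arg_cong2[of _ _ _ _ "(*)"])
      fix bs assume "bs \<in> I"
      from D[OF this] interpret l: linear "frechet_derivative (partials bs u) (at x)"
        by (rule has_derivative_linear)
      have "frechet_derivative (partials bs u) (at x) v = frechet_derivative (partials bs u) (at x) (\<Sum>b\<in>Basis. (v \<bullet> b) *\<^sub>R b)"
        by (simp add: euclidean_representation)
      also have "\<dots> = (\<Sum>b\<in>Basis. (v \<bullet> b) * partials (b # bs) u x)" by (simp add: l.sum l.scale)
      finally show "frechet_derivative (partials bs u) (at x) v = (\<Sum>b\<in>Basis. (v \<bullet> b) * partials (b # bs) u x)" .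
    qed
    also have "\<dots> = (\<Sum>bs\<in>I. \<Sum>b\<in>Basis. d (b # bs) * partials (b # bs) u x)"
      by (simp add: d_def sum_distrib_left mult_ac)
    also have "\<dots> = (\<Sum>b\<in>Basis. \<Sum>bs\<in>I. d (b # bs) * partials (b # bs) u x)" by (rule sum.swap)
    also have "\<dots> = (\<Sum>(b, bs)\<in>Basis \<times> I. d (b # bs) * partials (b # bs) u x)" by (simp add: sum.cartesian_product)
    also have "\<dots> = (\<Sum>bs\<in>J. d bs * partials bs u x)"
      unfolding J_def by (subst sum.reindex) (auto simp: inj_on_def case_prod_unfold)
    finally show "partials (v # vs) u x = (\<Sum>bs\<in>J. d bs * partials bs u x)" .
  qed
qed

lemma partials_differentiable:
  assumes "length vs < k" "x \<in> S"
  shows "partials vs u differentiable (at x)"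
proof -
  obtain I c where I: "finite I" "\<And>bs. bs \<in> I \<Longrightarrow> set bs \<subseteq> Basis \<and> length bs = length vs"
    "\<And>x. x \<in> S \<Longrightarrow> partials vs u x = (\<Sum>bs\<in>I. c bs * partials bs u x)"
    using partials_expand[of vs] assms(1) by auto
  have "(\<lambda>y. \<Sum>bs\<in>I. c bs * partials bs u y) differentiable (at x)"
    using I(1,2) assms by (intro differentiable_sum differentiable_mult differentiable_const ballI partials_basis_differentiable) auto
  then obtain D where "((\<lambda>y. \<Sum>bs\<in>I. c bs * partials bs u y) has_derivative D) (at x)"
    by (auto simp: differentiable_def)
  hence "(partials vs u has_derivative D) (at x)"
    by (rule has_derivative_transform_within_open[OF _ S assms(2)]) (simp add: I(3))
  thus ?thesis by (auto simp: differentiable_def)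
qed

lemma partials_continuous_on:
  assumes "length vs \<le> k"
  shows "continuous_on S (partials vs u)"
proof -
  obtain I c where I: "finite I" "\<And>bs. bs \<in> I \<Longrightarrow> set bs \<subseteq> Basis \<and> length bs = length vs"
    "\<And>x. x \<in> S \<Longrightarrow> partials vs u x = (\<Sum>bs\<in>I. c bs * partials bs u x)"
    using partials_expand[of vs] assms(1) by auto
  have "continuous_on S (\<lambda>y. \<Sum>bs\<in>I. c bs * partials bs u y)"
    using C I assms unfolding Ck_on_def by (intro continuous_intros) auto
  thus ?thesis using I(3) by (subst continuous_on_cong[OF refl, of _ _ "\<lambda>y. \<Sum>bs\<in>I. c bs * partials bs u y"]) auto
qed

lemma partials_has_derivative:
  assumes "length vs < k" "x \<in> S"
  shows "(partials vs u has_derivative (\<lambda>v. partials (v # vs) u x)) (at x)"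
  using partials_differentiable[OF assms] by (simp add: frechet_derivative_works)

lemma partials_Cons_cong:
  assumes "length vs < k" "x \<in> S" "\<And>y. y \<in> S \<Longrightarrow> partials vs u y = partials ws u y"
  shows "partials (v # vs) u x = partials (v # ws) u x"
proof -
  have "(partials ws u has_derivative (\<lambda>v. partials (v # vs) u x)) (at x)"
    by (rule has_derivative_transform_within_open[OF partials_has_derivative[OF assms(1,2)] S assms(2)])
      (simp add: assms(3))
  from frechet_derivative_at[OF this] have "(\<lambda>v. partials (v # vs) u x) = frechet_derivative (partials ws u) (at x)" .
  thus ?thesis by (simp add: fun_eq_iff)
qed

section \<open>Symmetry of iterated partial derivatives\<close>

lemma partials_line_DERIV:
  assumes "length vs < k" "x + t *\<^sub>R v \<in> S"
  shows "((\<lambda>t. partials vs u (x + t *\<^sub>R v)) has_real_derivative partials (v # vs) u (x + t *\<^sub>R v)) (at t)"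
proof -
  have "((\<lambda>t. x + t *\<^sub>R v) has_derivative (\<lambda>h. h *\<^sub>R v)) (at t)"
    by (auto intro!: derivative_eq_intros)
  from has_derivative_compose[OF this partials_has_derivative[OF assms]]
  have D: "((\<lambda>t. partials vs u (x + t *\<^sub>R v)) has_derivative (\<lambda>h. partials (h *\<^sub>R v # vs) u (x + t *\<^sub>R v))) (at t)" .
  from partials_has_derivative[OF assms] interpret l: linear "\<lambda>w. partials (w # vs) u (x + t *\<^sub>R v)"
    by (rule has_derivative_linear)
  have "(\<lambda>h. partials (h *\<^sub>R v # vs) u (x + t *\<^sub>R v)) = (*) (partials (v # vs) u (x + t *\<^sub>R v))"
    by (rule ext) (simp only: l.scale real_scaleR_def mult.commute)
  thus ?thesis using D unfolding has_field_derivative_def by (simp only:)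
qed

text \<open>Two applications of the mean value theorem to the second difference, first in direction
  a and then in direction b.\<close>

lemma partials_mixed_mean_value:
  assumes vs: "length vs + 2 \<le> k" and h: "h > 0"
    and box: "\<And>s t. 0 \<le> s \<Longrightarrow> s \<le> h \<Longrightarrow> 0 \<le> t \<Longrightarrow> t \<le> h \<Longrightarrow> x + s *\<^sub>R a + t *\<^sub>R b \<in> S"
  obtains s t where "0 \<le> s" "s \<le> h" "0 \<le> t" "t \<le> h"
    "partials vs u (x + h *\<^sub>R a + h *\<^sub>R b) - partials vs u (x + h *\<^sub>R a) - partials vs u (x + h *\<^sub>R b) + partials vs u x
     = h * h * partials (b # a # vs) u (x + s *\<^sub>R a + t *\<^sub>R b)"
proof -
  let ?g = "partials vs u"
  have "\<exists>s. 0 < s \<and> s < h \<and> (?g (x + h *\<^sub>R b + h *\<^sub>R a) - ?g (x + h *\<^sub>R a)) - (?g (x + h *\<^sub>R b + 0 *\<^sub>R a) - ?g (x + 0 *\<^sub>R a))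
    = (h - 0) * (partials (a # vs) u (x + h *\<^sub>R b + s *\<^sub>R a) - partials (a # vs) u (x + s *\<^sub>R a))"
  proof (rule MVT2[OF h])
    fix s assume s: "0 \<le> s" "s \<le> h"
    have "x + h *\<^sub>R b + s *\<^sub>R a \<in> S" "x + s *\<^sub>R a \<in> S" using box[OF s, of h] box[OF s, of 0] h by (auto simp: add_ac)
    thus "((\<lambda>s. ?g (x + h *\<^sub>R b + s *\<^sub>R a) - ?g (x + s *\<^sub>R a)) has_real_derivative
      partials (a # vs) u (x + h *\<^sub>R b + s *\<^sub>R a) - partials (a # vs) u (x + s *\<^sub>R a)) (at s)"
      using vs by (intro DERIV_diff partials_line_DERIV) auto
  qed
  then obtain s where s: "0 < s" "s < h" and 1: "?g (x + h *\<^sub>R a + h *\<^sub>R b) - ?g (x + h *\<^sub>R a) - ?g (x + h *\<^sub>R b) + ?g x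
    = h * (partials (a # vs) u (x + s *\<^sub>R a + h *\<^sub>R b) - partials (a # vs) u (x + s *\<^sub>R a))"
    by (auto simp: add_ac algebra_simps)
  have "\<exists>t. 0 < t \<and> t < h \<and> partials (a # vs) u (x + s *\<^sub>R a + h *\<^sub>R b) - partials (a # vs) u (x + s *\<^sub>R a + 0 *\<^sub>R b)
    = (h - 0) * partials (b # a # vs) u (x + s *\<^sub>R a + t *\<^sub>R b)"
    using h vs box[of s] s by (intro MVT2 partials_line_DERIV) auto
  then obtain t where "0 < t" "t < h" "partials (a # vs) u (x + s *\<^sub>R a + h *\<^sub>R b) - partials (a # vs) u (x + s *\<^sub>R a)
    = h * partials (b # a # vs) u (x + s *\<^sub>R a + t *\<^sub>R b)" by auto
  thus ?thesis using that[of s t] s 1 by simp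
qed

text \<open>Schwarz's theorem. The second difference over a small parallelogram is symmetric in a
  and b, so the two mixed derivatives share a value at points arbitrarily near x; continuity brings
  them together at x.\<close>

lemma partials_commute:
  assumes vs: "length vs + 2 \<le> k" and x: "x \<in> S"
  shows "partials (a # b # vs) u x = partials (b # a # vs) u x"
proof (rule ccontr)
  assume ne: "partials (a # b # vs) u x \<noteq> partials (b # a # vs) u x"
  define \<epsilon> where "\<epsilon> = \<bar>partials (a # b # vs) u x - partials (b # a # vs) u x\<bar> / 2"
  have eps: "\<epsilon> > 0" using ne by (simp add: \<epsilon>_def)
  have cont: "\<exists>d>0. \<forall>y\<in>S. dist y x < d \<longrightarrow> dist (partials ws u y) (partials ws u x) < \<epsilon>"
    if "length ws \<le> k" for ws
    using partials_continuous_on[OF that] x eps unfolding continuous_on_iff by blast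
  obtain d1 where d1: "d1 > 0" "\<And>y. y \<in> S \<Longrightarrow> dist y x < d1 \<Longrightarrow> dist (partials (a # b # vs) u y) (partials (a # b # vs) u x) < \<epsilon>"
    using cont[of "a # b # vs"] vs by auto
  obtain d2 where d2: "d2 > 0" "\<And>y. y \<in> S \<Longrightarrow> dist y x < d2 \<Longrightarrow> dist (partials (b # a # vs) u y) (partials (b # a # vs) u x) < \<epsilon>"
    using cont[of "b # a # vs"] vs by auto
  obtain d3 where d3: "d3 > 0" "ball x d3 \<subseteq> S" using S x open_contains_ball by blast
  define d where "d = min d1 (min d2 d3)"
  have d: "d > 0" "d \<le> d1" "d \<le> d2" "d \<le> d3" using d1(1) d2(1) d3(1) by (auto simp: d_def)
  define n where "n = norm a + norm b + 1"
  have n: "n > 0" by (simp add: n_def add_nonneg_pos)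
  define h where "h = d / (2 * n)"
  have h: "h > 0" using d n by (simp add: h_def)
  have near: "dist (x + s *\<^sub>R a + t *\<^sub>R b) x < d" if "0 \<le> s" "s \<le> h" "0 \<le> t" "t \<le> h" for s t
  proof -
    have "dist (x + s *\<^sub>R a + t *\<^sub>R b) x = norm (s *\<^sub>R a + t *\<^sub>R b)" by (simp add: dist_norm algebra_simps)
    also have "\<dots> \<le> s * norm a + t * norm b" using that norm_triangle_ineq[of "s *\<^sub>R a" "t *\<^sub>R b"] by simp
    also have "\<dots> \<le> h * norm a + h * norm b" using that by (intro add_mono mult_right_mono) auto
    also have "\<dots> \<le> h * n" using h by (simp add: n_def algebra_simps)
    also have "\<dots> < d" using d n by (simp add: h_def)
    finally show ?thesis .
  qed
  have box: "x + s *\<^sub>R a + t *\<^sub>R b \<in> S" if "0 \<le> s" "s \<le> h" "0 \<le> t" "t \<le> h" for s t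
    using near[OF that] d d3(2) by (auto simp: dist_commute subset_eq)
  obtain s t where st: "0 \<le> s" "s \<le> h" "0 \<le> t" "t \<le> h" and 1:
    "partials vs u (x + h *\<^sub>R a + h *\<^sub>R b) - partials vs u (x + h *\<^sub>R a) - partials vs u (x + h *\<^sub>R b) + partials vs u x
     = h * h * partials (b # a # vs) u (x + s *\<^sub>R a + t *\<^sub>R b)"
    using partials_mixed_mean_value[OF vs h box] by blast
  have box': "x + s *\<^sub>R b + t *\<^sub>R a \<in> S" if "0 \<le> s" "s \<le> h" "0 \<le> t" "t \<le> h" for s t
    using box[of t s] that by (simp add: add_ac)
  obtain s' t' where st': "0 \<le> s'" "s' \<le> h" "0 \<le> t'" "t' \<le> h" and 2:
    "partials vs u (x + h *\<^sub>R b + h *\<^sub>R a) - partials vs u (x + h *\<^sub>R b) - partials vs u (x + h *\<^sub>R a) + partials vs u x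
     = h * h * partials (a # b # vs) u (x + s' *\<^sub>R b + t' *\<^sub>R a)"
    using partials_mixed_mean_value[OF vs h box'] by blast
  have "h * h * partials (b # a # vs) u (x + s *\<^sub>R a + t *\<^sub>R b) = h * h * partials (a # b # vs) u (x + s' *\<^sub>R b + t' *\<^sub>R a)"
    unfolding 1[symmetric] 2[symmetric] by (simp add: add_ac)
  hence eq: "partials (b # a # vs) u (x + s *\<^sub>R a + t *\<^sub>R b) = partials (a # b # vs) u (x + s' *\<^sub>R b + t' *\<^sub>R a)"
    using h by simp
  have "dist (partials (b # a # vs) u (x + s *\<^sub>R a + t *\<^sub>R b)) (partials (b # a # vs) u x) < \<epsilon>"
    using near[OF st] box[OF st] d by (intro d2) auto
  moreover have "dist (partials (a # b # vs) u (x + s' *\<^sub>R b + t' *\<^sub>R a)) (partials (a # b # vs) u x) < \<epsilon>"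
    using near[of t' s'] st' box'[OF st'] d by (intro d1) (auto simp: add_ac)
  ultimately show False unfolding eq by (auto simp: \<epsilon>_def dist_real_def abs_if split: if_splits)
qed

lemma partials_move_front:
  assumes "length (xs @ v # ys) \<le> k" "x \<in> S"
  shows "partials (xs @ v # ys) u x = partials (v # xs @ ys) u x"
  using assms
proof (induction xs arbitrary: x)
  case (Cons a xs)
  have "partials (a # (xs @ v # ys)) u x = partials (a # (v # xs @ ys)) u x"
    using Cons by (intro partials_Cons_cong) auto
  also have "\<dots> = partials (v # a # (xs @ ys)) u x"
    using Cons.prems by (intro partials_commute) auto
  finally show ?case by simp
qed simp

lemma partials_perm:
  assumes "mset vs = mset ws" "length vs \<le> k" "x \<in> S"
  shows "partials vs u x = partials ws u x"
  using assms
proof (induction vs arbitrary: ws x)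
  case (Cons v vs)
  have "v \<in> set ws" using Cons.prems(1) by (metis list.set_intros(1) mset_eq_setD)
  then obtain xs ys where ws: "ws = xs @ v # ys" by (meson split_list)
  have m: "mset vs = mset (xs @ ys)" using Cons.prems(1) by (simp add: ws)
  have l: "length ws \<le> k" using Cons.prems by (metis size_mset)
  have "partials (v # vs) u x = partials (v # xs @ ys) u x"
    using Cons.prems m by (intro partials_Cons_cong Cons.IH) auto
  also have "\<dots> = partials ws u x" using partials_move_front[of xs v ys x] l Cons.prems(3) by (simp add: ws)
  finally show ?case .
qed simp

lemma jet2_partials:
  assumes "length vs + 2 \<le> k" "x \<in> S"
  shows "jet2 (\<lambda>t. partials vs u (x + t *\<^sub>R v)) (partials vs u x) (partials (v # vs) u x) (partials (v # v # vs) u x)"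
proof (rule jet2I[where g' = "\<lambda>t. partials (v # vs) u (x + t *\<^sub>R v)"])
  have "((\<lambda>t. x + t *\<^sub>R v) \<longlongrightarrow> x + 0 *\<^sub>R v) (nhds 0)" by (intro tendsto_intros filterlim_ident)
  hence "\<forall>\<^sub>F t in nhds 0. x + t *\<^sub>R v \<in> S" using S assms(2) by (auto intro: topological_tendstoD)
  thus "\<forall>\<^sub>F t in nhds 0. ((\<lambda>t. partials vs u (x + t *\<^sub>R v)) has_real_derivative partials (v # vs) u (x + t *\<^sub>R v)) (at t)"
    by (rule eventually_mono) (use assms in \<open>auto intro!: partials_line_DERIV simp del: partials.simps\<close>)
  show "((\<lambda>t. partials (v # vs) u (x + t *\<^sub>R v)) has_real_derivative partials (v # v # vs) u x) (at 0)"
    using partials_line_DERIV[of "v # vs" x 0 v] assms by simp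
qed simp_all

lemma partials_Cons_sum:
  assumes "length vs < k" "x \<in> S"
  shows "partials ((\<Sum>i\<in>I. c i *\<^sub>R v i) # vs) u x = (\<Sum>i\<in>I. c i * partials (v i # vs) u x)"
proof -
  from partials_has_derivative[OF assms] interpret l: linear "\<lambda>w. partials (w # vs) u x"
    by (rule has_derivative_linear)
  show ?thesis by (simp only: l.sum l.scale real_scaleR_def)
qed

lemma inner_grad:
  assumes "1 \<le> k" "x \<in> S"
  shows "grad u x \<bullet> v = partials [v] u x"
proof -
  have "partials [v] u x = partials [\<Sum>b\<in>Basis. (v \<bullet> b) *\<^sub>R b] u x" by (simp add: euclidean_representation)
  also have "\<dots> = (\<Sum>b\<in>Basis. (v \<bullet> b) * partials [b] u x)" using assms by (intro partials_Cons_sum) auto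
  also have "\<dots> = grad u x \<bullet> v"
    by (simp add: grad_def inner_sum_left inner_commute[of v] mult.commute del: partials.simps)
  finally show ?thesis by simp
qed

end

lemma partials_eq_hessian:
  fixes u :: "real^'n \<Rightarrow> real"
  assumes "Ck_on k S u" "open S" "2 \<le> k" "x \<in> S"
  shows "partials [v, w] u x = v \<bullet> (hessian u x *v w)"
proof -
  have rep: "w = (\<Sum>i\<in>UNIV. (w $ i) *\<^sub>R axis i 1)" for w :: "real^'n"
    by (simp add: vec_eq_iff axis_def if_distrib cong: if_cong)
  have l1: "partials [v, w] u x = (\<Sum>i\<in>UNIV. v $ i * partials [axis i 1, w] u x)" for v w
    using partials_Cons_sum[OF assms(1,2), of "[w]" x "\<lambda>i. v $ i" "\<lambda>i. axis i 1" UNIV] assms(3,4) rep[of v] by simp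
  have "partials [v, w] u x = (\<Sum>i\<in>UNIV. v $ i * partials [axis i 1, w] u x)" by (rule l1)
  \<comment> \<open>Linearity is used in the outermost direction, so the second vector is moved
    there first.\<close>
  also have "\<dots> = (\<Sum>i\<in>UNIV. v $ i * partials [w, axis i 1] u x)"
    using partials_commute[OF assms(1,2), of "[]" x] assms(3,4) by (simp del: partials.simps)
  also have "\<dots> = (\<Sum>i\<in>UNIV. v $ i * (\<Sum>j\<in>UNIV. w $ j * partials [axis j 1, axis i 1] u x))"
    by (subst l1[of w]) (rule refl)
  also have "\<dots> = (\<Sum>i\<in>UNIV. v $ i * (\<Sum>j\<in>UNIV. w $ j * partials [axis i 1, axis j 1] u x))"
    using partials_commute[OF assms(1,2), of "[]" x] assms(3,4) by (simp del: partials.simps)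
  also have "\<dots> = v \<bullet> (hessian u x *v w)"
    by (simp add: inner_vec_def hessian_def matrix_vector_mult_def mult.commute del: partials.simps)
  finally show ?thesis .
qed

lemma hessian_symmetric:
  fixes u :: "real^'n \<Rightarrow> real"
  assumes "Ck_on k S u" "open S" "2 \<le> k" "x \<in> S"
  shows "transpose (hessian u x) = hessian u x"
  using partials_commute[OF assms(1,2), of "[]" x] assms(3,4)
  by (simp add: hessian_def transpose_def vec_eq_iff del: partials.simps)

section \<open>Bounds from the norms\<close>

text \<open>A supremum of reals is informative only for a bounded set; some Lipschitz constant L,
  however large, makes the difference quotients bounded.\<close>

lemma lip_seminorm_bound:
  assumes "L-lipschitz_on S g" "x \<in> S" "y \<in> S"
  shows "dist (g x) (g y) \<le> lip_seminorm S g * dist x y"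
proof (cases "x = y")
  case False
  let ?A = "{dist (g x) (g y) / dist x y | x y. x \<in> S \<and> y \<in> S \<and> x \<noteq> y}"
  have "bdd_above ?A"
    using lipschitz_onD[OF assms(1)] by (intro bdd_aboveI[of _ L]) (auto simp: divide_le_eq)
  hence "dist (g x) (g y) / dist x y \<le> lip_seminorm S g"
    unfolding lip_seminorm_def using assms False by (intro cSup_upper) auto
  thus ?thesis using False by (simp add: pos_divide_le_eq)
qed simp

lemma lip_seminorm_nonneg:
  assumes "L-lipschitz_on S g" "x \<in> S" "y \<in> S" "x \<noteq> y"
  shows "lip_seminorm S g \<ge> 0"
  using lip_seminorm_bound[OF assms(1-3)] assms(4)
  by (metis dist_pos_lt less_le_not_le mult_less_0_iff not_le order_trans zero_le_dist)

lemma DERIV_norm_le: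
  fixes \<phi> :: "real \<Rightarrow> real"
  assumes "(\<phi> has_real_derivative D) (at 0)" "\<forall>\<^sub>F t in nhds 0. \<bar>\<phi> t - \<phi> 0\<bar> \<le> L * \<bar>t\<bar>"
  shows "\<bar>D\<bar> \<le> L"
proof -
  have "((\<lambda>t. \<bar>(\<phi> t - \<phi> 0) / t\<bar>) \<longlongrightarrow> \<bar>D\<bar>) (at 0)"
    using assms(1) by (intro tendsto_rabs) (simp add: has_field_derivative_iff)
  moreover have "\<forall>\<^sub>F t in at 0. \<bar>(\<phi> t - \<phi> 0) / t\<bar> \<le> L"
    using assms(2) unfolding eventually_at_filter
    by eventually_elim (simp add: abs_divide divide_le_eq)
  ultimately show ?thesis by (intro tendsto_upperbound) auto
qed

lemma line_eventually_in_open: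
  fixes x v :: "'a::real_normed_vector"
  assumes "open S" "x \<in> S"
  shows "\<forall>\<^sub>F t in nhds 0. x + t *\<^sub>R v \<in> S"
proof -
  have "((\<lambda>t. x + t *\<^sub>R v) \<longlongrightarrow> x + 0 *\<^sub>R v) (nhds 0)" by (intro tendsto_intros filterlim_ident)
  thus ?thesis using assms by (auto intro: topological_tendstoD)
qed

text \<open>The derivative along the gradient itself equals |grad u|^2 and is at most L |grad
  u|.\<close>

lemma grad_norm_le:
  fixes u :: "'a::euclidean_space \<Rightarrow> real"
  assumes C: "Ck_on k S u" "1 \<le> k" and S: "open S" "x \<in> S"
    and lip: "\<And>y. y \<in> S \<Longrightarrow> \<bar>u y - u x\<bar> \<le> L * norm (y - x)"
  shows "norm (grad u x) \<le> L"
proof -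
  let ?v = "grad u x"
  have D: "((\<lambda>t. u (x + t *\<^sub>R ?v)) has_real_derivative partials [?v] u x) (at 0)"
    using partials_line_DERIV[OF C(1) S(1), of "[]" x 0 ?v] assms by (simp del: partials.simps(2))
  have "\<forall>\<^sub>F t in nhds 0. \<bar>u (x + t *\<^sub>R ?v) - u (x + 0 *\<^sub>R ?v)\<bar> \<le> (L * norm ?v) * \<bar>t\<bar>"
  proof (rule eventually_mono[OF line_eventually_in_open[OF S, of ?v]])
    fix t assume "x + t *\<^sub>R ?v \<in> S"
    from lip[OF this] show "\<bar>u (x + t *\<^sub>R ?v) - u (x + 0 *\<^sub>R ?v)\<bar> \<le> (L * norm ?v) * \<bar>t\<bar>"
      by (simp add: mult_ac)
  qed
  from DERIV_norm_le[OF D this] have "\<bar>partials [?v] u x\<bar> \<le> L * norm ?v" .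
  moreover have "partials [?v] u x = norm ?v * norm ?v"
    using inner_grad[OF C(1) S(1) C(2) S(2), of ?v] by (simp add: power2_norm_eq_inner[symmetric] power2_eq_square del: partials.simps)
  ultimately have "norm ?v * norm ?v \<le> L * norm ?v" by simp
  \<comment> \<open>If the gradient vanishes the claim is L >= 0, which a second point of the open
    set supplies.\<close>
  moreover have "L \<ge> 0" if "norm ?v = 0"
  proof -
    obtain e where e: "e > 0" "ball x e \<subseteq> S" using S open_contains_ball by blast
    obtain b :: 'a where b: "b \<in> Basis" using nonempty_Basis by blast
    have "x + (e / 2) *\<^sub>R b \<in> S" using e b by (intro subsetD[OF e(2)]) (simp add: dist_norm)
    from order_trans[OF abs_ge_zero lip[OF this]] show ?thesis
      using b e(1) by (simp add: zero_le_mult_iff)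
  qed
  ultimately show ?thesis by (cases "norm ?v = 0") auto
qed

lemma Ck_closure_partials_bounded:
  assumes "Ck_closure k S f" "bounded S" "set bs \<subseteq> Basis" "length bs \<le> k"
  obtains B where "B > 0" "\<And>x. x \<in> S \<Longrightarrow> \<bar>partials bs f x\<bar> \<le> B"
proof -
  obtain g where g: "continuous_on (closure S) g" "\<And>x. x \<in> S \<Longrightarrow> g x = partials bs f x"
    using assms unfolding Ck_closure_def by blast
  have "compact (closure S)" using assms(2) by (simp add: compact_closure)
  hence "bounded (g ` closure S)" using g(1) by (intro compact_imp_bounded compact_continuous_image)
  then obtain B where "B > 0" "\<And>y. y \<in> g ` closure S \<Longrightarrow> norm y \<le> B" by (auto simp: bounded_pos)
  thus ?thesis using that[of B] g(2) closure_subset[of S] by force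
qed

text \<open>Bounded first derivatives on a convex set give some Lipschitz constant, which extends to
  the closure and makes the seminorm a genuine supremum; the gradient is then bounded by that
  seminorm.\<close>

lemma C01_norm_bounds:
  fixes u :: "'a::euclidean_space \<Rightarrow> real"
  assumes C: "Ck_closure k S u" "1 \<le> k" and S: "open S" "S \<noteq> {}" "bounded S" "convex S"
  defines "U \<equiv> C01_norm (closure S) u"
  shows "x \<in> closure S \<Longrightarrow> \<bar>u x\<bar> \<le> U" and "x \<in> S \<Longrightarrow> norm (grad u x) \<le> U"
proof -
  have Con: "Ck_on k S u" and cont: "continuous_on (closure S) u" using C(1) by (auto simp: Ck_closure_def)
  have "\<exists>B. \<forall>x\<in>S. \<bar>partials [b] u x\<bar> \<le> B" if b: "b \<in> Basis" for b
  proof -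
    obtain B where "\<And>x. x \<in> S \<Longrightarrow> \<bar>partials [b] u x\<bar> \<le> B"
      by (rule Ck_closure_partials_bounded[OF C(1) S(3), of "[b]"]) (use b C(2) in auto)
    thus ?thesis by blast
  qed
  then obtain B where B: "\<And>b x. b \<in> Basis \<Longrightarrow> x \<in> S \<Longrightarrow> \<bar>partials [b] u x\<bar> \<le> B b" by metis
  define L where "L = (\<Sum>b\<in>Basis. B b)"
  obtain x0 where x0: "x0 \<in> S" using S(2) by blast
  have L0: "L \<ge> 0" unfolding L_def
    by (intro sum_nonneg) (metis B x0 abs_ge_zero order_trans)
  have gL: "norm (grad u x) \<le> L" if "x \<in> S" for x
    unfolding grad_def L_def using B that
    by (intro order_trans[OF norm_sum] sum_mono) (simp del: partials.simps)
  have "L-lipschitz_on S u"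
  proof (rule lipschitz_onI)
    fix x y assume xy: "x \<in> S" "y \<in> S"
    have "norm (u x - u y) \<le> L * norm (x - y)"
    proof (rule differentiable_bound[OF S(4) _ _ xy(1) xy(2)])
      fix z assume z: "z \<in> S"
      show "(u has_derivative (\<lambda>v. partials [v] u z)) (at z within S)"
        using partials_has_derivative[OF Con S(1), of "[]" z] C(2) z by (simp add: has_derivative_at_withinI)
      show "onorm (\<lambda>v. partials [v] u z) \<le> L"
      proof (rule onorm_bound[OF L0])
        fix v
        have "norm (partials [v] u z) = \<bar>grad u z \<bullet> v\<bar>" using inner_grad[OF Con S(1) C(2) z] by simp
        also have "\<dots> \<le> norm (grad u z) * norm v" by (rule Cauchy_Schwarz_ineq2)
        also have "\<dots> \<le> L * norm v" using gL[OF z] by (intro mult_right_mono) auto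
        finally show "norm (partials [v] u z) \<le> L * norm v" .
      qed
    qed
    thus "dist (u x) (u y) \<le> L * dist x y" by (simp add: dist_norm)
  qed (rule L0)
  hence lip: "L-lipschitz_on (closure S) u" using cont by (rule lipschitz_on_closure)
  let ?l = "lip_seminorm (closure S) u"
  have gl: "norm (grad u x) \<le> ?l" if "x \<in> S" for x
    using Con C(2) S(1) that
  proof (rule grad_norm_le)
    fix y assume "y \<in> S"
    thus "\<bar>u y - u x\<bar> \<le> ?l * norm (y - x)"
      using lip_seminorm_bound[OF lip, of y x] that closure_subset[of S] by (auto simp: dist_norm)
  qed
  have l0: "?l \<ge> 0" using gl[OF x0] norm_ge_zero order_trans by blast
  have "compact (closure S)" using S(3) by (simp add: compact_closure)
  hence "bdd_above ((\<lambda>x. \<bar>u x\<bar>) ` closure S)"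
    using cont by (intro bounded_imp_bdd_above compact_imp_bounded compact_continuous_image continuous_intros)
  hence s: "\<bar>u x\<bar> \<le> (SUP x\<in>closure S. \<bar>u x\<bar>)" if "x \<in> closure S" for x using that by (intro cSUP_upper)
  show "x \<in> closure S \<Longrightarrow> \<bar>u x\<bar> \<le> U" using s[of x] l0 unfolding U_def C01_norm_def by simp
  have "x0 \<in> closure S" using x0 closure_subset[of S] by blast
  hence "(SUP x\<in>closure S. \<bar>u x\<bar>) \<ge> 0" using s[of x0] by linarith
  thus "x \<in> S \<Longrightarrow> norm (grad u x) \<le> U" using gl[of x] unfolding U_def C01_norm_def by simp
qed

section \<open>Bounds for the right-hand side f\<close>

lemma closure_slab:
  fixes \<Omega> :: "'a::euclidean_space set"
  shows "closure (\<Omega> \<times> (UNIV :: 'b::euclidean_space set) \<times> (UNIV :: 'c::euclidean_space set)) = closure \<Omega> \<times> UNIV \<times> UNIV"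
  by (simp add: closure_Times)

lemma rhs_min_bounds:
  fixes \<Omega> :: "(real^'n) set"
  assumes f: "C11_rhs \<Omega> f" "\<forall>w \<in> closure \<Omega> \<times> UNIV \<times> UNIV. f w > 0" and \<Omega>: "\<Omega> \<noteq> {}" "bounded \<Omega>" and M: "M \<ge> 0"
  shows "rhs_min \<Omega> M f > 0" and "w \<in> closure \<Omega> \<times> {-M..M} \<times> cball 0 M \<Longrightarrow> rhs_min \<Omega> M f \<le> f w"
proof -
  let ?W = "closure \<Omega> \<times> {-M..M} \<times> cball (0::real^'n) M"
  have "continuous_on (closure \<Omega> \<times> UNIV \<times> UNIV) f"
    using f(1) unfolding C11_rhs_def Ck_closure_def closure_slab by blast
  hence cont: "continuous_on ?W f" by (rule continuous_on_subset) auto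
  have "compact ?W" using \<Omega>(2) by (intro compact_Times) (auto simp: compact_closure)
  moreover have "?W \<noteq> {}" using \<Omega>(1) M by auto
  ultimately obtain w0 where w0: "w0 \<in> ?W" "\<And>w. w \<in> ?W \<Longrightarrow> f w0 \<le> f w"
    using continuous_attains_inf[OF _ _ cont] by blast
  have "rhs_min \<Omega> M f = f w0" unfolding rhs_min_def
    by (intro antisym cINF_lower cINF_greatest bdd_belowI2[of _ "f w0"]) (use w0 in auto)
  thus "rhs_min \<Omega> M f > 0" "w \<in> ?W \<Longrightarrow> rhs_min \<Omega> M f \<le> f w" using w0 f(2) by auto
qed

lemma rhs_norm_bounds:
  fixes \<Omega> :: "(real^'n) set" and f :: "(real^'n) \<times> real \<times> (real^'n) \<Rightarrow> real"
  assumes f: "C11_rhs \<Omega> f" and \<Omega>: "open \<Omega>" "\<Omega> \<noteq> {}" "bounded \<Omega>" and M: "M \<ge> 0"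
  defines "W \<equiv> \<Omega> \<times> {-M..M} \<times> cball (0::real^'n) M" and "K \<equiv> rhs_norm \<Omega> M f"
  shows "w \<in> W \<Longrightarrow> norm (grad f w) \<le> K"
    and "w \<in> W \<Longrightarrow> w' \<in> W \<Longrightarrow> norm (grad f w - grad f w') \<le> K * norm (w - w')"
proof -
  obtain L where L: "L-lipschitz_on W (grad f)" using f unfolding C11_rhs_def W_def by blast
  have cont: "continuous_on (closure \<Omega> \<times> UNIV \<times> UNIV) f"
    using f unfolding C11_rhs_def Ck_closure_def closure_slab by blast
  let ?W = "closure \<Omega> \<times> {-M..M} \<times> cball (0::real^'n) M"
  have cW: "compact ?W" using \<Omega>(3) by (intro compact_Times) (auto simp: compact_closure)
  have sub: "W \<subseteq> ?W" unfolding W_def using closure_subset[of \<Omega>] by auto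
  have "bounded ((\<lambda>w. \<bar>f w\<bar>) ` ?W)"
    by (intro compact_imp_bounded compact_continuous_image[OF _ cW] continuous_intros continuous_on_subset[OF cont]) auto
  hence b1: "bdd_above ((\<lambda>w. \<bar>f w\<bar>) ` W)" using bounded_imp_bdd_above bdd_above_mono image_mono[OF sub] by metis
  obtain x0 where x0: "x0 \<in> \<Omega>" using \<Omega>(2) by blast
  obtain e where e: "e > 0" "ball x0 e \<subseteq> \<Omega>" using \<Omega>(1) x0 open_contains_ball by blast
  obtain b :: "real^'n" where b: "b \<in> Basis" using nonempty_Basis by blast
  \<comment> \<open>The second point must differ in the x-component: for M = 0 the other two factors
    are single points.\<close>
  define x1 where "x1 = x0 + (e / 2) *\<^sub>R b"
  have "x1 \<in> \<Omega>" using e b by (intro subsetD[OF e(2)]) (simp add: dist_norm x1_def)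
  hence w01: "(x0, 0, 0) \<in> W" "(x1, 0, 0) \<in> W" "(x0, 0::real, 0::real^'n) \<noteq> (x1, 0, 0)"
    using x0 M e(1) b by (auto simp: W_def x1_def)
  have l0: "lip_seminorm W (grad f) \<ge> 0" by (rule lip_seminorm_nonneg[OF L w01])
  have "bounded W" using cW sub by (meson bounded_subset compact_imp_bounded)
  then obtain R where R: "\<And>w. w \<in> W \<Longrightarrow> norm w \<le> R" by (auto simp: bounded_iff)
  have b2: "bdd_above ((\<lambda>w. norm (grad f w)) ` W)"
  proof (rule bdd_aboveI2)
    fix w assume w: "w \<in> W"
    have "norm (grad f w) \<le> norm (grad f (x0, 0, 0)) + dist (grad f w) (grad f (x0, 0, 0))"
      by (metis add.commute dist_norm norm_triangle_sub)
    also have "dist (grad f w) (grad f (x0, 0, 0)) \<le> L * dist w (x0, 0, 0)" using L w w01(1) by (rule lipschitz_onD)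
    also have "\<dots> \<le> L * (R + R)"
    proof (rule mult_left_mono)
      show "dist w (x0, 0, 0) \<le> R + R"
        unfolding dist_norm using norm_triangle_ineq4[of w "(x0, 0, 0)"] R[OF w] R[OF w01(1)] by linarith
    qed (use L lipschitz_on_nonneg in blast)
    finally show "norm (grad f w) \<le> norm (grad f (x0, 0, 0)) + L * (R + R)" by simp
  qed
  have s1: "(SUP w\<in>W. \<bar>f w\<bar>) \<ge> 0" using cSUP_upper[OF w01(1) b1] abs_ge_zero order_trans by blast
  have s2: "(SUP w\<in>W. norm (grad f w)) \<ge> 0" using cSUP_upper[OF w01(1) b2] norm_ge_zero order_trans by blast
  have K: "K = (SUP w\<in>W. \<bar>f w\<bar>) + (SUP w\<in>W. norm (grad f w)) + lip_seminorm W (grad f)"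
    unfolding K_def rhs_norm_def C11_norm_def W_def ..
  show "w \<in> W \<Longrightarrow> norm (grad f w) \<le> K"
    using cSUP_upper[OF _ b2, of w] s1 l0 unfolding K by linarith
  show "w \<in> W \<Longrightarrow> w' \<in> W \<Longrightarrow> norm (grad f w - grad f w') \<le> K * norm (w - w')"
  proof -
    assume w: "w \<in> W" "w' \<in> W"
    have "norm (grad f w - grad f w') \<le> lip_seminorm W (grad f) * norm (w - w')"
      using lip_seminorm_bound[OF L w] by (simp add: dist_norm)
    also have "\<dots> \<le> K * norm (w - w')" using s1 s2 unfolding K by (intro mult_right_mono) auto
    finally show ?thesis .
  qed
qed

text \<open>As \<open>f\<close> has only Lipschitz first derivatives, its second derivatives along the solution
  are replaced by this one-sided quadratic bound.\<close>

lemma quadratic_upper_bound: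
  fixes f :: "'a::euclidean_space \<Rightarrow> real"
  assumes C: "Ck_on 1 S f" "open S" and W: "convex W" "W \<subseteq> S" "w0 \<in> W" "w1 \<in> W"
    and K: "\<And>w w'. w \<in> W \<Longrightarrow> w' \<in> W \<Longrightarrow> norm (grad f w - grad f w') \<le> K * norm (w - w')"
  shows "f w1 \<le> f w0 + grad f w0 \<bullet> (w1 - w0) + K * (norm (w1 - w0))\<^sup>2"
proof -
  let ?v = "w1 - w0"
  have inW: "w0 + t *\<^sub>R ?v \<in> W" if "0 \<le> t" "t \<le> 1" for t
  proof -
    have "(1 - t) *\<^sub>R w0 + t *\<^sub>R w1 \<in> W" using W that by (intro convexD) auto
    thus ?thesis by (simp add: algebra_simps)
  qed
  have "\<exists>s. 0 < s \<and> s < 1 \<and> f (w0 + 1 *\<^sub>R ?v) - f (w0 + 0 *\<^sub>R ?v) = (1 - 0) * partials [?v] f (w0 + s *\<^sub>R ?v)"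
  proof (rule MVT2)
    fix t :: real assume "0 \<le> t" "t \<le> 1"
    hence "w0 + t *\<^sub>R ?v \<in> S" using inW W by auto
    thus "((\<lambda>t. f (w0 + t *\<^sub>R ?v)) has_real_derivative partials [?v] f (w0 + t *\<^sub>R ?v)) (at t)"
      using partials_line_DERIV[OF C, of "[]" w0 t ?v] by simp
  qed simp
  then obtain s where s: "0 < s" "s < 1" "f w1 - f w0 = partials [?v] f (w0 + s *\<^sub>R ?v)" by auto
  let ?z = "w0 + s *\<^sub>R ?v"
  have zW: "?z \<in> W" using inW s by auto
  have "f w1 - f w0 = grad f ?z \<bullet> ?v" using inner_grad[OF C, of ?z ?v] zW W(2) s(3) by auto
  also have "\<dots> = grad f w0 \<bullet> ?v + (grad f ?z - grad f w0) \<bullet> ?v" by (simp add: inner_diff_left)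
  also have "(grad f ?z - grad f w0) \<bullet> ?v \<le> norm (grad f ?z - grad f w0) * norm ?v" by (rule norm_cauchy_schwarz)
  also have "\<dots> \<le> (K * norm (?z - w0)) * norm ?v" using K[OF zW W(3)] by (intro mult_right_mono) auto
  also have "\<dots> = s * (K * (norm ?v)\<^sup>2)" using s by (simp add: power2_eq_square)
  also have "\<dots> \<le> 1 * (K * (norm ?v)\<^sup>2)"
  proof (rule mult_right_mono)
    have "0 \<le> K * norm ?v" using K[OF W(4) W(3)] norm_ge_zero order_trans by blast
    thus "0 \<le> K * (norm ?v)\<^sup>2" by (simp add: power2_eq_square mult.assoc[symmetric])
  qed (use s in auto)
  finally show ?thesis by simp
qed

section \<open>The estimate at the maximum point\<close>

lemma orthonormal_inner_expand:
  fixes e :: "'n \<Rightarrow> real^'n"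
  assumes "orthonormal_family e"
  shows "x \<bullet> y = (\<Sum>i\<in>UNIV. (x \<bullet> e i) * (y \<bullet> e i))"
proof -
  have "x \<bullet> y = (\<Sum>i\<in>UNIV. (x \<bullet> e i) *\<^sub>R e i) \<bullet> y"
    using orthonormal_expand[OF assms, of x] by simp
  also have "\<dots> = (\<Sum>i\<in>UNIV. (x \<bullet> e i) * (e i \<bullet> y))" by (simp only: inner_sum_left inner_scaleR_left)
  finally show ?thesis by (simp only: inner_commute[of y])
qed

context
  fixes \<Omega> :: "(real^'n) set" and u :: "real^'n \<Rightarrow> real" and x0 :: "real^'n"
    and e :: "'n \<Rightarrow> real^'n" and l :: "'n \<Rightarrow> real"
  assumes \<Omega>: "open \<Omega>" "x0 \<in> \<Omega>" and u: "Ck_on 4 \<Omega> u"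
    and e: "orthonormal_family e" and H: "\<And>i. hessian u x0 *v e i = l i *\<^sub>R e i"
begin

lemma eigenbasis_inner: "e i \<bullet> e j = (if i = j then 1 else 0)"
  using e by (simp add: orthonormal_family_def)

lemma second_partials: "partials [e i, e j] u x0 = (if i = j then l i else 0)"
  using partials_eq_hessian[OF u \<Omega>(1) _ \<Omega>(2), of "e i" "e j"] by (simp add: H eigenbasis_inner del: partials.simps)

text \<open>Along the line, f at the solution lies below its first-order expansion plus K times the
  squared displacement, with contact at t = 0, so second derivatives compare. The gradient of u
  moves with velocity l r e r at t = 0, whence the term (l r)^2.\<close>

lemma rhs_second_derivative_bound:
  fixes f :: "(real^'n) \<times> real \<times> (real^'n) \<Rightarrow> real"
  assumes f: "Ck_on 1 (\<Omega> \<times> UNIV \<times> UNIV) f" and conv: "convex \<Omega>"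
    and bd: "\<And>x. x \<in> \<Omega> \<Longrightarrow> \<bar>u x\<bar> \<le> M" "\<And>x. x \<in> \<Omega> \<Longrightarrow> norm (grad u x) \<le> M"
    and K: "\<And>w w'. w \<in> \<Omega> \<times> {-M..M} \<times> cball 0 M \<Longrightarrow> w' \<in> \<Omega> \<times> {-M..M} \<times> cball 0 M \<Longrightarrow>
      norm (grad f w - grad f w') \<le> K * norm (w - w')"
    and g: "jet2 (\<lambda>t. f (x0 + t *\<^sub>R e r, u (x0 + t *\<^sub>R e r), grad u (x0 + t *\<^sub>R e r))) g0 g1 g2"
    and gf: "grad f (x0, u x0, grad u x0) = (\<alpha>, \<gamma>, \<pi>)"
  shows "g2 \<le> \<gamma> * l r + partials [e r, e r, \<pi>] u x0 + 2 * K * (1 + (partials [e r] u x0)\<^sup>2 + (l r)\<^sup>2)"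
proof -
  let ?x = "\<lambda>t. x0 + t *\<^sub>R e r"
  let ?W = "\<Omega> \<times> {-M..M} \<times> cball (0::real^'n) M"
  let ?w = "\<lambda>t. (?x t, u (?x t), grad u (?x t))"
  let ?Q = "\<lambda>t. 0 + t * (\<alpha> \<bullet> e r) + \<gamma> * (u (?x t) + (- u x0)) + (partials [\<pi>] u (?x t) + - partials [\<pi>] u x0)
     + K * ((0 + t * 1) * (0 + t * 1) + (u (?x t) + (- u x0)) * (u (?x t) + (- u x0))
       + (\<Sum>i\<in>UNIV. (partials [e i] u (?x t) + - partials [e i] u x0) * (partials [e i] u (?x t) + - partials [e i] u x0)))"
  have ev: "\<forall>\<^sub>F t in nhds 0. ?x t \<in> \<Omega>" by (rule line_eventually_in_open[OF \<Omega>])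
  have f': "Ck_on 1 (\<Omega> \<times> UNIV \<times> (UNIV :: (real^'n) set)) f" "open (\<Omega> \<times> (UNIV :: real set) \<times> (UNIV :: (real^'n) set))"
    using f \<Omega> by (auto intro!: open_Times)
  have inW: "(x, u x, grad u x) \<in> ?W" if "x \<in> \<Omega>" for x
    using bd[OF that] that by (auto simp: abs_le_iff)
  have "\<forall>\<^sub>F t in nhds 0. 0 \<le> ?Q t + (g0 + (-1) * f (?w t))"
    using ev
  proof (rule eventually_mono)
    fix t assume t: "?x t \<in> \<Omega>"
    have gu: "grad u x \<bullet> v = partials [v] u x" if "x \<in> \<Omega>" for x v
      using inner_grad[OF u \<Omega>(1) _ that, of v] by simp
    have "f (?w t) \<le> f (x0, u x0, grad u x0) + grad f (x0, u x0, grad u x0) \<bullet> (?w t - (x0, u x0, grad u x0))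
        + K * (norm (?w t - (x0, u x0, grad u x0)))\<^sup>2"
      using \<Omega>(2) t conv by (intro quadratic_upper_bound[OF f', of ?W] inW K convex_Times) auto
    also have "f (x0, u x0, grad u x0) = g0" using jet2_value[OF g] by simp
    also have "grad f (x0, u x0, grad u x0) \<bullet> (?w t - (x0, u x0, grad u x0))
      = t * (\<alpha> \<bullet> e r) + \<gamma> * (u (?x t) - u x0) + (partials [\<pi>] u (?x t) - partials [\<pi>] u x0)"
      unfolding gf using gu[OF t, of \<pi>] gu[OF \<Omega>(2), of \<pi>]
      by (simp add: inner_diff_right inner_commute del: partials.simps)
    also have "(norm (?w t - (x0, u x0, grad u x0)))\<^sup>2 = t * t + (u (?x t) - u x0) * (u (?x t) - u x0)
      + (\<Sum>i\<in>UNIV. (partials [e i] u (?x t) - partials [e i] u x0) * (partials [e i] u (?x t) - partials [e i] u x0))"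
    proof -
      have "(norm (?w t - (x0, u x0, grad u x0)))\<^sup>2 = t * t * (e r \<bullet> e r) + (u (?x t) - u x0) * (u (?x t) - u x0)
        + (grad u (?x t) - grad u x0) \<bullet> (grad u (?x t) - grad u x0)"
        by (simp add: power2_norm_eq_inner)
      also have "(grad u (?x t) - grad u x0) \<bullet> (grad u (?x t) - grad u x0)
        = (\<Sum>i\<in>UNIV. (partials [e i] u (?x t) - partials [e i] u x0) * (partials [e i] u (?x t) - partials [e i] u x0))"
        by (subst orthonormal_inner_expand[OF e]) (simp add: inner_diff_left gu[OF t] gu[OF \<Omega>(2)] del: partials.simps)
      finally show ?thesis by (simp add: eigenbasis_inner del: partials.simps)
    qed
    finally show "0 \<le> ?Q t + (g0 + (-1) * f (?w t))" by (simp del: partials.simps)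
  qed
  moreover have "jet2 (\<lambda>t. ?Q t + (g0 + (-1) * f (?w t))) 0
    (\<alpha> \<bullet> e r + \<gamma> * partials [e r] u x0 + partials [e r, \<pi>] u x0 - g1)
    (\<gamma> * partials [e r, e r] u x0 + partials [e r, e r, \<pi>] u x0
      + 2 * K * (1 + (partials [e r] u x0)\<^sup>2 + (\<Sum>i\<in>UNIV. (partials [e r, e i] u x0)\<^sup>2)) - g2)"
  proof -
    have Ju: "jet2 (\<lambda>t. u (?x t) + (- u x0)) (u x0 + (- u x0)) (partials [e r] u x0 + 0) (partials [e r, e r] u x0 + 0)"
      using jet2_partials[OF u \<Omega>(1), of "[]" x0 "e r"] \<Omega>(2) by (intro jet2_add jet2_const) simp
    have Jp: "jet2 (\<lambda>t. partials [v] u (?x t) + - partials [v] u x0) (partials [v] u x0 + - partials [v] u x0)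
       (partials [e r, v] u x0 + 0) (partials [e r, e r, v] u x0 + 0)" for v
      using jet2_partials[OF u \<Omega>(1), of "[v]" x0 "e r"] \<Omega>(2) by (intro jet2_add jet2_const) simp
    have Js: "jet2 (\<lambda>t. \<Sum>i\<in>UNIV. (partials [e i] u (?x t) + - partials [e i] u x0) * (partials [e i] u (?x t) + - partials [e i] u x0))
      0 0 (\<Sum>i\<in>UNIV. 2 * (partials [e r, e i] u x0)\<^sup>2)"
      using jet2_sum[of UNIV, OF _ jet2_mult[OF Jp Jp], of e e] by (simp add: power2_eq_square mult.assoc del: partials.simps)
    have "jet2 (\<lambda>t. ?Q t + (g0 + (-1) * f (?w t)))
      (0 + \<gamma> * (u x0 + (- u x0)) + (partials [\<pi>] u x0 + - partials [\<pi>] u x0) + K * (0 * 0 + (u x0 + (- u x0)) * (u x0 + (- u x0)) + 0) + (g0 + (-1) * g0))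
      (\<alpha> \<bullet> e r + \<gamma> * (partials [e r] u x0 + 0) + (partials [e r, \<pi>] u x0 + 0) + K * ((1 * 0 + 0 * 1) + ((partials [e r] u x0 + 0) * (u x0 + (- u x0)) + (u x0 + (- u x0)) * (partials [e r] u x0 + 0)) + 0) + (0 + (-1) * g1))
      (0 + \<gamma> * (partials [e r, e r] u x0 + 0) + (partials [e r, e r, \<pi>] u x0 + 0) + K * ((0 * 0 + 2 * 1 * 1 + 0 * 0) + ((partials [e r, e r] u x0 + 0) * (u x0 + (- u x0)) + 2 * (partials [e r] u x0 + 0) * (partials [e r] u x0 + 0) + (u x0 + (- u x0)) * (partials [e r, e r] u x0 + 0)) + (\<Sum>i\<in>UNIV. 2 * (partials [e r, e i] u x0)\<^sup>2)) + (0 + (-1) * g2))"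
      by (intro jet2_add jet2_mult jet2_cmult jet2_linear jet2_const Ju Jp Js g)
    thus ?thesis by (simp add: power2_eq_square sum_distrib_left[symmetric] algebra_simps del: partials.simps)
  qed
  ultimately have "0 \<le> \<gamma> * partials [e r, e r] u x0 + partials [e r, e r, \<pi>] u x0
      + 2 * K * (1 + (partials [e r] u x0)\<^sup>2 + (\<Sum>i\<in>UNIV. (partials [e r, e i] u x0)\<^sup>2)) - g2"
    using jet2_nonneg(2) by blast
  moreover have "(\<Sum>i\<in>UNIV. (partials [e r, e i] u x0)\<^sup>2) = (l r)\<^sup>2"
  proof -
    have "(\<Sum>i\<in>UNIV. (partials [e r, e i] u x0)\<^sup>2) = (\<Sum>i\<in>UNIV. if r = i then (l r)\<^sup>2 else 0)"
      unfolding second_partials by (intro sum.cong) auto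
    thus ?thesis by simp
  qed
  moreover have "partials [e r, e r] u x0 = l r" unfolding second_partials by simp
  ultimately show ?thesis by (simp del: partials.simps)
qed

text \<open>Second-derivative test at the maximum, along the line \<open>x0 + t e i\<close> while the test vector
  \<open>e r + t w\<close> moves; this choice of \<open>w\<close> avoids differentiating the smallest eigenvalue, which
  need not be simple.\<close>

lemma maximum_second_derivative:
  assumes min: "\<And>x v. x \<in> \<Omega> \<Longrightarrow> \<kappa> * (v \<bullet> v) * exp (\<theta> x) \<le> v \<bullet> (hessian u x *v v)"
    and eq: "l r = \<kappa> * exp (\<theta> x0)" and l: "\<And>j. l j > 0"
    and \<theta>: "jet2 (\<lambda>t. \<theta> (x0 + t *\<^sub>R e i)) \<theta>0 \<theta>1 \<theta>2"
  defines "X \<equiv> \<lambda>i j. partials [e r, e i, e j] u x0"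
  shows "X i r = l r * \<theta>1"
    and "0 \<le> partials [e r, e r, e i, e i] u x0
       - 2 * (\<Sum>j\<in>UNIV-{r}. (X i j)\<^sup>2 * (1 / l j * (1 + l r * (1 / l j)))) - l r * (\<theta>2 + \<theta>1\<^sup>2)"
proof -
  let ?x = "\<lambda>t. x0 + t *\<^sub>R e i"
  \<comment> \<open>The optimal coefficients would be - X i j / (l j - l r), undefined for a
    repeated eigenvalue. Dropping l r there yields the factor 1 / l j (1 + l r / l j), the first two
    terms of the geometric series for 1 / (l j - l r).\<close>
  define w where "w = (\<Sum>j\<in>UNIV-{r}. (- (X i j / l j)) *\<^sub>R e j)"
  have wr: "e r \<bullet> w = 0" unfolding w_def by (simp add: inner_sum_right eigenbasis_inner if_distrib cong: if_cong)
  have we: "w \<bullet> e j = (if j = r then 0 else - (X i j / l j))" for j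
    unfolding w_def by (simp add: inner_sum_left eigenbasis_inner if_distrib cong: if_cong)
  have ww: "w \<bullet> w = (\<Sum>j\<in>UNIV-{r}. (X i j)\<^sup>2 * (1 / l j)\<^sup>2)"
  proof -
    have "w \<bullet> w = (\<Sum>j\<in>UNIV. if j = r then 0 else (X i j)\<^sup>2 * (1 / l j)\<^sup>2)"
      unfolding orthonormal_inner_expand[OF e, of w w] we by (intro sum.cong) (auto simp: power2_eq_square)
    also have "\<dots> = (\<Sum>j\<in>UNIV-{r}. (X i j)\<^sup>2 * (1 / l j)\<^sup>2)" by (intro sum.mono_neutral_cong_right) auto
    finally show ?thesis .
  qed
  have Hw: "hessian u x0 *v w = (\<Sum>j\<in>UNIV-{r}. (- X i j) *\<^sub>R e j)"
    unfolding w_def linear_sum[OF matrix_vector_mul_linear] matrix_vector_mult_scaleR H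
    using l by (intro sum.cong refl) (simp add: less_imp_neq[symmetric])
  have C0: "partials [w, w] u x0 = (\<Sum>j\<in>UNIV-{r}. (X i j)\<^sup>2 * (1 / l j))"
  proof -
    have "partials [w, w] u x0 = w \<bullet> (hessian u x0 *v w)" using partials_eq_hessian[OF u \<Omega>(1) _ \<Omega>(2)] by simp
    also have "\<dots> = (\<Sum>j\<in>UNIV-{r}. - X i j * (w \<bullet> e j))" unfolding Hw by (simp add: inner_sum_right)
    also have "\<dots> = (\<Sum>j\<in>UNIV-{r}. (X i j)\<^sup>2 * (1 / l j))" by (intro sum.cong) (auto simp: we power2_eq_square)
    finally show ?thesis .
  qed
  have B0: "partials [e r, w] u x0 = 0"
    using partials_eq_hessian[OF u \<Omega>(1) _ \<Omega>(2), of "e r" w] unfolding Hw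
    by (simp add: inner_sum_right eigenbasis_inner if_distrib cong: if_cong del: partials.simps)
  have perm: "partials vs u x0 = partials ws u x0" if "mset vs = mset ws" "length vs \<le> 4" for vs ws
    using partials_perm[OF u \<Omega>(1) that \<Omega>(2)] .
  have B1: "partials [e i, e r, w] u x0 = - (\<Sum>j\<in>UNIV-{r}. (X i j)\<^sup>2 * (1 / l j))"
  proof -
    have "partials [e i, e r, w] u x0 = partials [w, e i, e r] u x0" by (rule perm) simp_all
    also have "\<dots> = (\<Sum>j\<in>UNIV-{r}. - (X i j / l j) * partials [e j, e i, e r] u x0)"
      unfolding w_def using partials_Cons_sum[OF u \<Omega>(1), of "[e i, e r]" x0 "\<lambda>j. - (X i j / l j)" e] \<Omega>(2) by simp
    also have "\<dots> = (\<Sum>j\<in>UNIV-{r}. - (X i j / l j) * X i j)"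
    proof -
      have "partials [e j, e i, e r] u x0 = X i j" for j unfolding X_def by (rule perm) simp_all
      thus ?thesis by simp
    qed
    finally show ?thesis by (simp add: power2_eq_square sum_negf)
  qed
  \<comment> \<open>The gap in \<open>min\<close> at x0 + t e i for the vector e r + t w, expanded
    in powers of t; it is nonnegative near 0 and vanishes at t = 0.\<close>
  let ?h = "\<lambda>t. partials [e r, e r] u (?x t) + (0 + t * 2) * partials [e r, w] u (?x t)
     + (0 + t * 1) * (0 + t * 1) * partials [w, w] u (?x t)
     + (- \<kappa>) * ((1 + (w \<bullet> w) * ((0 + t * 1) * (0 + t * 1))) * exp (\<theta> (?x t)))"
  have "\<forall>\<^sub>F t in nhds 0. ?h t \<ge> 0"
  proof (rule eventually_mono[OF line_eventually_in_open[OF \<Omega>, of "e i"]])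
    fix t assume t: "?x t \<in> \<Omega>"
    let ?v = "e r + t *\<^sub>R w"
    let ?H = "hessian u (?x t)"
    have P: "partials [v, v'] u (?x t) = v \<bullet> (?H *v v')" for v v' using partials_eq_hessian[OF u \<Omega>(1) _ t] by simp
    have S: "w \<bullet> (?H *v e r) = e r \<bullet> (?H *v w)"
      unfolding P[symmetric] using partials_perm[OF u \<Omega>(1), of "[w, e r]" "[e r, w]", OF _ _ t] by simp
    have v1: "?v \<bullet> ?v = 1 + t * t * (w \<bullet> w)"
      using wr by (simp add: inner_add_left inner_add_right eigenbasis_inner inner_commute[of w "e r"] mult.assoc)
    have v2: "?v \<bullet> (?H *v ?v) = e r \<bullet> (?H *v e r) + 2 * t * (e r \<bullet> (?H *v w)) + t * t * (w \<bullet> (?H *v w))"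
      using S by (simp add: inner_add_left inner_add_right matrix_vector_right_distrib matrix_vector_mult_scaleR algebra_simps)
    show "?h t \<ge> 0" using min[OF t, of ?v] unfolding v1 v2 P by (simp add: algebra_simps)
  qed
  moreover have J: "jet2 ?h 0 (X i r - l r * \<theta>1) (partials [e r, e r, e i, e i] u x0 + 4 * partials [e i, e r, w] u x0
     + 2 * partials [w, w] u x0 - l r * (2 * (w \<bullet> w) + \<theta>2 + \<theta>1\<^sup>2))"
  proof -
    have Jp: "jet2 (\<lambda>t. partials [v, v'] u (?x t)) (partials [v, v'] u x0) (partials [e i, v, v'] u x0) (partials [e i, e i, v, v'] u x0)" for v v'
      using jet2_partials[OF u \<Omega>(1), of "[v, v']" x0 "e i"] \<Omega>(2) by simp
    have e0: "exp \<theta>0 = exp (\<theta> x0)" using jet2_value[OF \<theta>] by simp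
    have "jet2 ?h (partials [e r, e r] u x0 + 0 * partials [e r, w] u x0 + 0 * 0 * partials [w, w] u x0
        + (- \<kappa>) * ((1 + (w \<bullet> w) * (0 * 0)) * exp \<theta>0))
      (partials [e i, e r, e r] u x0 + (2 * partials [e r, w] u x0 + 0 * partials [e i, e r, w] u x0)
        + ((1 * 0 + 0 * 1) * partials [w, w] u x0 + 0 * 0 * partials [e i, w, w] u x0)
        + (- \<kappa>) * ((0 + (w \<bullet> w) * (1 * 0 + 0 * 1)) * exp \<theta>0 + (1 + (w \<bullet> w) * (0 * 0)) * (exp \<theta>0 * \<theta>1)))
      (partials [e i, e i, e r, e r] u x0 + (0 * partials [e r, w] u x0 + 2 * 2 * partials [e i, e r, w] u x0 + 0 * partials [e i, e i, e r, w] u x0)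
        + ((0 * 0 + 2 * 1 * 1 + 0 * 0) * partials [w, w] u x0 + 2 * (1 * 0 + 0 * 1) * partials [e i, w, w] u x0 + 0 * 0 * partials [e i, e i, w, w] u x0)
        + (- \<kappa>) * ((0 + (w \<bullet> w) * (0 * 0 + 2 * 1 * 1 + 0 * 0)) * exp \<theta>0 + 2 * (0 + (w \<bullet> w) * (1 * 0 + 0 * 1)) * (exp \<theta>0 * \<theta>1)
          + (1 + (w \<bullet> w) * (0 * 0)) * (exp \<theta>0 * (\<theta>2 + \<theta>1\<^sup>2))))"
      by (intro jet2_add jet2_mult jet2_cmult jet2_linear jet2_const jet2_exp Jp \<theta>)
    moreover have "partials [e i, e r, e r] u x0 = X i r" unfolding X_def by (rule perm) simp_all
    moreover have "partials [e i, e i, e r, e r] u x0 = partials [e r, e r, e i, e i] u x0" by (rule perm) simp_all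
    moreover have "partials [e r, e r] u x0 = \<kappa> * exp (\<theta> x0)" using second_partials[of r r] eq by simp
    ultimately show ?thesis unfolding e0 B0 eq by (simp add: algebra_simps del: partials.simps)
  qed
  ultimately have r: "X i r - l r * \<theta>1 = 0" "0 \<le> partials [e r, e r, e i, e i] u x0 + 4 * partials [e i, e r, w] u x0
     + 2 * partials [w, w] u x0 - l r * (2 * (w \<bullet> w) + \<theta>2 + \<theta>1\<^sup>2)"
    using jet2_nonneg[OF J] by blast+
  show "X i r = l r * \<theta>1" using r(1) by simp
  have "(\<Sum>j\<in>UNIV-{r}. (X i j)\<^sup>2 * (1 / l j * (1 + l r * (1 / l j)))) = (\<Sum>j\<in>UNIV-{r}. (X i j)\<^sup>2 * (1 / l j)) + l r * (w \<bullet> w)"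
    unfolding ww sum_distrib_left sum.distrib[symmetric] by (intro sum.cong refl) (simp add: algebra_simps power2_eq_square)
  thus "0 \<le> partials [e r, e r, e i, e i] u x0
       - 2 * (\<Sum>j\<in>UNIV-{r}. (X i j)\<^sup>2 * (1 / l j * (1 + l r * (1 / l j)))) - l r * (\<theta>2 + \<theta>1\<^sup>2)"
    using r(2) unfolding B1 C0 by (simp add: algebra_simps del: partials.simps)
qed

end

text \<open>Two regimes: either k = 1 or b r lies below the threshold of the third-order estimate,
  and b r is bounded outright; or that estimate applies. The bounds from both regimes are simply
  added.\<close>

lemma maximum_point_estimate:
  fixes \<Omega> :: "(real^'n) set" and u :: "real^'n \<Rightarrow> real" and f :: "(real^'n) \<times> real \<times> (real^'n) \<Rightarrow> real"
    and e :: "'n \<Rightarrow> real^'n" and l :: "'n \<Rightarrow> real" and k :: nat and A \<beta> d m K U M \<kappa> n :: real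
  assumes \<Omega>: "open \<Omega>" "x0 \<in> \<Omega>" "convex \<Omega>" and u: "Ck_on 4 \<Omega> u"
    and e: "orthonormal_family e" and H: "\<And>i. hessian u x0 *v e i = l i *\<^sub>R e i"
    and l: "\<And>i. l i > 0" "\<And>i. l r \<le> l i"
    and k: "1 \<le> k" "k < CARD('n)" and n: "n = real CARD('n)"
    and f: "Ck_on 1 (\<Omega> \<times> UNIV \<times> UNIV) f"
    and eqn: "\<And>x. x \<in> \<Omega> \<Longrightarrow> hess_quot k (hessian u x) = f (x, u x, grad u x)"
    and bd: "\<And>x. x \<in> \<Omega> \<Longrightarrow> \<bar>u x\<bar> \<le> U" "\<And>x. x \<in> \<Omega> \<Longrightarrow> norm (grad u x) \<le> U" and UM: "U \<le> M"
    and m: "m > 0" "\<And>w. w \<in> \<Omega> \<times> {-M..M} \<times> cball 0 M \<Longrightarrow> m \<le> f w"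
    and K: "\<And>w. w \<in> \<Omega> \<times> {-M..M} \<times> cball 0 M \<Longrightarrow> norm (grad f w) \<le> K"
      "\<And>w w'. w \<in> \<Omega> \<times> {-M..M} \<times> cball 0 M \<Longrightarrow> w' \<in> \<Omega> \<times> {-M..M} \<times> cball 0 M \<Longrightarrow>
         norm (grad f w - grad f w') \<le> K * norm (w - w')"
    and d: "norm (x0 - p) \<le> d" and neg: "\<And>x. x \<in> \<Omega> \<Longrightarrow> u x < 0"
    and A: "A = 4 * (2 * K * (2 + U\<^sup>2) / m + 1)" and \<beta>: "\<beta> \<ge> 32 * n" "\<beta> \<ge> 4 * A * d\<^sup>2"
    and max: "\<And>x v. x \<in> \<Omega> \<Longrightarrow> \<kappa> * (v \<bullet> v) * exp (\<beta> * ln (- u x) + A / 2 * ((x - p) \<bullet> (x - p))) \<le> v \<bullet> (hessian u x *v v)"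
    and eq: "l r = \<kappa> * exp (\<beta> * ln (- u x0) + A / 2 * ((x0 - p) \<bullet> (x0 - p)))"
  shows "- u x0 / l r \<le> \<beta> * n + (K * U + K * A * d * U + K * \<beta> * U) / m + U * ((1 + 16 * n) * n * max 1 (1 / m))"
proof -
  let ?K = "int k"
  define b where "b i = 1 / l i" for i
  have b: "b i > 0" "b i * l i = 1" "b i \<le> b r" for i
    using l(1)[of i] l(2)[of i] l(1)[of r] by (auto simp: b_def frac_le)
  let ?\<sigma> = "esym ?K UNIV b"
  define s where "s = - u x0"
  have s: "s > 0" "s \<le> U" using neg[OF \<Omega>(2)] bd(1)[OF \<Omega>(2)] by (auto simp: s_def)
  have inW: "(x, u x, grad u x) \<in> \<Omega> \<times> {-M..M} \<times> cball 0 M" if "x \<in> \<Omega>" for x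
    using bd[OF that] that UM by (auto simp: abs_le_iff)
  have U0: "U > 0" using s by simp
  have K0: "K \<ge> 0" using K(1)[OF inW[OF \<Omega>(2)]] norm_ge_zero order_trans by blast
  have d0: "d \<ge> 0" using d norm_ge_zero order_trans by blast
  have n1: "n \<ge> 1" using n by (simp add: Suc_leI)
  have A0: "A \<ge> 4" using K0 m(1) by (simp add: A)
  have b0: "\<beta> \<ge> 32" using \<beta>(1) n1 by linarith
  have sig: "?\<sigma> > 0" using b k by (intro esym_pos) auto
  have hq: "hess_quot k (hessian u x0) = 1 / ?\<sigma>"
    unfolding b_def using k l(1) by (intro hess_quot_eigenbasis[OF e H]) (auto simp: less_imp_neq[symmetric])
  have sigm: "?\<sigma> \<le> 1 / m"
  proof -
    have "m \<le> 1 / ?\<sigma>" using m(2)[OF inW[OF \<Omega>(2)]] eqn[OF \<Omega>(2)] hq by simp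
    thus ?thesis using sig m(1) by (simp add: field_simps)
  qed
  let ?B = "(1 + 16 * n) * n * max 1 (1 / m)"
  have rest0: "0 \<le> \<beta> * n + (K * U + K * A * d * U + K * \<beta> * U) / m"
    using n1 K0 A0 b0 U0 d0 m(1) by (intro add_nonneg_nonneg divide_nonneg_pos mult_nonneg_nonneg) auto
  show ?thesis
  proof (cases "k = 1 \<or> b r \<le> ?B")
    case True
    have "b r \<le> ?B"
    proof (cases "k = 1")
      case True
      \<comment> \<open>For k = 1 the equation itself bounds \<open>b r\<close>, as sigma_1(b) = 1 /
        f <= 1 / m.\<close>
      have "b r \<le> sum b UNIV" by (rule member_le_sum) (use b in \<open>auto intro: less_imp_le\<close>)
      also have "\<dots> = ?\<sigma>" using True by (simp add: esym_1)
      also have "\<dots> \<le> max 1 (1 / m)" using sigm by simp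
      also have "\<dots> = 1 * max 1 (1 / m)" by simp
      also have "\<dots> \<le> ?B"
      proof (rule mult_right_mono)
        show "1 \<le> (1 + 16 * n) * n" using n1 mult_mono[of 1 "1 + 16 * n" 1 n] by simp
      qed simp
      finally show ?thesis .
    qed (use True in simp)
    hence "s * b r \<le> U * ?B" using s b(1)[of r] U0 by (intro mult_mono) (auto intro: less_imp_le)
    thus ?thesis using rest0 by (simp add: s_def b_def)
  next
    case False
    hence k2: "2 \<le> ?K" "?K < int (card (UNIV :: 'n set))" and large: "?B \<le> b r" using k by auto
    have fin: "finite (UNIV :: 'n set)" by simp
    note ctx = fin UNIV_I b(1) k2 n sigm large
    have br1: "b r \<ge> 1" by (rule large_bounds(3)[OF ctx])
    define X where "X i j = partials [e r, e i, e j] u x0" for i j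
    define Z where "Z i j = partials [e r, e r, e i, e j] u x0" for i j
    have Xsym: "X i j = X j i" for i j
      unfolding X_def using partials_perm[OF u \<Omega>(1), of "[e r, e i, e j]" "[e r, e j, e i]", OF _ _ \<Omega>(2)] by simp
    let ?x = "\<lambda>t. x0 + t *\<^sub>R e r"
    have ev: "\<forall>\<^sub>F t in nhds 0. ?x t \<in> \<Omega>" by (rule line_eventually_in_open[OF \<Omega>(1,2)])
    have J: "jet2 (\<lambda>t. e i \<bullet> (hessian u (?x t) *v e j)) (if i = j then l i else 0) (X i j) (Z i j)" for i j
    proof -
      have "jet2 (\<lambda>t. partials [e i, e j] u (?x t)) (if i = j then l i else 0) (X i j) (Z i j)"
        using jet2_partials[OF u \<Omega>(1), of "[e i, e j]" x0 "e r"] \<Omega>(2)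
        unfolding X_def Z_def second_partials[OF \<Omega>(1,2) u e H, symmetric] by simp
      moreover have "\<forall>\<^sub>F t in nhds 0. partials [e i, e j] u (?x t) = e i \<bullet> (hessian u (?x t) *v e j)"
        by (rule eventually_mono[OF ev]) (rule partials_eq_hessian[OF u \<Omega>(1)], simp_all)
      ultimately show ?thesis by (rule jet2_cong)
    qed
    have symm: "\<forall>\<^sub>F t in nhds 0. transpose (hessian u (?x t)) = hessian u (?x t)"
      by (rule eventually_mono[OF ev]) (rule hessian_symmetric[OF u \<Omega>(1)], simp_all)
    define S where "S i = esym (?K - 1) (UNIV - {i}) b / ?\<sigma>" for i
    define G where "G i = (b i)\<^sup>2 * S i" for i
    define D where "D = (\<Sum>i\<in>UNIV. \<Sum>j\<in>UNIV-{i}. (X i i * X j j - (X i j)\<^sup>2) * (b i * b j * (1 - esym ?K (UNIV - {i} - {j}) b / ?\<sigma>)))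
      - (\<Sum>i\<in>UNIV. b i * X i i)\<^sup>2 + (\<Sum>i\<in>UNIV. X i i * (b i * (esym ?K (UNIV - {i}) b / ?\<sigma>)))\<^sup>2"
    have bfun: "(\<lambda>i. 1 / l i) = b" by (simp add: b_def fun_eq_iff)
    obtain g1 g2 where g: "jet2 (\<lambda>t. hess_quot k (hessian u (?x t))) (1 / ?\<sigma>) g1 g2"
      and "?\<sigma> * g1 = (\<Sum>i\<in>UNIV. G i * X i i)"
      and g2: "?\<sigma> * g2 = (\<Sum>i\<in>UNIV. G i * Z i i) + D + (\<Sum>i\<in>UNIV. G i * X i i)\<^sup>2"
      by (rule jet2_hess_quot[OF e symm J l(1) less_imp_le[OF k(2)] Xsym, unfolded bfun, folded b_def, folded S_def, folded G_def D_def])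
    have G0: "G i \<ge> 0" for i
      unfolding G_def S_def using sig b by (intro mult_nonneg_nonneg divide_nonneg_pos esym_nonneg) (auto intro: less_imp_le)
    have T: "- 2 * (\<Sum>i\<in>UNIV. \<Sum>j\<in>UNIV-{r}. G i * (X i j)\<^sup>2 * (b j * (b r + b j))) - (\<Sum>i\<in>UNIV. G i * (b r * X i r)\<^sup>2)
      \<le> b r * D - 1 / (16 * n) * (\<Sum>i\<in>UNIV. G i * (b r * X i r)\<^sup>2) + b r * (\<Sum>i\<in>UNIV. G i * X i i)\<^sup>2"
      using third_order_estimate[OF ctx Xsym] unfolding G_def S_def D_def .
    define c0 where "c0 = 1 / (16 * n)"
    have c0: "c0 > 0" using n1 by (simp add: c0_def)
    define q where "q i = partials [e i] u x0 / u x0" for i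
    define y where "y i = (x0 - p) \<bullet> e i" for i
    define \<theta> where "\<theta> x = \<beta> * ln (- u x) + A / 2 * ((x - p) \<bullet> (x - p))" for x
    define \<theta>1 where "\<theta>1 i = \<beta> * q i + A * y i" for i
    define \<theta>2 where "\<theta>2 i = \<beta> * (l i / u x0 - (q i)\<^sup>2) + A" for i
    have u0: "u x0 \<noteq> 0" using s by (simp add: s_def)
    have J\<theta>: "jet2 (\<lambda>t. \<theta> (x0 + t *\<^sub>R e i)) (\<theta> x0) (\<theta>1 i) (\<theta>2 i)" for i
    proof -
      have Ju: "jet2 (\<lambda>t. u (x0 + t *\<^sub>R e i)) (u x0) (partials [e i] u x0) (l i)"
        using jet2_partials[OF u \<Omega>(1), of "[]" x0 "e i"] \<Omega>(2) second_partials[OF \<Omega>(1,2) u e H, of i i] by simp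
      have 1: "jet2 (\<lambda>t. \<beta> * ln ((-1) * u (x0 + t *\<^sub>R e i)) + A / 2 * (((x0 - p) \<bullet> (x0 - p) + t * (2 * y i)) + (0 + t * 1) * (0 + t * 1)))
        (\<beta> * ln ((-1) * u x0) + A / 2 * ((x0 - p) \<bullet> (x0 - p) + 0 * 0))
        (\<beta> * (((-1) * partials [e i] u x0) / ((-1) * u x0)) + A / 2 * (2 * y i + (1 * 0 + 0 * 1)))
        (\<beta> * (((-1) * l i) / ((-1) * u x0) - (((-1) * partials [e i] u x0) / ((-1) * u x0))\<^sup>2) + A / 2 * (0 + (0 * 0 + 2 * 1 * 1 + 0 * 0)))"
        using s by (intro jet2_add jet2_cmult jet2_ln jet2_mult jet2_linear Ju) (simp add: s_def)
      have th: "\<theta> (x0 + t *\<^sub>R e i) = \<beta> * ln ((-1) * u (x0 + t *\<^sub>R e i)) + A / 2 * (((x0 - p) \<bullet> (x0 - p) + t * (2 * y i)) + (0 + t * 1) * (0 + t * 1))" for t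
      proof -
        have gen: "(z + t *\<^sub>R v) \<bullet> (z + t *\<^sub>R v) = (z \<bullet> z + t * (2 * (z \<bullet> v))) + (0 + t * 1) * (0 + t * 1)"
          if "v \<bullet> v = 1" for z v :: "real^'n"
          using that by (simp add: inner_add_left inner_add_right inner_commute[of v z] algebra_simps)
        have ee: "e i \<bullet> e i = 1" using eigenbasis_inner[OF \<Omega>(1,2) u e H, of i i] by simp
        have sh: "x0 + t *\<^sub>R e i - p = (x0 - p) + t *\<^sub>R e i" by (simp add: algebra_simps)
        show ?thesis unfolding \<theta>_def sh gen[OF ee] y_def by simp
      qed
      have v0: "\<theta> x0 = \<beta> * ln ((-1) * u x0) + A / 2 * ((x0 - p) \<bullet> (x0 - p) + 0 * 0)"
        by (simp add: \<theta>_def)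
      have v1: "\<theta>1 i = \<beta> * (((-1) * partials [e i] u x0) / ((-1) * u x0)) + A / 2 * (2 * y i + (1 * 0 + 0 * 1))"
        by (simp add: \<theta>1_def q_def del: partials.simps)
      have v2: "\<theta>2 i = \<beta> * (((-1) * l i) / ((-1) * u x0) - (((-1) * partials [e i] u x0) / ((-1) * u x0))\<^sup>2) + A / 2 * (0 + (0 * 0 + 2 * 1 * 1 + 0 * 0))"
        by (simp add: \<theta>2_def q_def del: partials.simps)
      show ?thesis unfolding th v0 v1 v2 by (rule 1)
    qed
    note MX = maximum_second_derivative[OF \<Omega>(1,2) u e H max[folded \<theta>_def] eq[folded \<theta>_def] l(1) J\<theta>]
    have mx1: "X i r = l r * \<theta>1 i" for i unfolding X_def by (rule MX(1))
    have mx2: "0 \<le> Z i i - 2 * (\<Sum>j\<in>UNIV-{r}. (X i j)\<^sup>2 * (1 / l j * (1 + l r * (1 / l j)))) - l r * (\<theta>2 i + (\<theta>1 i)\<^sup>2)" for i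
      unfolding X_def Z_def by (rule MX(2))
    \<comment> \<open>Criticality at the maximum. It expresses the third derivatives
      \<open>X i r\<close> by first-order quantities, both in the gain of the third-order estimate
      and in the derivative of f.\<close>
    have X\<theta>: "b r * X i r = \<theta>1 i" for i
      unfolding mx1 using b(2)[of r] by (simp add: mult.assoc[symmetric])
    have I2: "G i * \<theta>2 i \<le> b r * (G i * Z i i) - 2 * (\<Sum>j\<in>UNIV-{r}. G i * (X i j)\<^sup>2 * (b j * (b r + b j))) - G i * (\<theta>1 i)\<^sup>2" for i
    proof -
      have "0 \<le> (b r * G i) * (Z i i - 2 * (\<Sum>j\<in>UNIV-{r}. (X i j)\<^sup>2 * (1 / l j * (1 + l r * (1 / l j)))) - l r * (\<theta>2 i + (\<theta>1 i)\<^sup>2))"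
        using mx2[of i] G0[of i] b(1)[of r] by (intro mult_nonneg_nonneg) auto
      also have "\<dots> = b r * (G i * Z i i) - 2 * (b r * G i * (\<Sum>j\<in>UNIV-{r}. (X i j)\<^sup>2 * (1 / l j * (1 + l r * (1 / l j))))) - (b r * l r) * (G i * (\<theta>2 i + (\<theta>1 i)\<^sup>2))"
        by (simp add: algebra_simps)
      also have "b r * G i * (\<Sum>j\<in>UNIV-{r}. (X i j)\<^sup>2 * (1 / l j * (1 + l r * (1 / l j)))) = (\<Sum>j\<in>UNIV-{r}. G i * (X i j)\<^sup>2 * (b j * (b r + b j)))"
      proof -
        have "b r * (1 + l r * b j) = b r + b j" for j using b(2)[of r] by (simp add: distrib_left mult.assoc[symmetric])
        hence tm: "b r * G i * ((X i j)\<^sup>2 * (b j * (1 + l r * b j))) = G i * (X i j)\<^sup>2 * (b j * (b r + b j))" for j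
          by (metis (no_types, opaque_lifting) mult.assoc mult.left_commute)
        show ?thesis unfolding sum_distrib_left b_def[symmetric] tm ..
      qed
      finally show ?thesis using b(2)[of r] by (simp add: algebra_simps)
    qed
    \<comment> \<open>The square of the sum of G i X i i, a multiple of the squared derivative of f,
      occurs in \<open>T\<close> and in \<open>g2\<close> and cancels; third derivatives survive
      only in the gain c0 and inside g2.\<close>
    have E1: "(\<Sum>i\<in>UNIV. G i * \<theta>2 i) \<le> b r * (?\<sigma> * g2) - c0 * (\<Sum>i\<in>UNIV. G i * (\<theta>1 i)\<^sup>2)"
    proof -
      have "(\<Sum>i\<in>UNIV. G i * \<theta>2 i) \<le> (\<Sum>i\<in>UNIV. b r * (G i * Z i i) - 2 * (\<Sum>j\<in>UNIV-{r}. G i * (X i j)\<^sup>2 * (b j * (b r + b j))) - G i * (\<theta>1 i)\<^sup>2)"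
        by (intro sum_mono I2)
      also have "\<dots> = b r * (\<Sum>i\<in>UNIV. G i * Z i i) - 2 * (\<Sum>i\<in>UNIV. \<Sum>j\<in>UNIV-{r}. G i * (X i j)\<^sup>2 * (b j * (b r + b j))) - (\<Sum>i\<in>UNIV. G i * (\<theta>1 i)\<^sup>2)"
        by (simp only: sum_subtractf sum_distrib_left)
      finally show ?thesis using T unfolding X\<theta> g2 c0_def by (simp add: algebra_simps)
    qed
    \<comment> \<open>Euler's identity again: the terms \<beta> l i / u x0 of \<theta>2 sum to -
      \<beta> k / s without any bound on D^2u.\<close>
    have Gl: "(\<Sum>i\<in>UNIV. G i * l i) = k"
    proof -
      have "(\<Sum>i\<in>UNIV. G i * l i) = (\<Sum>i\<in>UNIV. b i * esym (?K - 1) (UNIV - {i}) b / ?\<sigma>)"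
        by (intro sum.cong refl) (simp add: G_def S_def power2_eq_square mult.assoc b(2) mult.left_commute[of _ _ "l _"])
      also have "\<dots> = k" using esym_euler[of UNIV b ?K] sig by (simp add: sum_divide_distrib[symmetric])
      finally show ?thesis .
    qed
    define SG where "SG = (\<Sum>i\<in>UNIV. G i)"
    \<comment> \<open>Uses \<beta> q i = \<theta>1 i - A y i. The gain absorbs the first part
      because \<beta> c0 >= 2, and by \<beta> >= 4 A d^2 the second part uses up at most half of the
      A in \<theta>2.\<close>
    have pw: "\<beta> * (q i)\<^sup>2 \<le> c0 * (\<theta>1 i)\<^sup>2 + A / 2" for i
    proof -
      have bp: "\<beta> > 0" using b0 by simp
      have "(\<beta> * q i)\<^sup>2 \<le> 2 * (\<theta>1 i)\<^sup>2 + 2 * (A * y i)\<^sup>2"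
        unfolding \<theta>1_def using zero_le_power2[of "\<beta> * q i + 2 * (A * y i)"] by (simp add: power2_eq_square algebra_simps)
      moreover have "(A * y i)\<^sup>2 \<le> A\<^sup>2 * d\<^sup>2"
      proof -
        have "\<bar>y i\<bar> \<le> norm (x0 - p) * norm (e i)" unfolding y_def by (rule Cauchy_Schwarz_ineq2)
        also have "norm (e i) = 1" using eigenbasis_inner[OF \<Omega>(1,2) u e H, of i i] by (simp add: norm_eq_sqrt_inner)
        finally have "\<bar>y i\<bar> \<le> d" using d by simp
        hence "(y i)\<^sup>2 \<le> d\<^sup>2" using d0 by (simp add: abs_le_square_iff[symmetric])
        thus ?thesis unfolding power_mult_distrib by (intro mult_left_mono) auto
      qed
      ultimately have "\<beta> * (\<beta> * (q i)\<^sup>2) \<le> 2 * (\<theta>1 i)\<^sup>2 + 2 * (A\<^sup>2 * d\<^sup>2)" by (simp add: power2_eq_square mult_ac)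
      also have "\<dots> \<le> \<beta> * (c0 * (\<theta>1 i)\<^sup>2) + \<beta> * (A / 2)"
      proof (rule add_mono)
        have "2 \<le> \<beta> * c0" using \<beta>(1) n1 by (simp add: c0_def field_simps)
        thus "2 * (\<theta>1 i)\<^sup>2 \<le> \<beta> * (c0 * (\<theta>1 i)\<^sup>2)" unfolding mult.assoc[symmetric] by (intro mult_right_mono) auto
        have "4 * A * d\<^sup>2 * (A / 2) \<le> \<beta> * (A / 2)" using \<beta>(2) A0 by (intro mult_right_mono) auto
        thus "2 * (A\<^sup>2 * d\<^sup>2) \<le> \<beta> * (A / 2)" by (simp add: power2_eq_square mult_ac)
      qed
      finally have "\<beta> * (\<beta> * (q i)\<^sup>2) \<le> \<beta> * (c0 * (\<theta>1 i)\<^sup>2 + A / 2)" by (simp add: distrib_left)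
      thus ?thesis using bp by (simp add: mult_le_cancel_left_pos)
    qed
    have E2: "A / 2 * SG \<le> \<beta> * k / s + b r * (?\<sigma> * g2)"
    proof -
      have "(\<Sum>i\<in>UNIV. G i * \<theta>2 i) = \<beta> / u x0 * (\<Sum>i\<in>UNIV. G i * l i) - (\<Sum>i\<in>UNIV. G i * (\<beta> * (q i)\<^sup>2)) + A * SG"
        unfolding \<theta>2_def SG_def sum_distrib_left sum_subtractf[symmetric] sum.distrib[symmetric]
        by (intro sum.cong refl) (simp add: algebra_simps)
      moreover have "(\<Sum>i\<in>UNIV. G i * (\<beta> * (q i)\<^sup>2)) \<le> (\<Sum>i\<in>UNIV. G i * (c0 * (\<theta>1 i)\<^sup>2 + A / 2))"
        using G0 pw by (intro sum_mono mult_left_mono) auto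
      moreover have "(\<Sum>i\<in>UNIV. G i * (c0 * (\<theta>1 i)\<^sup>2 + A / 2)) = c0 * (\<Sum>i\<in>UNIV. G i * (\<theta>1 i)\<^sup>2) + A / 2 * SG"
        unfolding SG_def by (simp add: distrib_left sum.distrib sum_distrib_left mult_ac)
      moreover have "\<beta> / u x0 * k = - (\<beta> * k / s)" by (simp add: s_def)
      ultimately show ?thesis using E1 unfolding Gl by simp
    qed
    have SG: "b r / 2 \<le> SG"
    proof -
      have "b r * S r \<ge> 1 / 2" unfolding S_def by (rule top_derivative_ge[OF ctx])
      hence "b r * (1 / 2) \<le> b r * (b r * S r)" using b(1)[of r] by (intro mult_left_mono) auto
      also have "\<dots> = G r" by (simp add: G_def power2_eq_square)
      also have "\<dots> \<le> SG" unfolding SG_def by (rule member_le_sum) (use G0 in auto)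
      finally show ?thesis by simp
    qed
    obtain \<alpha> \<gamma> \<pi> where gf: "grad f (x0, u x0, grad u x0) = (\<alpha>, \<gamma>, \<pi>)" by (cases "grad f (x0, u x0, grad u x0)")
    have gK: "\<bar>\<gamma>\<bar> \<le> K" "norm \<pi> \<le> K"
    proof -
      have "norm (\<alpha>, \<gamma>, \<pi>) \<le> K" using K(1)[OF inW[OF \<Omega>(2)]] gf by simp
      moreover have "norm (\<gamma>, \<pi>) \<le> norm (\<alpha>, \<gamma>, \<pi>)" by (rule norm_snd_le)
      moreover have "norm \<gamma> \<le> norm (\<gamma>, \<pi>)" "norm \<pi> \<le> norm (\<gamma>, \<pi>)" by (rule norm_fst_le, rule norm_snd_le)
      ultimately show "\<bar>\<gamma>\<bar> \<le> K" "norm \<pi> \<le> K" by auto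
    qed
    \<comment> \<open>The differentiated equation: the jet of the quotient is also that of the
      right-hand side, so the bound from f applies to the same g2.\<close>
    have g': "jet2 (\<lambda>t. f (?x t, u (?x t), grad u (?x t))) (1 / ?\<sigma>) g1 g2"
      by (rule jet2_cong[OF g eventually_mono[OF ev eqn]])
    have g2le: "g2 \<le> \<gamma> * l r + partials [e r, e r, \<pi>] u x0 + 2 * K * (1 + (partials [e r] u x0)\<^sup>2 + (l r)\<^sup>2)"
      using bd UM by (intro rhs_second_derivative_bound[OF \<Omega>(1,2) u e H f \<Omega>(3) _ _ K(2) g' gf]) (auto intro: order_trans)
    \<comment> \<open>The third derivatives left in the bound for g2 are those of u_rr along \<pi>,
      the p-gradient of f. Criticality turns b r times them into gradient terms with factors \<beta>
      / u x0 and A.\<close>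
    have third: "b r * partials [e r, e r, \<pi>] u x0 = \<beta> * (grad u x0 \<bullet> \<pi>) / u x0 + A * ((x0 - p) \<bullet> \<pi>)"
    proof -
      have \<pi>: "\<pi> = (\<Sum>i\<in>UNIV. (\<pi> \<bullet> e i) *\<^sub>R e i)" by (rule orthonormal_expand[OF e])
      have "partials [e r, e r, \<pi>] u x0 = partials [\<pi>, e r, e r] u x0"
        using partials_perm[OF u \<Omega>(1), of "[e r, e r, \<pi>]" "[\<pi>, e r, e r]", OF _ _ \<Omega>(2)] by simp
      also have "\<dots> = (\<Sum>i\<in>UNIV. (\<pi> \<bullet> e i) * partials [e i, e r, e r] u x0)"
        using partials_Cons_sum[OF u \<Omega>(1), of "[e r, e r]" x0 "\<lambda>i. \<pi> \<bullet> e i" e UNIV] \<Omega>(2) \<pi> by simp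
      also have "\<dots> = (\<Sum>i\<in>UNIV. (\<pi> \<bullet> e i) * X i r)"
      proof -
        have "partials [e i, e r, e r] u x0 = X i r" for i
          unfolding X_def using partials_perm[OF u \<Omega>(1), of "[e i, e r, e r]" "[e r, e i, e r]", OF _ _ \<Omega>(2)] by simp
        thus ?thesis by simp
      qed
      finally have "b r * partials [e r, e r, \<pi>] u x0 = (\<Sum>i\<in>UNIV. (\<pi> \<bullet> e i) * \<theta>1 i)"
        by (simp add: sum_distrib_left X\<theta>[symmetric] mult_ac del: partials.simps)
      also have "\<dots> = \<beta> / u x0 * (\<Sum>i\<in>UNIV. (grad u x0 \<bullet> e i) * (\<pi> \<bullet> e i)) + A * (\<Sum>i\<in>UNIV. ((x0 - p) \<bullet> e i) * (\<pi> \<bullet> e i))"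
      proof -
        have gu: "grad u x0 \<bullet> e i = partials [e i] u x0" for i using inner_grad[OF u \<Omega>(1) _ \<Omega>(2)] by simp
        show ?thesis unfolding gu sum_distrib_left sum.distrib[symmetric] \<theta>1_def q_def y_def
          by (intro sum.cong refl) (simp add: algebra_simps del: partials.simps)
      qed
      finally show ?thesis unfolding orthonormal_inner_expand[OF e, symmetric] by simp
    qed
    define Q where "Q = K + (\<beta> * (U * K) / s + A * (d * K)) + 2 * K * (2 + U\<^sup>2) * b r"
    have Qg: "b r * g2 \<le> Q"
    proof -
      have "b r * g2 \<le> b r * (\<gamma> * l r + partials [e r, e r, \<pi>] u x0 + 2 * K * (1 + (partials [e r] u x0)\<^sup>2 + (l r)\<^sup>2))"
        using g2le b(1)[of r] by (intro mult_left_mono) auto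
      also have "\<dots> = \<gamma> * (b r * l r) + b r * partials [e r, e r, \<pi>] u x0 + 2 * K * (1 + (partials [e r] u x0)\<^sup>2 + (l r)\<^sup>2) * b r"
        by (simp add: algebra_simps del: partials.simps)
      also have "\<dots> \<le> Q" unfolding Q_def
      proof (rule add_mono[OF add_mono])
        show "\<gamma> * (b r * l r) \<le> K" using gK(1) b(2)[of r] by simp
        have "\<bar>grad u x0 \<bullet> \<pi>\<bar> \<le> U * K"
          using bd(2)[OF \<Omega>(2)] gK(2) U0 by (intro order_trans[OF Cauchy_Schwarz_ineq2] mult_mono) auto
        hence "\<beta> / s * - (grad u x0 \<bullet> \<pi>) \<le> \<beta> / s * (U * K)" using b0 s by (intro mult_left_mono) auto
        moreover have "\<bar>(x0 - p) \<bullet> \<pi>\<bar> \<le> d * K"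
          using d gK(2) d0 by (intro order_trans[OF Cauchy_Schwarz_ineq2] mult_mono) auto
        hence "A * ((x0 - p) \<bullet> \<pi>) \<le> A * (d * K)" using A0 by (intro mult_left_mono) auto
        ultimately show "b r * partials [e r, e r, \<pi>] u x0 \<le> \<beta> * (U * K) / s + A * (d * K)"
          unfolding third by (simp add: s_def)
        have "(partials [e r] u x0)\<^sup>2 \<le> U\<^sup>2"
        proof -
          have "partials [e r] u x0 = grad u x0 \<bullet> e r" using inner_grad[OF u \<Omega>(1) _ \<Omega>(2), of "e r"] by simp
          moreover have "\<bar>grad u x0 \<bullet> e r\<bar> \<le> norm (grad u x0) * norm (e r)" by (rule Cauchy_Schwarz_ineq2)
          moreover have "norm (e r) = 1" using eigenbasis_inner[OF \<Omega>(1,2) u e H, of r r] by (simp add: norm_eq_sqrt_inner)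
          ultimately have "\<bar>partials [e r] u x0\<bar> \<le> U" using bd(2)[OF \<Omega>(2)] by simp
          thus ?thesis using U0 by (simp add: abs_le_square_iff[symmetric])
        qed
        moreover have "(l r)\<^sup>2 \<le> 1"
        proof -
          have "l r \<le> 1" using b(2)[of r] br1 l(1)[of r] by (metis less_imp_le mult_le_cancel_right1 not_le)
          thus ?thesis using l(1)[of r] by (intro power_le_one) auto
        qed
        ultimately have "1 + (partials [e r] u x0)\<^sup>2 + (l r)\<^sup>2 \<le> 2 + U\<^sup>2" by linarith
        thus "2 * K * (1 + (partials [e r] u x0)\<^sup>2 + (l r)\<^sup>2) * b r \<le> 2 * K * (2 + U\<^sup>2) * b r"
          using K0 b(1)[of r] by (intro mult_right_mono mult_left_mono) auto
      qed
      finally show ?thesis .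
    qed
    have Q0: "Q \<ge> 0" unfolding Q_def using K0 b0 U0 s A0 d0 b(1)[of r]
      by (intro add_nonneg_nonneg mult_nonneg_nonneg divide_nonneg_pos) auto
    have "b r * (?\<sigma> * g2) = ?\<sigma> * (b r * g2)" by simp
    also have "\<dots> \<le> ?\<sigma> * Q" using Qg sig by (intro mult_left_mono) auto
    also have "\<dots> \<le> 1 / m * Q" using sigm Q0 by (intro mult_right_mono) auto
    finally have gQ: "b r * (?\<sigma> * g2) \<le> Q / m" by simp
    have "A / 2 * (b r / 2) \<le> A / 2 * SG" using SG A0 by (intro mult_left_mono) auto
    also have "\<dots> \<le> \<beta> * k / s + Q / m" using E2 gQ by linarith
    also have "\<dots> \<le> \<beta> * n / s + Q / m"
    proof -
      have "real k \<le> n" using k n by simp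
      hence "\<beta> * k / s \<le> \<beta> * n / s" using b0 s by (intro divide_right_mono mult_left_mono) auto
      thus ?thesis by simp
    qed
    also have "Q / m = (K + \<beta> * (U * K) / s + A * (d * K)) / m + (2 * K * (2 + U\<^sup>2) / m) * b r"
      unfolding Q_def using m(1) by (simp add: add_divide_distrib)
    finally have "A / 2 * (b r / 2) \<le> \<beta> * n / s + ((K + \<beta> * (U * K) / s + A * (d * K)) / m + (2 * K * (2 + U\<^sup>2) / m) * b r)" .
    \<comment> \<open>This dictates the value of A: the terms of f that grow like b r cancel
      exactly, and one b r is left over.\<close>
    moreover have "A / 2 * (b r / 2) = (2 * K * (2 + U\<^sup>2) / m) * b r + b r"
    proof -
      have "A / 2 * (b r / 2) = A / 4 * b r" by simp
      also have "A / 4 = 2 * K * (2 + U\<^sup>2) / m + 1" by (simp add: A)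
      finally show ?thesis by (simp only: distrib_right mult_1)
    qed
    ultimately have "b r \<le> \<beta> * n / s + (K + \<beta> * (U * K) / s + A * (d * K)) / m" by linarith
    hence "s * b r \<le> s * (\<beta> * n / s + (K + \<beta> * (U * K) / s + A * (d * K)) / m)"
      using s by (intro mult_left_mono) auto
    also have "\<dots> = \<beta> * n + (s * K + \<beta> * (U * K) + s * (A * (d * K))) / m"
    proof -
      have h1: "s * (\<beta> * n / s) = \<beta> * n" using s by simp
      have h2: "s * (K + \<beta> * (U * K) / s + A * (d * K)) = s * K + \<beta> * (U * K) + s * (A * (d * K))"
        using s by (simp add: distrib_left)
      have "s * (v + w / m) = s * v + s * w / m" for v w by (simp add: distrib_left)
      thus ?thesis unfolding h2[symmetric] using h1 by simp
    qed
    also have "\<dots> \<le> \<beta> * n + (U * K + \<beta> * (U * K) + U * (A * (d * K))) / m"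
      using s K0 A0 d0 m(1) by (intro add_left_mono divide_right_mono add_mono mult_right_mono) auto
    also have "\<dots> = \<beta> * n + (K * U + K * A * d * U + K * \<beta> * U) / m" by (simp add: mult_ac add_ac)
    also have "\<dots> \<le> \<beta> * n + (K * U + K * A * d * U + K * \<beta> * U) / m + U * ?B" using U0 n1 by simp
    finally show ?thesis by (simp add: s_def b_def)
  qed
qed

section \<open>Existence of the maximum and conclusion\<close>

text \<open>The symmetric second difference of a convex function is nonnegative and vanishes at t =
  0.\<close>

lemma hessian_nonneg:
  fixes u :: "real^'n \<Rightarrow> real"
  assumes u: "Ck_on k \<Omega> u" "2 \<le> k" and \<Omega>: "open \<Omega>" "x \<in> \<Omega>" and c: "convex_on \<Omega> u"
  shows "0 \<le> v \<bullet> (hessian u x *v v)"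
proof -
  have J: "jet2 (\<lambda>t. u (x + t *\<^sub>R v)) (u x) (partials [v] u x) (partials [v, v] u x)"
    using jet2_partials[OF u(1) \<Omega>(1), of "[]" x v] u(2) \<Omega>(2) by simp
  have "jet2 (\<lambda>t. (u (x + t *\<^sub>R v) + u (x + (- t) *\<^sub>R v)) + (- 2 * u x)) ((u x + u x) + (- 2 * u x))
    ((partials [v] u x + - partials [v] u x) + 0) ((partials [v, v] u x + partials [v, v] u x) + 0)"
    by (intro jet2_add jet2_const J jet2_reflect[OF J])
  hence J2: "jet2 (\<lambda>t. (u (x + t *\<^sub>R v) + u (x + (- t) *\<^sub>R v)) + (- 2 * u x)) 0 0 (2 * partials [v, v] u x)"
    by (simp del: partials.simps)
  have ev: "\<forall>\<^sub>F t in nhds 0. x + t *\<^sub>R v \<in> \<Omega> \<and> x + t *\<^sub>R (- v) \<in> \<Omega>"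
    by (intro eventually_conj line_eventually_in_open \<Omega>)
  have "\<forall>\<^sub>F t in nhds 0. (u (x + t *\<^sub>R v) + u (x + (- t) *\<^sub>R v)) + (- 2 * u x) \<ge> 0"
  proof (rule eventually_mono[OF ev])
    fix t assume t: "x + t *\<^sub>R v \<in> \<Omega> \<and> x + t *\<^sub>R (- v) \<in> \<Omega>"
    have h: "(1/2) *\<^sub>R z + (1/2) *\<^sub>R z = z" for z :: "real^'n"
      by (simp add: scaleR_add_left[symmetric])
    have "(1 - 1/2) *\<^sub>R (x + t *\<^sub>R v) + (1/2) *\<^sub>R (x + t *\<^sub>R (- v)) = x"
    proof -
      have "(1 - 1/2) *\<^sub>R (x + t *\<^sub>R v) + (1/2) *\<^sub>R (x + t *\<^sub>R (- v)) = (1/2) *\<^sub>R x + (1/2) *\<^sub>R x"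
        by (simp add: scaleR_add_right scaleR_diff_right)
      thus ?thesis unfolding h .
    qed
    with convex_onD[OF c, of "1/2" "x + t *\<^sub>R v" "x + t *\<^sub>R (- v)"] t
    show "(u (x + t *\<^sub>R v) + u (x + (- t) *\<^sub>R v)) + (- 2 * u x) \<ge> 0" by simp
  qed
  from jet2_nonneg(2)[OF J2 this] show ?thesis
    using partials_eq_hessian[OF u(1) \<Omega>(1) u(2) \<Omega>(2), of v v] by simp
qed

text \<open>Upgrades the nonnegative eigenvalues of a convex solution to positive ones: a zero
  eigenvalue makes sigma_n and hence the quotient zero, also when the denominator vanishes, since 0
  / 0 = 0.\<close>

lemma hess_quot_nonzero_eigenvalues:
  fixes B :: "real^'n^'n"
  assumes "orthonormal_family e" "\<And>i. B *v e i = l i *\<^sub>R e i" "hess_quot k B \<noteq> 0"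
  shows "l i \<noteq> 0"
proof
  assume "l i = 0"
  hence "prod l UNIV = 0" by (auto intro!: prod_zero)
  moreover have "sigma CARD('n) B = prod l UNIV"
    unfolding sigma_eigenbasis[OF assms(1,2)] using esym_card[of "UNIV :: 'n set" l] by simp
  ultimately show False using assms(3) by (simp add: hess_quot_def)
qed

lemma quadratic_form_eigenbasis:
  fixes B :: "real^'n^'n"
  assumes e: "orthonormal_family e" and B: "\<And>i. B *v e i = l i *\<^sub>R e i"
  shows "v \<bullet> (B *v v) = (\<Sum>i\<in>UNIV. l i * (v \<bullet> e i)\<^sup>2)"
proof -
  have "B *v v = B *v (\<Sum>i\<in>UNIV. (v \<bullet> e i) *\<^sub>R e i)" using orthonormal_expand[OF e, of v] by simp
  also have "\<dots> = (\<Sum>i\<in>UNIV. (v \<bullet> e i) *\<^sub>R (l i *\<^sub>R e i))"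
    unfolding linear_sum[OF matrix_vector_mul_linear] matrix_vector_mult_scaleR B ..
  finally show ?thesis by (simp add: inner_sum_right power2_eq_square mult_ac)
qed

lemma quadratic_form_ge:
  fixes B :: "real^'n^'n"
  assumes e: "orthonormal_family e" and B: "\<And>i. B *v e i = l i *\<^sub>R e i" and c: "\<And>i. c \<le> l i"
  shows "c * (v \<bullet> v) \<le> v \<bullet> (B *v v)"
proof -
  have "c * (v \<bullet> v) = (\<Sum>i\<in>UNIV. c * (v \<bullet> e i)\<^sup>2)"
    unfolding orthonormal_inner_expand[OF e, of v v] by (simp add: sum_distrib_left power2_eq_square)
  also have "\<dots> \<le> v \<bullet> (B *v v)"
    unfolding quadratic_form_eigenbasis[OF e B] using c by (intro sum_mono mult_right_mono) auto
  finally show ?thesis .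
qed

text \<open>A value u x >= 0 would force a maximum of u over the domain to be attained inside, where
  positivity of the Hessian forbids it.\<close>

lemma negative_of_zero_boundary:
  fixes u :: "real^'n \<Rightarrow> real"
  assumes u: "Ck_on k \<Omega> u" "2 \<le> k" "continuous_on (closure \<Omega>) u" "\<And>x. x \<in> frontier \<Omega> \<Longrightarrow> u x = 0"
    and \<Omega>: "open \<Omega>" "bounded \<Omega>"
    and pos: "\<And>x v. x \<in> \<Omega> \<Longrightarrow> v \<noteq> 0 \<Longrightarrow> 0 < v \<bullet> (hessian u x *v v)"
    and x: "x \<in> \<Omega>"
  shows "u x < 0"
proof (rule ccontr)
  assume nn: "\<not> u x < 0"
  have "compact (closure \<Omega>)" "closure \<Omega> \<noteq> {}" using \<Omega> x by (auto simp: compact_closure)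
  then obtain z where z: "z \<in> closure \<Omega>" "\<And>w. w \<in> closure \<Omega> \<Longrightarrow> u w \<le> u z"
    using continuous_attains_sup[OF _ _ u(3)] by blast
  obtain y where y: "y \<in> \<Omega>" "\<And>w. w \<in> \<Omega> \<Longrightarrow> u w \<le> u y"
  proof (cases "z \<in> \<Omega>")
    case True
    thus ?thesis using that[of z] z closure_subset[of \<Omega>] by blast
  next
    case False
    \<comment> \<open>A maximum over the closure that sits on the boundary is 0 <= u x, so x itself
      is then an interior maximum point.\<close>
    hence "u z = 0" using z(1) \<Omega>(1) u(4) by (simp add: frontier_def interior_open)
    hence "u w \<le> u x" if "w \<in> \<Omega>" for w using z(2)[of w] that nn closure_subset[of \<Omega>] by force
    thus ?thesis using that[of x] x by blast
  qed
  obtain v :: "real^'n" where v: "v \<in> Basis" using nonempty_Basis by blast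
  have J: "jet2 (\<lambda>t. u (y + t *\<^sub>R v)) (u y) (partials [v] u y) (partials [v, v] u y)"
    using jet2_partials[OF u(1) \<Omega>(1), of "[]" y v] u(2) y(1) by simp
  have "jet2 (\<lambda>t. u y + (-1) * u (y + t *\<^sub>R v)) (u y + (-1) * u y) (0 + (-1) * partials [v] u y) (0 + (-1) * partials [v, v] u y)"
    by (intro jet2_add jet2_const jet2_cmult J)
  hence J2: "jet2 (\<lambda>t. u y + (-1) * u (y + t *\<^sub>R v)) 0 ((-1) * partials [v] u y) ((-1) * partials [v, v] u y)" by simp
  have "\<forall>\<^sub>F t in nhds 0. u y + (-1) * u (y + t *\<^sub>R v) \<ge> 0"
    by (rule eventually_mono[OF line_eventually_in_open[OF \<Omega>(1) y(1), of v]]) (use y(2) in simp)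
  from jet2_nonneg(2)[OF J2 this] have "partials [v, v] u y \<le> 0" by (simp del: partials.simps)
  moreover have "partials [v, v] u y > 0"
    using pos[OF y(1), of v] v nonzero_Basis[OF v] partials_eq_hessian[OF u(1) \<Omega>(1) u(2) y(1), of v v] by simp
  ultimately show False by simp
qed

lemma esym_ge_power:
  assumes "finite I" "\<And>i. i \<in> I \<Longrightarrow> c \<le> b i" "0 \<le> c" "m \<le> card I"
  shows "c ^ m \<le> esym (int m) I b"
proof -
  obtain J where J: "J \<subseteq> I" "card J = m" using obtain_subset_with_card_n[OF assms(4)] by blast
  have b0: "0 \<le> b i" if "i \<in> I" for i using assms(2)[OF that] assms(3) by simp
  have "c ^ m = (\<Prod>i\<in>J. c)" using J by simp
  also have "\<dots> \<le> prod b J" using J assms by (intro prod_mono) auto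
  also have "\<dots> \<le> esym (int m) I b"
    unfolding esym_def
  proof (rule member_le_sum)
    show "finite {J. J \<subseteq> I \<and> int (card J) = int m}"
      by (rule finite_subset[of _ "Pow I"]) (use assms in auto)
  qed (use J b0 in \<open>auto intro!: prod_nonneg\<close>)
  finally show ?thesis .
qed

text \<open>With all reciprocals at least 1 / L, the single family of terms containing b r already
  gives b r (1 / L)^(k-1) <= sigma_k(b) <= 1 / m: an upper bound on the eigenvalues keeps the
  smallest one away from 0.\<close>

lemma eigenvalue_lower_bound:
  fixes l :: "'n::finite \<Rightarrow> real"
  assumes l: "\<And>i. 0 < l i" "\<And>i. l i \<le> L" and k: "1 \<le> k" "k \<le> CARD('n)"
    and m: "m > 0" "m \<le> 1 / esym (int k) UNIV (\<lambda>i. 1 / l i)"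
  shows "m * (1 / L) ^ (k - 1) \<le> l r"
proof -
  define b where "b i = 1 / l i" for i
  have b: "b i > 0" for i using l(1)[of i] by (simp add: b_def)
  have L: "L > 0" using l[of r] by linarith
  have bL: "1 / L \<le> b i" for i using l[of i] by (simp add: b_def frac_le)
  let ?\<sigma> = "esym (int k) UNIV b"
  have sig: "?\<sigma> > 0" using b k by (intro esym_pos) auto
  have "(1 / L) ^ (k - 1) \<le> esym (int (k - 1)) (UNIV - {r}) b"
    using k bL L by (intro esym_ge_power) (auto simp: card_Diff_singleton)
  hence "b r * (1 / L) ^ (k - 1) \<le> b r * esym (int (k - 1)) (UNIV - {r}) b"
    using b[of r] by (intro mult_left_mono) auto
  also have "\<dots> \<le> ?\<sigma>"
    using esym_remove[of UNIV r "int k" b] esym_nonneg[of "UNIV - {r}" b "int k"] k b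
    by (simp add: of_nat_diff less_imp_le)
  also have "?\<sigma> \<le> 1 / m" using m sig unfolding b_def by (simp add: field_simps)
  finally have "b r * (1 / L) ^ (k - 1) \<le> 1 / m" .
  moreover have "m * q \<le> l r" if "b r * q \<le> 1 / m" for q
    using that l(1)[of r] m(1) by (simp add: b_def field_simps)
  ultimately show ?thesis by blast
qed

lemma hessian_quadratic_form_continuous:
  fixes u :: "real^'n \<Rightarrow> real"
  assumes "Ck_on k \<Omega> u" "2 \<le> k"
  shows "continuous_on (\<Omega> \<times> S) (\<lambda>z. snd z \<bullet> (hessian u (fst z) *v snd z))"
proof -
  have c: "continuous_on (\<Omega> \<times> S) (\<lambda>z. partials [axis i 1, axis j 1] u (fst z))" for i j
  proof (rule continuous_on_compose2[OF _ continuous_on_fst[OF continuous_on_id]])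
    show "continuous_on \<Omega> (partials [axis i 1, axis j 1] u)"
      using assms(1)[unfolded Ck_on_def, rule_format, of "[axis i 1, axis j 1]"] assms(2)
      by (simp add: axis_in_Basis_iff del: partials.simps)
  qed auto
  have "(\<lambda>z. snd z \<bullet> (hessian u (fst z) *v snd z))
    = (\<lambda>z. \<Sum>i\<in>UNIV. snd z $ i * (\<Sum>j\<in>UNIV. partials [axis i 1, axis j 1] u (fst z) * snd z $ j))"
    by (simp add: inner_vec_def matrix_vector_mult_def hessian_def del: partials.simps)
  moreover have "continuous_on (\<Omega> \<times> S) \<dots>" by (intro continuous_intros c)
  ultimately show ?thesis by (simp only:)
qed

text \<open>The weight \<open>(- u)\<^sup>\<beta>\<close> vanishes on the boundary, so the supremum is attained inside once the
  smallest eigenvalue has some positive lower bound, however bad.\<close>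

lemma weighted_quotient_attains_max:
  fixes u :: "real^'n \<Rightarrow> real"
  assumes u: "Ck_on k \<Omega> u" "2 \<le> k" "continuous_on (closure \<Omega>) u" "\<And>x. x \<in> frontier \<Omega> \<Longrightarrow> u x = 0"
    and neg: "\<And>x. x \<in> \<Omega> \<Longrightarrow> u x < 0"
    and \<Omega>: "open \<Omega>" "\<Omega> \<noteq> {}" "bounded \<Omega>"
    and c0: "c0 > 0" "\<And>x v. x \<in> \<Omega> \<Longrightarrow> norm v = 1 \<Longrightarrow> c0 \<le> v \<bullet> (hessian u x *v v)"
    and \<beta>: "\<beta> > 0" and A: "A \<ge> 0" and d: "\<And>x. x \<in> \<Omega> \<Longrightarrow> (x - p) \<bullet> (x - p) \<le> d\<^sup>2"
  defines "\<Phi> \<equiv> \<lambda>x v. exp (\<beta> * ln (- u x) + A / 2 * ((x - p) \<bullet> (x - p))) / (v \<bullet> (hessian u x *v v))"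
  obtains x0 v0 where "x0 \<in> \<Omega>" "norm v0 = 1" "\<And>x v. x \<in> \<Omega> \<Longrightarrow> norm v = 1 \<Longrightarrow> \<Phi> x v \<le> \<Phi> x0 v0"
proof -
  obtain x1 where x1: "x1 \<in> \<Omega>" using \<Omega>(2) by blast
  obtain v1 :: "real^'n" where v1: "norm v1 = 1" using nonempty_Basis norm_Basis by blast
  define c where "c = \<Phi> x1 v1"
  have c: "c > 0" unfolding c_def \<Phi>_def using c0(1) c0(2)[OF x1 v1] by (intro divide_pos_pos) auto
  define E where "E = exp (A / 2 * d\<^sup>2)"
  \<comment> \<open>Chosen so that the weight is at most c c0 / 2 where - u < \<epsilon>. There
    \<Phi> is at most c / 2, below its value c at the reference pair, so the supremum may be sought
    on the compact set T times the sphere.\<close>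
  define \<epsilon> where "\<epsilon> = (c * c0 / (2 * E)) powr (1 / \<beta>)"
  have E: "E > 0" by (simp add: E_def)
  have eps: "\<epsilon> > 0" "\<epsilon> powr \<beta> = c * c0 / (2 * E)"
    using c c0(1) E \<beta> by (auto simp: \<epsilon>_def powr_powr)
  have small: "\<Phi> x v < c" if x: "x \<in> \<Omega>" and v: "norm v = 1" and "- u x < \<epsilon>" for x v
  proof -
    have un: "0 < - u x" using neg[OF x] by simp
    have "exp (\<beta> * ln (- u x) + A / 2 * ((x - p) \<bullet> (x - p))) = (- u x) powr \<beta> * exp (A / 2 * ((x - p) \<bullet> (x - p)))"
      using un by (simp add: powr_def exp_add)
    also have "\<dots> \<le> \<epsilon> powr \<beta> * E"
      unfolding E_def using un that(3) \<beta> A d[OF x] by (intro mult_mono powr_mono2) (auto intro: mult_left_mono)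
    also have "\<dots> = c * c0 / 2" using E unfolding eps(2) by simp
    finally have "\<Phi> x v \<le> (c * c0 / 2) / c0"
      unfolding \<Phi>_def using c0(1) c0(2)[OF x v] c by (intro frac_le) auto
    also have "\<dots> < c" using c c0(1) by simp
    finally show ?thesis .
  qed
  define T where "T = {x \<in> closure \<Omega>. \<epsilon> \<le> - u x}"
  have T\<Omega>: "T \<subseteq> \<Omega>"
  proof
    fix x assume x: "x \<in> T"
    show "x \<in> \<Omega>"
    proof (rule ccontr)
      assume "x \<notin> \<Omega>"
      hence "u x = 0" using x \<Omega>(1) u(4) by (simp add: T_def frontier_def interior_open)
      thus False using x eps(1) by (simp add: T_def)
    qed
  qed
  have "closed (closure \<Omega> \<inter> (\<lambda>x. - u x) -` {\<epsilon>..})"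
    by (intro continuous_closed_preimage continuous_on_minus u(3)) auto
  moreover have "T = closure \<Omega> \<inter> (\<lambda>x. - u x) -` {\<epsilon>..}" by (auto simp: T_def)
  ultimately have "closed T" by (simp only:)
  hence cT: "compact (T \<times> sphere (0::real^'n) 1)"
    using \<Omega>(3) by (intro compact_Times) (auto simp: compact_eq_bounded_closed T_def intro: bounded_subset[OF bounded_closure])
  have "x1 \<in> T" using small[OF x1 v1] x1 closure_subset[of \<Omega>] unfolding T_def c_def[symmetric]
    by (metis (mono_tags, lifting) c_def less_irrefl mem_Collect_eq not_le subsetD)
  hence ne: "T \<times> sphere (0::real^'n) 1 \<noteq> {}" using v1 by auto
  have cont: "continuous_on (T \<times> sphere 0 1) (\<lambda>z. \<Phi> (fst z) (snd z))"
  proof -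
    have sub: "T \<times> sphere 0 1 \<subseteq> \<Omega> \<times> sphere (0::real^'n) 1" using T\<Omega> by auto
    have cu: "continuous_on (T \<times> sphere (0::real^'n) 1) (\<lambda>z. u (fst z))"
      by (rule continuous_on_compose2[OF u(3) continuous_on_fst[OF continuous_on_id]]) (auto simp: T_def)
    show ?thesis unfolding \<Phi>_def
    proof (rule continuous_on_divide[OF _ continuous_on_subset[OF hessian_quadratic_form_continuous[OF u(1,2)] sub]])
      show "continuous_on (T \<times> sphere (0::real^'n) 1) (\<lambda>z. exp (\<beta> * ln (- u (fst z)) + A / 2 * ((fst z - p) \<bullet> (fst z - p))))"
        using eps(1) by (intro continuous_intros cu) (auto simp: T_def)
      show "\<forall>z\<in>T \<times> sphere (0::real^'n) 1. snd z \<bullet> (hessian u (fst z) *v snd z) \<noteq> 0"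
        using T\<Omega> c0 by fastforce
    qed
  qed
  obtain z where z: "z \<in> T \<times> sphere 0 1" "\<And>w. w \<in> T \<times> sphere 0 1 \<Longrightarrow> \<Phi> (fst w) (snd w) \<le> \<Phi> (fst z) (snd z)"
    using continuous_attains_sup[OF cT ne cont] by blast
  have cz: "c \<le> \<Phi> (fst z) (snd z)" using z(2)[of "(x1, v1)"] \<open>x1 \<in> T\<close> v1 by (simp add: c_def)
  show ?thesis
  proof (rule that[of "fst z" "snd z"])
    show "fst z \<in> \<Omega>" "norm (snd z) = 1" using z(1) T\<Omega> by auto
    fix x v assume xv: "x \<in> \<Omega>" "norm (v :: real^'n) = 1"
    show "\<Phi> x v \<le> \<Phi> (fst z) (snd z)"
    proof (cases "- u x < \<epsilon>")
      case True
      thus ?thesis using small[OF xv] cz by simp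
    next
      case False
      hence "x \<in> T" using xv(1) closure_subset[of \<Omega>] by (auto simp: T_def)
      thus ?thesis using z(2)[of "(x, v)"] xv by simp
    qed
  qed
qed

text \<open>The exponential weight is centred at the very point x where the bound is wanted, so it
  is 1 there and at most exp (A d^2 / 2) at the maximum point x0. One factor - u x0 goes into the
  maximum-point estimate; the remaining power is bounded by U powr (\<beta> - 1).\<close>

lemma pogorelov_estimate:
  fixes \<Omega> :: "(real^'n) set" and u :: "real^'n \<Rightarrow> real" and f :: "(real^'n) \<times> real \<times> (real^'n) \<Rightarrow> real"
    and k :: nat and M :: real
  assumes k: "1 \<le> k" "k < CARD('n)"
    and dom: "smooth_bounded_convex_domain \<Omega>"
    and f: "C11_rhs \<Omega> f" "\<forall>w \<in> closure \<Omega> \<times> UNIV \<times> UNIV. f w > 0"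
    and u: "Ck_closure 4 \<Omega> u" "convex_on \<Omega> u"
    and eqn: "\<forall>x\<in>\<Omega>. hess_quot k (hessian u x) = f (x, u x, grad u x)"
    and bc: "\<forall>x\<in>frontier \<Omega>. u x = 0" and UM: "C01_norm (closure \<Omega>) u \<le> M"
    and x: "x \<in> \<Omega>"
  defines "d \<equiv> diameter \<Omega>" and "U \<equiv> C01_norm (closure \<Omega>) u" and "m \<equiv> rhs_min \<Omega> M f"
    and "K \<equiv> rhs_norm \<Omega> M f" and "n \<equiv> real CARD('n)"
  defines "A \<equiv> 4 * (2 * K * (2 + U\<^sup>2) / m + 1)"
  defines "\<beta> \<equiv> 32 * n + 4 * \<bar>A\<bar> * d\<^sup>2"
  shows "(- u x) powr \<beta> / lambda_min (hessian u x)
    \<le> U powr (\<beta> - 1) * (\<beta> * n + (K * U + K * A * d * U + K * \<beta> * U) / m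
       + U * ((1 + 16 * n) * n * max 1 (1 / m))) * exp (A / 2 * d\<^sup>2)" (is "_ \<le> _ * ?C * _")
proof -
  have \<Omega>: "open \<Omega>" "\<Omega> \<noteq> {}" "bounded \<Omega>" "convex \<Omega>"
    using dom by (auto simp: smooth_bounded_convex_domain_def)
  have u4: "Ck_on 4 \<Omega> u" and uc: "continuous_on (closure \<Omega>) u" using u(1) by (auto simp: Ck_closure_def)
  have f1: "Ck_on 1 (\<Omega> \<times> UNIV \<times> UNIV) f" using f(1) by (auto simp: C11_rhs_def Ck_closure_def)
  have bd: "\<bar>u y\<bar> \<le> U" "norm (grad u y) \<le> U" if "y \<in> \<Omega>" for y
    using C01_norm_bounds[OF u(1) _ \<Omega>, of y] that closure_subset[of \<Omega>] unfolding U_def by auto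
  have UM': "U \<le> M" using UM by (simp add: U_def)
  have M0: "M \<ge> 0" using bd(1)[OF x] UM' by linarith
  let ?W = "\<Omega> \<times> {-M..M} \<times> cball (0::real^'n) M"
  have m: "m > 0" "\<And>w. w \<in> ?W \<Longrightarrow> m \<le> f w"
    using rhs_min_bounds[OF f \<Omega>(2,3) M0] closure_subset[of \<Omega>] unfolding m_def by auto
  have K: "\<And>w. w \<in> ?W \<Longrightarrow> norm (grad f w) \<le> K"
    "\<And>w w'. w \<in> ?W \<Longrightarrow> w' \<in> ?W \<Longrightarrow> norm (grad f w - grad f w') \<le> K * norm (w - w')"
    using rhs_norm_bounds[OF f(1) \<Omega>(1-3) M0] unfolding K_def by blast+
  have inW: "(y, u y, grad u y) \<in> ?W" if "y \<in> \<Omega>" for y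
    using bd[OF that] that UM' by (auto simp: abs_le_iff)
  have K0: "K \<ge> 0" using K(1)[OF inW[OF x]] norm_ge_zero order_trans by blast
  have A: "A \<ge> 4" using K0 m(1) by (simp add: A_def)
  have n1: "n \<ge> 1" using k by (simp add: n_def)
  have "\<beta> \<ge> 32 * n" "\<beta> \<ge> 4 * A * d\<^sup>2" using A n1 by (auto simp: \<beta>_def)
  hence \<beta>: "\<beta> \<ge> 32 * n" "\<beta> \<ge> 4 * A * d\<^sup>2" "\<beta> \<ge> 32" using n1 by linarith+
  have hq: "hess_quot k (hessian u y) \<ge> m" if "y \<in> \<Omega>" for y using eqn that m(2)[OF inW[OF that]] by simp
  have eig: "\<exists>e l. orthonormal_family e \<and> (\<forall>i::'n. hessian u y *v e i = l i *\<^sub>R e i) \<and> (\<forall>i. 0 < l i)"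
    if y: "y \<in> \<Omega>" for y
  proof -
    obtain e l where el: "orthonormal_family e" "\<And>i::'n. hessian u y *v e i = l i *\<^sub>R e i"
      using symmetric_eigenbasis[OF hessian_symmetric[OF u4 \<Omega>(1) _ y]] by auto
    have "l i > 0" for i
    proof -
      have "0 \<le> e i \<bullet> (hessian u y *v e i)" by (rule hessian_nonneg[OF u4 _ \<Omega>(1) y u(2)]) simp
      hence "0 \<le> l i" using el by (simp add: orthonormal_family_def)
      moreover have "l i \<noteq> 0" using hess_quot_nonzero_eigenvalues[OF el, of k i] hq[OF y] m(1) by simp
      ultimately show ?thesis by simp
    qed
    thus ?thesis using el by blast
  qed
  have min_ev: "\<exists>r. \<forall>i. l r \<le> l i" for l :: "'n \<Rightarrow> real"
  proof -
    have "Min (range l) \<in> range l" by (intro Min_in) auto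
    then obtain r where r: "Min (range l) = l r" by (rule rangeE)
    have "l r \<le> l i" for i using Min_le[of "range l" "l i"] unfolding r by simp
    thus ?thesis by blast
  qed
  have pos: "0 < v \<bullet> (hessian u y *v v)" if y: "y \<in> \<Omega>" and v: "v \<noteq> 0" for y v
  proof -
    obtain e l where el: "orthonormal_family e" "\<And>i::'n. hessian u y *v e i = l i *\<^sub>R e i" "\<And>i. 0 < l i"
      using eig[OF y] by blast
    obtain r where r: "\<And>i. l r \<le> l i" using min_ev by blast
    have "0 < l r * (v \<bullet> v)" using el(3)[of r] v by simp
    also have "\<dots> \<le> v \<bullet> (hessian u y *v v)" by (rule quadratic_form_ge[OF el(1,2) r])
    finally show ?thesis .
  qed
  have neg: "u y < 0" if "y \<in> \<Omega>" for y
    by (rule negative_of_zero_boundary[OF u4 _ uc _ \<Omega>(1,3) pos that]) (use bc in auto)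
  have "\<exists>B. \<forall>y\<in>\<Omega>. \<bar>hessian u y $ i $ j\<bar> \<le> B" for i j
  proof -
    obtain B where "\<And>y. y \<in> \<Omega> \<Longrightarrow> \<bar>partials [axis i 1, axis j 1] u y\<bar> \<le> B"
      by (rule Ck_closure_partials_bounded[OF u(1) \<Omega>(3), of "[axis i 1, axis j 1]"]) (auto simp: axis_in_Basis_iff)
    thus ?thesis by (auto simp: hessian_def simp del: partials.simps)
  qed
  then obtain B where B: "\<And>i j y. y \<in> \<Omega> \<Longrightarrow> \<bar>hessian u y $ i $ j\<bar> \<le> B i j" by metis
  define L where "L = (\<Sum>i\<in>UNIV. \<Sum>j\<in>UNIV. B i j)"
  have HL: "v \<bullet> (hessian u y *v v) \<le> L" if y: "y \<in> \<Omega>" and v: "norm v = 1" for y v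
  proof -
    have v1: "\<bar>v $ i\<bar> \<le> 1" for i using component_le_norm_cart[of v i] v by simp
    have "v \<bullet> (hessian u y *v v) = (\<Sum>i\<in>UNIV. \<Sum>j\<in>UNIV. v $ i * (hessian u y $ i $ j * v $ j))"
      by (simp add: inner_vec_def matrix_vector_mult_def sum_distrib_left)
    also have "\<dots> \<le> L" unfolding L_def
    proof (intro sum_mono)
      fix i j
      have "v $ i * (hessian u y $ i $ j * v $ j) \<le> \<bar>v $ i\<bar> * (\<bar>hessian u y $ i $ j\<bar> * \<bar>v $ j\<bar>)"
        by (metis abs_ge_self abs_mult)
      also have "\<dots> \<le> 1 * (B i j * 1)"
        using v1 B[OF y] by (intro mult_mono) (auto intro: order_trans[OF abs_ge_zero])
      finally show "v $ i * (hessian u y $ i $ j * v $ j) \<le> B i j" by simp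
    qed
    finally show ?thesis .
  qed
  \<comment> \<open>A crude bound that depends on the size of D^2u through L. It secures the
    existence of the maximum and does not enter the final constant.\<close>
  define c0 where "c0 = m * (1 / L) ^ (k - 1)"
  have ev_lower: "c0 \<le> l i" if y: "y \<in> \<Omega>" and el: "orthonormal_family e" "\<And>i::'n. hessian u y *v e i = l i *\<^sub>R e i" "\<And>i. 0 < l i"
    for y e l i
    unfolding c0_def
  proof (rule eigenvalue_lower_bound[OF el(3) _ k(1) less_imp_le[OF k(2)] m(1)])
    fix j
    have ee: "e j \<bullet> e j = 1" using el(1) by (simp add: orthonormal_family_def)
    hence "norm (e j) = 1" by (simp add: norm_eq_sqrt_inner)
    from HL[OF y this] show "l j \<le> L" using ee by (simp add: el(2))
  next
    have "hess_quot k (hessian u y) = 1 / esym (int k) UNIV (\<lambda>i. 1 / l i)"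
      using el(3) k by (intro hess_quot_eigenbasis[OF el(1,2)]) (auto simp: less_imp_neq[symmetric])
    thus "m \<le> 1 / esym (int k) UNIV (\<lambda>i. 1 / l i)" using hq[OF y] by simp
  qed
  have L0: "L > 0"
  proof -
    obtain v :: "real^'n" where v: "v \<in> Basis" using nonempty_Basis by blast
    show ?thesis using HL[OF x norm_Basis[OF v]] pos[OF x nonzero_Basis[OF v]] by linarith
  qed
  have c0: "c0 > 0" using m(1) L0 by (simp add: c0_def)
  have lower: "c0 \<le> v \<bullet> (hessian u y *v v)" if y: "y \<in> \<Omega>" and v: "norm v = 1" for y v
  proof -
    obtain e l where el: "orthonormal_family e" "\<And>i::'n. hessian u y *v e i = l i *\<^sub>R e i" "\<And>i. 0 < l i"
      using eig[OF y] by blast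
    have "c0 * (v \<bullet> v) \<le> v \<bullet> (hessian u y *v v)" by (rule quadratic_form_ge[OF el(1,2) ev_lower[OF y el]])
    thus ?thesis using v by (simp add: dot_square_norm)
  qed
  have dist_d: "norm (y - x) \<le> d" if "y \<in> \<Omega>" for y
    using diameter_bounded_bound[OF \<Omega>(3) that x] by (simp add: d_def dist_norm)
  have dist_d2: "(y - x) \<bullet> (y - x) \<le> d\<^sup>2" if "y \<in> \<Omega>" for y
    using power_mono[OF dist_d[OF that], of 2] by (simp add: power2_norm_eq_inner)
  define \<theta> where "\<theta> y = \<beta> * ln (- u y) + A / 2 * ((y - x) \<bullet> (y - x))" for y
  have \<beta>A: "\<beta> > 0" "A \<ge> 0" using \<beta>(3) A by auto
  obtain x0 v0 where x0: "x0 \<in> \<Omega>" "norm v0 = 1"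
    and mx: "\<And>y v. y \<in> \<Omega> \<Longrightarrow> norm v = 1 \<Longrightarrow> exp (\<theta> y) / (v \<bullet> (hessian u y *v v)) \<le> exp (\<theta> x0) / (v0 \<bullet> (hessian u x0 *v v0))"
    unfolding \<theta>_def
    by (rule weighted_quotient_attains_max[OF u4 _ uc _ neg \<Omega>(1-3) c0 lower \<beta>A dist_d2]) (use bc in auto)
  have v00: "v0 \<noteq> 0" using x0(2) by auto
  define q0 where "q0 = v0 \<bullet> (hessian u x0 *v v0)"
  have q0: "q0 > 0" unfolding q0_def by (rule pos[OF x0(1) v00])
  \<comment> \<open>The reciprocal of the maximal quotient. Maximality thereby becomes the
    quadratic-form inequality \<open>max2\<close>, with equality at x0.\<close>
  define \<kappa> where "\<kappa> = q0 / exp (\<theta> x0)"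
  have \<kappa>: "\<kappa> > 0" using q0 by (simp add: \<kappa>_def)
  have max1: "\<kappa> * exp (\<theta> y) \<le> v \<bullet> (hessian u y *v v)" if y: "y \<in> \<Omega>" and v: "norm v = 1" for y v
  proof -
    have "v \<noteq> 0" using v by auto
    from mx[OF y v] pos[OF y this] q0 show ?thesis
      unfolding \<kappa>_def q0_def[symmetric] by (simp add: field_simps)
  qed
  have max2: "\<kappa> * (v \<bullet> v) * exp (\<theta> y) \<le> v \<bullet> (hessian u y *v v)" if y: "y \<in> \<Omega>" for y v
  proof (cases "v = 0")
    case False
    define w where "w = (1 / norm v) *\<^sub>R v"
    have w: "norm w = 1" "v = norm v *\<^sub>R w" using False by (auto simp: w_def)
    have "v \<bullet> (hessian u y *v v) = (norm v)\<^sup>2 * (w \<bullet> (hessian u y *v w))"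
      by (subst (1 2) w(2)) (simp add: matrix_vector_mult_scaleR power2_eq_square)
    moreover have "(norm v)\<^sup>2 * (\<kappa> * exp (\<theta> y)) \<le> (norm v)\<^sup>2 * (w \<bullet> (hessian u y *v w))"
      using max1[OF y w(1)] by (intro mult_left_mono) auto
    ultimately show ?thesis by (simp add: power2_norm_eq_inner mult_ac)
  qed simp
  obtain e l where el: "orthonormal_family e" "\<And>i::'n. hessian u x0 *v e i = l i *\<^sub>R e i" "\<And>i. 0 < l i"
    using eig[OF x0(1)] by blast
  obtain r where r: "\<And>i. l r \<le> l i" using min_ev by blast
  have enorm: "e i \<bullet> e i = 1" for i using el(1) by (simp add: orthonormal_family_def)
  \<comment> \<open>The maximising direction v0 need not be the basis vector e r, but the quadratic
    form takes the smallest eigenvalue as its value on both.\<close>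
  have lr: "l r = \<kappa> * exp (\<theta> x0)"
  proof (rule antisym)
    have "l r * (v0 \<bullet> v0) \<le> q0" unfolding q0_def by (rule quadratic_form_ge[OF el(1,2) r])
    thus "l r \<le> \<kappa> * exp (\<theta> x0)" using x0(2) by (simp add: \<kappa>_def dot_square_norm)
    show "\<kappa> * exp (\<theta> x0) \<le> l r" using max2[OF x0(1), of "e r"] enorm by (simp add: el(2))
  qed
  have est: "- u x0 / l r \<le> ?C"
    using A_def by (intro maximum_point_estimate[OF \<Omega>(1) x0(1) \<Omega>(4) u4 el(1,2,3) r k n_def[THEN meta_eq_to_obj_eq] f1 _ bd UM' m K
      dist_d[OF x0(1)] neg _ \<beta>(1,2) max2[unfolded \<theta>_def] lr[unfolded \<theta>_def]]) (use eqn in auto)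
  have s0: "0 \<le> - u x0 / l r" using neg[OF x0(1)] el(3)[of r] by (intro divide_nonneg_pos) auto
  have C0: "0 \<le> ?C" using order_trans[OF s0 est] .
  obtain e' l' where el': "orthonormal_family e'" "\<And>i::'n. hessian u x *v e' i = l' i *\<^sub>R e' i" "\<And>i. 0 < l' i"
    using eig[OF x] by blast
  have "Min (range l') \<in> range l'" by (intro Min_in) auto
  then obtain j where "Min (range l') = l' j" by (rule rangeE)
  hence j: "lambda_min (hessian u x) = l' j" unfolding lambda_min_eigenbasis[OF el'(1,2)] .
  have "e' j \<bullet> e' j = 1" using el'(1) by (simp add: orthonormal_family_def)
  hence lj: "\<kappa> * exp (\<theta> x) \<le> l' j" using max2[OF x, of "e' j"] by (simp add: el'(2))
  have ux: "(- u x) powr \<beta> = exp (\<theta> x)" using neg[OF x] by (simp add: powr_def \<theta>_def)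
  have "(- u x) powr \<beta> / lambda_min (hessian u x) \<le> (- u x) powr \<beta> / (\<kappa> * exp (\<theta> x))"
    unfolding j using lj \<kappa> el'(3)[of j] by (intro divide_left_mono) auto
  also have "\<dots> = 1 / \<kappa>" unfolding ux by simp
  also have "\<dots> = exp (\<theta> x0) / l r" unfolding lr using \<kappa> by simp
  also have "exp (\<theta> x0) = (- u x0) powr (\<beta> - 1) * (- u x0) * exp (A / 2 * ((x0 - x) \<bullet> (x0 - x)))"
    using neg[OF x0(1)] by (simp add: \<theta>_def exp_add powr_def exp_diff algebra_simps)
  also have "(- u x0) powr (\<beta> - 1) * (- u x0) * exp (A / 2 * ((x0 - x) \<bullet> (x0 - x))) / l r
    = (- u x0) powr (\<beta> - 1) * (- u x0 / l r) * exp (A / 2 * ((x0 - x) \<bullet> (x0 - x)))" by simp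
  also have "\<dots> \<le> U powr (\<beta> - 1) * ?C * exp (A / 2 * d\<^sup>2)"
  proof (intro mult_mono est)
    show "(- u x0) powr (\<beta> - 1) \<le> U powr (\<beta> - 1)"
      using neg[OF x0(1)] bd(1)[OF x0(1)] \<beta>(3) by (intro powr_mono2) auto
    show "exp (A / 2 * ((x0 - x) \<bullet> (x0 - x))) \<le> exp (A / 2 * d\<^sup>2)"
      using dist_d2[OF x0(1)] A by (simp add: mult_left_mono)
  qed (use C0 s0 in \<open>auto intro!: mult_nonneg_nonneg\<close>)
  finally show ?thesis .
qed

theorem lemma4p1:
  fixes k :: nat
  assumes "CARD('n::finite) \<ge> 2" and "1 \<le> k" and "k < CARD('n)"
  shows "\<exists>\<beta> C :: real \<Rightarrow> real \<Rightarrow> real \<Rightarrow> real \<Rightarrow> real.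
    (\<forall>d U m K. \<beta> d U m K > 0 \<and> C d U m K > 0) \<and>
    (\<forall>(\<Omega> :: (real^'n) set) (f :: (real^'n) \<times> real \<times> (real^'n) \<Rightarrow> real) (u :: real^'n \<Rightarrow> real) (M :: real).
       smooth_bounded_convex_domain \<Omega> \<and>
       C11_rhs \<Omega> f \<and> (\<forall>w \<in> closure \<Omega> \<times> UNIV \<times> UNIV. f w > 0) \<and>
       Ck_closure 4 \<Omega> u \<and> convex_on \<Omega> u \<and>
       (\<forall>x\<in>\<Omega>. hess_quot k (hessian u x) = f (x, u x, grad u x)) \<and>
       (\<forall>x\<in>frontier \<Omega>. u x = 0) \<and>
       C01_norm (closure \<Omega>) u \<le> M \<longrightarrow>
       (let d = diameter \<Omega>; U = C01_norm (closure \<Omega>) u; m = rhs_min \<Omega> M f; K = rhs_norm \<Omega> M f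
        in \<forall>x\<in>\<Omega>. (- u x) powr (\<beta> d U m K) / lambda_min (hessian u x) \<le> C d U m K))"
proof -
  define n where "n = real CARD('n)"
  define A :: "real \<Rightarrow> real \<Rightarrow> real \<Rightarrow> real" where "A U m K = 4 * (2 * K * (2 + U\<^sup>2) / m + 1)" for U m K
  \<comment> \<open>Positivity is demanded at all real arguments, also at those that no solution
    produces; hence the absolute value here and the bound 1 + |C| below.\<close>
  define \<beta> where "\<beta> d U m K = 32 * n + 4 * \<bar>A U m K\<bar> * d\<^sup>2" for d U m K
  define C where "C d U m K = U powr (\<beta> d U m K - 1) * (\<beta> d U m K * n
    + (K * U + K * A U m K * d * U + K * \<beta> d U m K * U) / m
    + U * ((1 + 16 * n) * n * max 1 (1 / m))) * exp (A U m K / 2 * d\<^sup>2)" for d U m K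
  have "n > 0" by (simp add: n_def)
  hence pos: "\<beta> d U m K > 0 \<and> 1 + \<bar>C d U m K\<bar> > 0" for d U m K
    unfolding \<beta>_def by (auto intro!: add_pos_nonneg)
  have le: "y \<le> 1 + \<bar>C d U m K\<bar>" if "y \<le> C d U m K" for y d U m K using that by linarith
  show ?thesis
    using pos pogorelov_estimate[OF assms(2,3), folded n_def, folded A_def, folded \<beta>_def, folded C_def]
    by (intro exI[of _ \<beta>] exI[of _ "\<lambda>d U m K. 1 + \<bar>C d U m K\<bar>"]) (auto simp: Let_def intro!: le)
qed

end
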